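(* Let $A=(a_{ij})_{1\le i,j\le n}$ be a symmetric matrix with $a_{ij}\ge0$ and let $\lambda>0$. The following are equivalent: (i) $A$ has eigenvalues $\mu_1>0\ge\mu_2\ge\cdots\ge\mu_n$, and the convex hull of the column vectors $\{\vec a_i\}_{i=1}^n$, $\vec a_i=(a_{i1},\dots,a_{in})$, contains $(e,\dots,e)$ as a (relative) interior point for some $e>0$; (ii) the minimization $$M_\lambda=\inf\{I(\vec u)\mid I'(\vec u)(\vec u)=0,\ \vec u\in\mathbf{H}\setminus\{0\}\}$$ is attained by a positive vector solution $\vec cU\in\mathbb{R}^nU$ of the system $-\Delta u_i+\lambda u_i=\sum_{j=1}^na_{ij}u_iu_j^2$ in $\Omega$, $u_i\in H$, $1\le i\le n$, where $U$ is a least energy solution of $\Delta u-\lambda u+u^3=0$ in $\Omega$, $u=0$ on $\partial\Omega$.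
   Context: $\Omega\subset\mathbb{R}^N$ is a domain, $N\le 3$. $H=H^1_0(\Omega)$, except that if $\Omega=\mathbb{R}^N$ then $H$ is the subspace of radially symmetric functions in $H^1(\mathbb{R}^N)$; $\mathbf{H}=H^n$. It is assumed that the scalar equation $\Delta u-\lambda u+u^3=0$ in $\Omega$, $u=0$ on $\partial\Omega$, has a least energy positive solution in $H$. $\mathbb{R}^nU=\{\vec cU\mid\vec c\in\mathbb{R}^n\}$. A positive vector solution is a solution with $u_i>0$ in $\Omega$ for every $i$. The energy functional on $\mathbf{H}$ is $I(\vec u)=\frac12\sum_{i=1}^n\int_\Omega(|\nabla u_i|^2+\lambda u_i^2)\,dx-\frac14\int_\Omega\sum_{i,j=1}^na_{ij}u_i^2u_j^2\,dx$. The relative interior of the convex hull is its interior within its affine hull, i.e. the set of convex combinations of the $\vec a_i$ with all coefficients strictly positive. *)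

theory Defs
  imports "HOL-Analysis.Analysis" "HOL-Computational_Algebra.Polynomial"
begin

definition charpoly :: "real ^ 'n ^ 'n \<Rightarrow> real poly" where
  "charpoly A = det (\<chi> i j. (if i = j then [:0, 1:] else 0) - [:A $ i $ j:])"

(* mu 1, ..., mu n are the eigenvalues of A, repeated according to multiplicity. *)
definition eigenvalue_seq :: "real ^ 'n ^ 'n \<Rightarrow> (nat \<Rightarrow> real) \<Rightarrow> bool" where
  "eigenvalue_seq A \<mu> \<longleftrightarrow> charpoly A = (\<Prod>k = 1..CARD('n). [:- \<mu> k, 1:])"

fun is_Ck :: "nat \<Rightarrow> ('a :: euclidean_space \<Rightarrow> real) \<Rightarrow> bool" where
  "is_Ck 0 f \<longleftrightarrow> continuous_on UNIV f"
| "is_Ck (Suc k) f \<longleftrightarrow> (\<forall>x. f differentiable (at x)) \<and>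
     (\<forall>b\<in>Basis. is_Ck k (\<lambda>x. frechet_derivative f (at x) b))"

definition grad :: "('a :: euclidean_space \<Rightarrow> real) \<Rightarrow> 'a \<Rightarrow> 'a" where
  "grad f x = (\<Sum>b\<in>Basis. frechet_derivative f (at x) b *\<^sub>R b)"

definition test_functions :: "'a :: euclidean_space set \<Rightarrow> ('a \<Rightarrow> real) set" where
  "test_functions \<Omega> = {\<phi>. (\<forall>k. is_Ck k \<phi>) \<and> compact (closure {x. \<phi> x \<noteq> 0}) \<and>
     closure {x. \<phi> x \<noteq> 0} \<subseteq> \<Omega>}"

(* Elements of the function spaces over Omega below are functions on the whole space, of which
   only the restriction to Omega matters, and that only up to null sets. *)

definition L2 :: "'a :: euclidean_space set \<Rightarrow> ('a \<Rightarrow> 'b :: euclidean_space) set" where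
  "L2 \<Omega> = {f. set_borel_measurable lebesgue \<Omega> f \<and>
     set_integrable lebesgue \<Omega> (\<lambda>x. (norm (f x))\<^sup>2)}"

definition L2_weak_gradient :: "'a :: euclidean_space set \<Rightarrow> ('a \<Rightarrow> real) \<Rightarrow> ('a \<Rightarrow> 'a) \<Rightarrow> bool" where
  "L2_weak_gradient \<Omega> u g \<longleftrightarrow> g \<in> L2 \<Omega> \<and> (\<forall>\<phi>\<in>test_functions \<Omega>.
     (LINT x:\<Omega>|lebesgue. u x *\<^sub>R grad \<phi> x) = - (LINT x:\<Omega>|lebesgue. \<phi> x *\<^sub>R g x))"

definition H1 :: "'a :: euclidean_space set \<Rightarrow> ('a \<Rightarrow> real) set" where
  "H1 \<Omega> = {u. u \<in> L2 \<Omega> \<and> (\<exists>g. L2_weak_gradient \<Omega> u g)}"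

(* Determined almost everywhere on Omega if u is in H1 Omega. *)
definition wgrad :: "'a :: euclidean_space set \<Rightarrow> ('a \<Rightarrow> real) \<Rightarrow> 'a \<Rightarrow> 'a" where
  "wgrad \<Omega> u = (SOME g. L2_weak_gradient \<Omega> u g)"

definition H1_norm :: "'a :: euclidean_space set \<Rightarrow> ('a \<Rightarrow> real) \<Rightarrow> real" where
  "H1_norm \<Omega> u = sqrt (LINT x:\<Omega>|lebesgue. (norm (wgrad \<Omega> u x))\<^sup>2 + (u x)\<^sup>2)"

definition H10 :: "'a :: euclidean_space set \<Rightarrow> ('a \<Rightarrow> real) set" where
  "H10 \<Omega> = {u \<in> H1 \<Omega>. \<exists>\<phi>. (\<forall>k. \<phi> k \<in> test_functions \<Omega>) \<and>
     (\<lambda>k. H1_norm \<Omega> (\<lambda>x. \<phi> k x - u x)) \<longlonglongrightarrow> 0}"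

definition radial :: "('a :: euclidean_space \<Rightarrow> real) \<Rightarrow> bool" where
  "radial u \<longleftrightarrow> (\<exists>f. AE x in lebesgue. u x = f (norm x))"

definition Hspace :: "'a :: euclidean_space set \<Rightarrow> ('a \<Rightarrow> real) set" where
  "Hspace \<Omega> = (if \<Omega> = UNIV then {u \<in> H1 UNIV. radial u} else H10 \<Omega>)"

definition zero_on :: "'a :: euclidean_space set \<Rightarrow> ('a \<Rightarrow> real) \<Rightarrow> bool" where
  "zero_on \<Omega> u \<longleftrightarrow> (AE x in lebesgue. x \<in> \<Omega> \<longrightarrow> u x = 0)"

definition positive_on :: "'a :: euclidean_space set \<Rightarrow> ('a \<Rightarrow> real) \<Rightarrow> bool" where
  "positive_on \<Omega> u \<longleftrightarrow> (AE x in lebesgue. x \<in> \<Omega> \<longrightarrow> u x > 0)"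

definition scalar_energy :: "'a :: euclidean_space set \<Rightarrow> real \<Rightarrow> ('a \<Rightarrow> real) \<Rightarrow> real" where
  "scalar_energy \<Omega> lam u =
     1/2 * (LINT x:\<Omega>|lebesgue. (norm (wgrad \<Omega> u x))\<^sup>2 + lam * (u x)\<^sup>2)
     - 1/4 * (LINT x:\<Omega>|lebesgue. (u x)^4)"

(* The derivative at t = 0 of the energy along u + t u is the derivative of the energy at u
   applied to the direction u. *)
definition scalar_nehari :: "'a :: euclidean_space set \<Rightarrow> real \<Rightarrow> ('a \<Rightarrow> real) set" where
  "scalar_nehari \<Omega> lam = {u \<in> Hspace \<Omega>. \<not> zero_on \<Omega> u \<and>
     ((\<lambda>t. scalar_energy \<Omega> lam (\<lambda>x. u x + t * u x)) has_real_derivative 0) (at 0)}"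

(* Weak solutions; the boundary condition is part of membership in Hspace. *)
definition scalar_solution :: "'a :: euclidean_space set \<Rightarrow> real \<Rightarrow> ('a \<Rightarrow> real) \<Rightarrow> bool" where
  "scalar_solution \<Omega> lam u \<longleftrightarrow> u \<in> Hspace \<Omega> \<and> (\<forall>\<phi>\<in>test_functions \<Omega>.
     (LINT x:\<Omega>|lebesgue. wgrad \<Omega> u x \<bullet> grad \<phi> x + lam * u x * \<phi> x)
     = (LINT x:\<Omega>|lebesgue. (u x)^3 * \<phi> x))"

(* "Least energy" refers to the infimum over the Nehari set. *)
definition least_energy_solution :: "'a :: euclidean_space set \<Rightarrow> real \<Rightarrow> ('a \<Rightarrow> real) \<Rightarrow> bool" where
  "least_energy_solution \<Omega> lam u \<longleftrightarrow> scalar_solution \<Omega> lam u \<and> u \<in> scalar_nehari \<Omega> lam \<and>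
     scalar_energy \<Omega> lam u = Inf (scalar_energy \<Omega> lam ` scalar_nehari \<Omega> lam)"

definition energy ::
  "'a :: euclidean_space set \<Rightarrow> real \<Rightarrow> real ^ 'n ^ 'n \<Rightarrow> ('n \<Rightarrow> 'a \<Rightarrow> real) \<Rightarrow> real" where
  "energy \<Omega> lam A u =
     1/2 * (\<Sum>i\<in>UNIV. LINT x:\<Omega>|lebesgue. (norm (wgrad \<Omega> (u i) x))\<^sup>2 + lam * (u i x)\<^sup>2)
     - 1/4 * (LINT x:\<Omega>|lebesgue. (\<Sum>i\<in>UNIV. \<Sum>j\<in>UNIV. A $ i $ j * (u i x)\<^sup>2 * (u j x)\<^sup>2))"

definition nehari ::
  "'a :: euclidean_space set \<Rightarrow> real \<Rightarrow> real ^ 'n ^ 'n \<Rightarrow> ('n \<Rightarrow> 'a \<Rightarrow> real) set" where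
  "nehari \<Omega> lam A = {u. (\<forall>i. u i \<in> Hspace \<Omega>) \<and> \<not> (\<forall>i. zero_on \<Omega> (u i)) \<and>
     ((\<lambda>t. energy \<Omega> lam A (\<lambda>i x. u i x + t * u i x)) has_real_derivative 0) (at 0)}"

(* On the Nehari set the energy is nonnegative if lam is, so Inf is a genuine infimum
   whenever the set is nonempty. *)
definition Mval :: "'a :: euclidean_space set \<Rightarrow> real \<Rightarrow> real ^ 'n ^ 'n \<Rightarrow> real" where
  "Mval \<Omega> lam A = Inf (energy \<Omega> lam A ` nehari \<Omega> lam A)"

definition system_solution ::
  "'a :: euclidean_space set \<Rightarrow> real \<Rightarrow> real ^ 'n ^ 'n \<Rightarrow> ('n \<Rightarrow> 'a \<Rightarrow> real) \<Rightarrow> bool" where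
  "system_solution \<Omega> lam A u \<longleftrightarrow> (\<forall>i. u i \<in> Hspace \<Omega> \<and> (\<forall>\<phi>\<in>test_functions \<Omega>.
     (LINT x:\<Omega>|lebesgue. wgrad \<Omega> (u i) x \<bullet> grad \<phi> x + lam * u i x * \<phi> x)
     = (LINT x:\<Omega>|lebesgue. (\<Sum>j\<in>UNIV. A $ i $ j * u i x * (u j x)\<^sup>2) * \<phi> x)))"

end

theory Submission
  imports Defs
begin

text \<open>
  For \<open>c\<close> with nonzero entries put \<open>d = (c\<^sub>1\<^sup>2, \<dots>, c\<^sub>n\<^sup>2)\<close>. The multiple \<open>c U\<close> solves
  the system iff \<open>A d = (1, \<dots>, 1)\<close>, and the convex hull condition says exactly that such a
  positive \<open>d\<close> exists. Given \<open>d\<close>, the matrix \<open>A\<close> has exactly one positive eigenvalue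
  iff its quadratic form satisfies the reverse Cauchy-Schwarz inequality
  \<open>\<langle>A x, x\<rangle> \<Sum>d\<^sub>i \<le> (\<Sum>x\<^sub>i)\<^sup>2\<close>, or, equivalently, is nonpositive on \<open>\<Sum>x\<^sub>i = 0\<close>. Applied to
  \<open>x\<^sub>i = u\<^sub>i\<^sup>2\<close> and combined with \<open>\<parallel>U\<parallel>\<^sup>2 \<integral>v\<^sup>4 \<le> \<parallel>v\<parallel>\<^sup>4\<close>, which is the least energy property of
  \<open>U\<close>, the inequality bounds the energy on the Nehari set below by that of \<open>c U\<close>. Conversely, a
  direction \<open>x\<close> with \<open>\<Sum>x\<^sub>i = 0\<close> and \<open>\<langle>A x, x\<rangle> > 0\<close> would let \<open>sqrt (d + t x) U\<close>, rescaled to the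
  Nehari set, have less energy than \<open>c U\<close>.

  No Sobolev embedding is needed: the least energy property bounds the \<open>L\<^sup>4\<close> norm of those elements
  of the space which are in \<open>L\<^sup>4\<close>, and the other elements are limits of such (test functions, or
  averages over small balls in the radial case), so Fatou's lemma puts the whole space in \<open>L\<^sup>4\<close>.
\<close>

section \<open>Symmetric matrices with one positive eigenvalue\<close>

text \<open>On the Nehari set the quadratic part of the energy equals the quartic one, so the energy
  is a quarter of \<Sum>\<parallel>u_i\<parallel>^2 and only this sum has to be bounded below. For
  multiples of \<open>U\<close> the problem is finite-dimensional in d_i = c_i^2, because
  \<integral>U^4 = \<parallel>U\<parallel>^2. The reverse Cauchy-Schwarz inequality has sums in
  place of forms because A d = (1, ..., 1) turns <A d, d> into the sum of the d_i and <A d, x> into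
  the sum of the x_i.

  The obstacle is integrability. A nonexistent integral has the value 0, so the least energy
  inequality says nothing about a v with v^4 not integrable, while \<integral>(\<Sum>u_i^2)^2 splits
  into mixed terms only if each of them is integrable. Approximants must therefore lie in L^4 and
  also in the space on which \<open>U\<close> is minimal. If \<Omega> is not the whole space, test
  functions do. On the whole space they need not be radial; averages over balls keep radial
  functions radial, because Lebesgue measure is invariant under rotations, and averages of L^2
  functions are bounded, hence in L^4.\<close>

lemma symmetric_matrix_inner:
  fixes A :: "real ^ 'n ^ 'n"
  assumes "transpose A = A"
  shows "x \<bullet> (A *v y) = (A *v x) \<bullet> y"
  by (metis assms dot_lmul_matrix transpose_matrix_vector)

text \<open>The first-order condition at an extremum, in algebraic form; it is applied to the
  Rayleigh quotient.\<close>

lemma quadratic_nonneg_imp_linear_zero: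
  fixes a b :: real
  assumes "\<And>t. 2 * t * a + t\<^sup>2 * b \<ge> 0"
  shows "a = 0"
proof (rule ccontr)
  assume "a \<noteq> 0"
  \<comment> \<open>Any c > 0 above b works: at t = - a / c the linear term outweighs the quadratic
    one.\<close>
  define c where "c = \<bar>b\<bar> + 1"
  have c: "c > 0" "b < c" by (auto simp: c_def)
  have "2 * (- a / c) * a + (- a / c)\<^sup>2 * b = (a\<^sup>2 / c\<^sup>2) * (b - 2 * c)"
    using c by (simp add: field_simps power2_eq_square)
  also have "\<dots> < 0"
    using c \<open>a \<noteq> 0\<close> by (intro mult_pos_neg) auto
  finally show False using assms[of "- a / c"] by simp
qed

text \<open>A maximizer v of the Rayleigh quotient on the unit sphere of S is an eigenvector: by the
  first-order condition the residual l v - A v is orthogonal to S, and by invariance it lies in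
  S.\<close>

lemma symmetric_matrix_eigenvector_in_subspace:
  fixes A :: "real ^ 'n ^ 'n"
  assumes sym: "transpose A = A" and S: "subspace S"
    and inv: "\<And>x. x \<in> S \<Longrightarrow> A *v x \<in> S"
    and x0: "x0 \<in> S" "x0 \<noteq> 0"
  obtains v l where "v \<in> S" "norm v = 1" "A *v v = l *\<^sub>R v"
proof -
  let ?K = "S \<inter> sphere 0 1"
  let ?q = "\<lambda>x. x \<bullet> (A *v x)"
  have "compact ?K"
    by (intro closed_Int_compact closed_subspace S compact_sphere)
  moreover have "x0 /\<^sub>R norm x0 \<in> ?K"
    using x0 S by (auto simp: subspace_scale)
  then have "?K \<noteq> {}" by blast
  moreover have "continuous_on ?K ?q"
    by (intro continuous_intros matrix_vector_mult_linear_continuous_on)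
  ultimately obtain v where v: "v \<in> ?K" and vmax: "\<And>y. y \<in> ?K \<Longrightarrow> ?q y \<le> ?q v"
    using continuous_attains_sup[of ?K ?q] by blast
  define l where "l = ?q v"
  have vv: "v \<bullet> v = 1" using v by (auto simp: dot_square_norm)
  have q_le: "?q y \<le> l * (y \<bullet> y)" if "y \<in> S" for y
  proof (cases "y = 0")
    case False
    have "y /\<^sub>R norm y \<in> ?K" using that False S by (auto simp: subspace_scale)
    then have "?q (y /\<^sub>R norm y) \<le> l" using vmax l_def by blast
    moreover have "?q (y /\<^sub>R norm y) = ?q y / (y \<bullet> y)"
      by (simp only: matrix_vector_mult_scaleR inner_scaleR_left inner_scaleR_right dot_square_norm)
         (simp add: power2_eq_square field_simps)
    moreover have "y \<bullet> y > 0" using False by simp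
    ultimately show ?thesis by (simp add: pos_divide_le_eq)
  qed simp
  have "(l *\<^sub>R v - A *v v) \<bullet> y = 0" if y: "y \<in> S" for y
  proof (rule quadratic_nonneg_imp_linear_zero)
    fix t :: real
    have "v + t *\<^sub>R y \<in> S" using v y S by (auto simp: subspace_add subspace_scale)
    from q_le[OF this]
    have "?q v + 2 * t * ((A *v v) \<bullet> y) + t\<^sup>2 * ?q y \<le> l * (1 + 2 * t * (v \<bullet> y) + t\<^sup>2 * (y \<bullet> y))"
      using vv symmetric_matrix_inner[OF sym, of v y]
      by (simp add: matrix_vector_right_distrib matrix_vector_mult_scaleR inner_add_left
          inner_add_right inner_commute power2_eq_square algebra_simps)
    then show "0 \<le> 2 * t * ((l *\<^sub>R v - A *v v) \<bullet> y) + t\<^sup>2 * (l * (y \<bullet> y) - ?q y)"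
      by (simp add: l_def inner_diff_left algebra_simps)
  qed
  moreover have "l *\<^sub>R v - A *v v \<in> S"
    using v inv S by (auto simp: subspace_diff subspace_scale)
  ultimately have "l *\<^sub>R v - A *v v = 0" by (metis inner_eq_zero_iff)
  then show ?thesis using that[of v l] v by auto
qed

text \<open>Take an orthonormal set of eigenvectors of largest cardinality. Its orthogonal
  complement is invariant under A, so if it were nonzero it would contain a further
  eigenvector.\<close>

lemma symmetric_matrix_orthonormal_eigenbasis:
  fixes A :: "real ^ 'n ^ 'n"
  assumes sym: "transpose A = A"
  obtains f :: "'n \<Rightarrow> real ^ 'n" and l where
    "\<And>i j. f i \<bullet> f j = (if i = j then 1 else 0)" "\<And>i. A *v f i = l i *\<^sub>R f i"
    "\<And>x. x = (\<Sum>i\<in>UNIV. (x \<bullet> f i) *\<^sub>R f i)"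
proof -
  define ok where "ok B \<longleftrightarrow> pairwise orthogonal B \<and> (\<forall>b\<in>B. norm b = 1 \<and> (\<exists>l. A *v b = l *\<^sub>R b))"
    for B :: "(real ^ 'n) set"
  have indep: "independent B" if "ok B" for B
    using that by (intro pairwise_orthogonal_independent) (auto simp: ok_def)
  have bnd: "card B \<le> CARD('n)" if "ok B" for B
    using independent_card_le[OF indep[OF that]] by simp
  have "ok {}" by (simp add: ok_def)
  then obtain B where B: "ok B" and Bmax: "\<And>C. ok C \<Longrightarrow> card C \<le> card B"
    using ex_has_greatest_nat[of ok "{}" card "Suc CARD('n)"] bnd by (metis le_imp_less_Suc)
  have finB: "finite B" using indep[OF B] independent_imp_finite by blast
  define S where "S = {x. \<forall>b\<in>B. b \<bullet> x = 0}"
  have S: "subspace S" unfolding S_def by (auto simp: subspace_def inner_add_right)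
  have S0: "x = 0" if "x \<in> S" for x
  proof (rule ccontr)
    assume "x \<noteq> 0"
    have "A *v y \<in> S" if "y \<in> S" for y
      using that B symmetric_matrix_inner[OF sym] by (fastforce simp: S_def ok_def)
    then obtain v l where v: "v \<in> S" "norm v = 1" "A *v v = l *\<^sub>R v"
      using symmetric_matrix_eigenvector_in_subspace[OF sym S _ \<open>x \<in> S\<close> \<open>x \<noteq> 0\<close>] by metis
    have "v \<notin> B" using v by (auto simp: S_def)
    have "ok (insert v B)"
      using B v by (auto simp: ok_def pairwise_insert orthogonal_def S_def inner_commute)
    from Bmax[OF this] show False using finB \<open>v \<notin> B\<close> by simp
  qed
  have span: "span B = UNIV"
  proof -
    have "x \<in> span B" for x
    proof -
      obtain y z where yz: "y \<in> span B" "\<And>w. w \<in> span B \<Longrightarrow> orthogonal z w" "x = y + z"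
        using orthogonal_subspace_decomp_exists[of B x] by metis
      have "z \<in> S" using yz(2) by (auto simp: S_def orthogonal_def inner_commute span_base)
      then have "z = 0" by (rule S0)
      then show ?thesis using yz by simp
    qed
    then show ?thesis by auto
  qed
  have "card B = CARD('n)"
    using dim_eq_card[of B UNIV] indep[OF B] span by (simp add: dim_UNIV)
  then obtain f where f: "bij_betw f (UNIV :: 'n set) B"
    using finB by (metis finite_class.finite_UNIV finite_same_card_bij)
  have fB: "f i \<in> B" for i using f by (auto simp: bij_betw_def)
  obtain l where l: "\<And>i. A *v f i = l i *\<^sub>R f i"
  proof -
    have "\<forall>i. \<exists>m. A *v f i = m *\<^sub>R f i" using fB B by (auto simp: ok_def)
    then show ?thesis using that by (metis (no_types))
  qed
  have on: "f i \<bullet> f j = (if i = j then 1 else 0)" for i j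
  proof (cases "i = j")
    case True
    then show ?thesis using fB[of i] B by (auto simp: ok_def dot_square_norm)
  next
    case False
    then have "f i \<noteq> f j" using f by (auto simp: bij_betw_def inj_on_def)
    then show ?thesis using False fB[of i] fB[of j] B by (auto simp: ok_def pairwise_def orthogonal_def)
  qed
  have "x = (\<Sum>i\<in>UNIV. (x \<bullet> f i) *\<^sub>R f i)" for x
  proof -
    have "x - (\<Sum>i\<in>UNIV. (x \<bullet> f i) *\<^sub>R f i) \<in> S"
    proof -
      have "b \<bullet> (x - (\<Sum>i\<in>UNIV. (x \<bullet> f i) *\<^sub>R f i)) = 0" if "b \<in> B" for b
      proof -
        have "b \<in> range f" using that f by (simp add: bij_betw_def)
        then obtain k where k: "b = f k" by blast
        show ?thesis
          by (simp add: k inner_diff_right inner_sum_right on inner_commute if_distrib cong: if_cong)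
      qed
      then show ?thesis by (simp add: S_def)
    qed
    then show ?thesis using S0 by force
  qed
  then show ?thesis using that on l by blast
qed

section \<open>Characteristic polynomial and multiplicities of eigenvalues\<close>

text \<open>Diagonalization over the polynomial ring: with the eigenvectors as the columns of T and
  as the rows of P, (X - A) T = T D and P T = 1, so multiplicativity of the determinant gives det (X
  - A) = det D.\<close>

lemma charpoly_orthonormal_eigenbasis:
  fixes A :: "real ^ 'n ^ 'n" and f :: "'n \<Rightarrow> real ^ 'n"
  assumes on: "\<And>i j. f i \<bullet> f j = (if i = j then 1 else 0)" and ev: "\<And>i. A *v f i = l i *\<^sub>R f i"
  shows "charpoly A = (\<Prod>i\<in>UNIV. [:- l i, 1:])"
proof -
  let ?P = "\<chi> i j. [:f i $ j:] :: real poly ^ 'n ^ 'n"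
  let ?T = "\<chi> i j. [:f j $ i:] :: real poly ^ 'n ^ 'n"
  let ?M = "\<chi> i j. (if i = j then [:0, 1:] else 0) - [:A $ i $ j:] :: real poly ^ 'n ^ 'n"
  let ?D = "\<chi> i j. if i = j then [:- l i, 1:] else 0 :: real poly ^ 'n ^ 'n"
  have sum_C: "(\<Sum>k\<in>UNIV. [:g k:]) = [:\<Sum>k\<in>UNIV. g k:]" for g :: "'n \<Rightarrow> real"
    by (simp add: poly_eq_iff coeff_sum coeff_pCons split: nat.split)
  have onc: "(\<Sum>k\<in>UNIV. f i $ k * f j $ k) = (if i = j then 1 else 0)" for i j
    using on[of i j] by (simp add: inner_vec_def)
  have evc: "(\<Sum>k\<in>UNIV. A $ i $ k * f j $ k) = l j * f j $ i" for i j
    using arg_cong[OF ev[of j], of "\<lambda>v. v $ i"] by (simp add: matrix_vector_mult_def)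
  have PT: "?P ** ?T = mat 1"
    by (simp add: matrix_matrix_mult_def mat_def vec_eq_iff sum_C onc)
  have MT: "?M ** ?T = ?T ** ?D"
  proof -
    have "(\<Sum>k\<in>UNIV. ((if i = k then [:0, 1:] else 0) - [:A $ i $ k:]) * [:f j $ k:])
      = (\<Sum>k\<in>UNIV. [:f k $ i:] * (if k = j then [:- l k, 1:] else 0))" for i j
    proof -
      have "(\<Sum>k\<in>UNIV. ((if i = k then [:0, 1:] else 0) - [:A $ i $ k:]) * [:f j $ k:])
        = (\<Sum>k\<in>UNIV. (if i = k then [:0, 1:] * [:f j $ k:] else 0)) - (\<Sum>k\<in>UNIV. [:A $ i $ k * f j $ k:])"
        by (subst sum_subtractf[symmetric]) (auto intro!: sum.cong simp: algebra_simps)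
      also have "\<dots> = [:0, 1:] * [:f j $ i:] - [:l j * f j $ i:]"
        by (simp add: sum_C evc)
      also have "\<dots> = [:f j $ i:] * [:- l j, 1:]" by simp
      also have "\<dots> = (\<Sum>k\<in>UNIV. [:f k $ i:] * (if k = j then [:- l k, 1:] else 0))"
        by (simp add: if_distrib cong: if_cong)
      finally show ?thesis .
    qed
    then show ?thesis by (simp add: matrix_matrix_mult_def vec_eq_iff)
  qed
  have "charpoly A = det ?M * (det ?P * det ?T)"
    by (simp add: charpoly_def det_mul[symmetric] PT)
  also have "\<dots> = det ?P * det (?M ** ?T)" by (simp add: det_mul)
  also have "\<dots> = (det ?P * det ?T) * det ?D" by (simp add: MT det_mul)
  also have "\<dots> = det ?D" by (simp add: det_mul[symmetric] PT)
  also have "\<dots> = (\<Prod>i\<in>UNIV. [:- l i, 1:])"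
    by (subst det_diagonal) simp_all
  finally show ?thesis .
qed

text \<open>Multisets of roots keep track of multiplicities; they allow two factorizations with
  different index sets to be compared.\<close>

lemma proots_prod_linear:
  "finite I \<Longrightarrow> proots (\<Prod>i\<in>I. [:- (a i :: real), 1:]) = image_mset a (mset_set I)"
proof (induction I rule: finite_induct)
  case (insert x F)
  have "(\<Prod>i\<in>F. [:- a i, 1:]) \<noteq> 0" using insert by simp
  then have "proots ([:- a x, 1:] * (\<Prod>i\<in>F. [:- a i, 1:])) = {#a x#} + image_mset a (mset_set F)"
    using insert.IH by (subst proots_mult) auto
  then show ?case using insert.hyps by simp
qed simp


text \<open>Both factorizations have the same multiset of roots, hence the same number of positive
  ones, which is 1 for \<open>\<mu>\<close>.\<close>

lemma eigenvalue_seq_imp_one_positive: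
  fixes A :: "real ^ 'n ^ 'n" and l :: "'n \<Rightarrow> real"
  assumes cp: "charpoly A = (\<Prod>i\<in>UNIV. [:- l i, 1:])"
    and "eigenvalue_seq A \<mu>" and "\<mu> 1 > 0" and np: "\<And>k. k \<in> {2..CARD('n)} \<Longrightarrow> \<mu> k \<le> 0"
  obtains p where "l p > 0" "\<And>i. i \<noteq> p \<Longrightarrow> l i \<le> 0"
proof -
  have "(\<Prod>i\<in>UNIV. [:- l i, 1:]) = (\<Prod>k = 1..CARD('n). [:- \<mu> k, 1:])"
    using assms by (simp add: eigenvalue_seq_def)
  then have "image_mset l (mset_set UNIV) = image_mset \<mu> (mset_set {1..CARD('n)})"
    by (metis proots_prod_linear finite_class.finite_UNIV finite_atLeastAtMost)
  then have "size (filter_mset (\<lambda>r. r > 0) (image_mset l (mset_set UNIV)))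
    = size (filter_mset (\<lambda>r. r > 0) (image_mset \<mu> (mset_set {1..CARD('n)})))" by simp
  then have "card {i. l i > 0} = card {k \<in> {1..CARD('n)}. \<mu> k > 0}"
    by (simp add: filter_mset_image_mset filter_mset_mset_set)
  also have "{k \<in> {1..CARD('n)}. \<mu> k > 0} = {1}"
  proof -
    have "k = 1" if "k \<in> {1..CARD('n)}" "\<mu> k > 0" for k
      using np[of k] that by (cases "k = 1") auto
    moreover have "1 \<le> CARD('n)" by (simp add: Suc_leI)
    ultimately show ?thesis using \<open>\<mu> 1 > 0\<close> by auto
  qed
  finally obtain p where "{i. l i > 0} = {p}" by (auto simp: card_1_singleton_iff)
  then show ?thesis using that[of p] by (metis mem_Collect_eq not_less singletonD singletonI)
qed

text \<open>The positive root goes first, followed by the others in decreasing order; as these are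
  nonpositive, the whole list is decreasing.\<close>

lemma one_positive_imp_eigenvalue_seq:
  fixes A :: "real ^ 'n ^ 'n" and l :: "'n \<Rightarrow> real"
  assumes cp: "charpoly A = (\<Prod>i\<in>UNIV. [:- l i, 1:])"
    and p: "l p > 0" and np: "\<And>i. i \<noteq> p \<Longrightarrow> l i \<le> 0"
  shows "\<exists>\<mu>. eigenvalue_seq A \<mu> \<and> \<mu> 1 > 0 \<and>
    (\<forall>k\<in>{2..CARD('n)}. \<mu> k \<le> 0 \<and> \<mu> k \<le> \<mu> (k - 1))"
proof -
  define ys where "ys = rev (sorted_list_of_multiset (image_mset l (mset_set (UNIV - {p}))))"
  define xs where "xs = l p # ys"
  \<comment> \<open>The sequence is indexed from 1, the list from 0.\<close>
  define \<mu> where "\<mu> k = xs ! (k - 1)" for k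
  have ys_mset: "mset ys = image_mset l (mset_set (UNIV - {p}))"
    by (simp add: ys_def)
  have ys_set: "set ys = l ` (UNIV - {p})"
    using arg_cong[OF ys_mset, of set_mset] by simp
  have ys_np: "y \<le> 0" if "y \<in> set ys" for y
    using that np by (auto simp: ys_set)
  have ys_sorted: "sorted_wrt (\<ge>) ys"
    by (simp add: ys_def sorted_wrt_rev)
  have xs_sorted: "sorted_wrt (\<ge>) xs"
    using ys_sorted ys_np p by (force simp: xs_def)
  have xs_mset: "mset xs = image_mset l (mset_set UNIV)"
  proof -
    have "mset_set (UNIV :: 'n set) = add_mset p (mset_set (UNIV - {p}))"
      by (simp add: mset_set.remove)
    then show ?thesis by (simp add: xs_def ys_mset)
  qed
  have len: "length xs = CARD('n)"
    using arg_cong[OF xs_mset, of size] by simp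
  have "(\<Prod>k = 1..CARD('n). [:- \<mu> k, 1:]) = (\<Prod>k<length xs. [:- (xs ! k), 1:])"
    unfolding len[symmetric] \<mu>_def
    by (rule prod.reindex_bij_witness[of _ Suc "\<lambda>k. k - 1"]) auto
  also have "\<dots> = prod_list (map (\<lambda>r. [:- r, 1:]) xs)"
    by (simp add: prod.list_conv_set_nth atLeast0LessThan)
  also have "\<dots> = prod_mset (image_mset (\<lambda>r. [:- r, 1:]) (mset xs))"
    by (metis mset_map prod_mset_prod_list)
  also have "\<dots> = charpoly A"
    by (simp add: xs_mset cp prod_unfold_prod_mset multiset.map_comp comp_def)
  finally have "eigenvalue_seq A \<mu>" by (simp add: eigenvalue_seq_def)
  moreover have "\<mu> 1 > 0" using p by (simp add: \<mu>_def xs_def)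
  moreover have "\<mu> k \<le> 0 \<and> \<mu> k \<le> \<mu> (k - 1)" if k: "k \<in> {2..CARD('n)}" for k
  proof
    have "\<mu> k = ys ! (k - 2)" "k - 2 < length ys"
      using k len by (auto simp: \<mu>_def xs_def nth_Cons' numeral_2_eq_2)
    then show "\<mu> k \<le> 0" using ys_np by simp
    show "\<mu> k \<le> \<mu> (k - 1)"
      using sorted_wrt_nth_less[OF xs_sorted, of "k - 1 - 1" "k - 1"] k len by (auto simp: \<mu>_def)
  qed
  ultimately show ?thesis by blast
qed

section \<open>Signs of eigenvalues and of the quadratic form\<close>

lemma quadratic_form_orthonormal_eigenbasis:
  fixes A :: "real ^ 'n ^ 'n" and f :: "'n \<Rightarrow> real ^ 'n"
  assumes ev: "\<And>i. A *v f i = l i *\<^sub>R f i"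
    and ex: "\<And>x. x = (\<Sum>i\<in>UNIV. (x \<bullet> f i) *\<^sub>R f i)"
  shows "x \<bullet> (A *v x) = (\<Sum>i\<in>UNIV. l i * (x \<bullet> f i)\<^sup>2)"
proof -
  have "A *v x = A *v (\<Sum>i\<in>UNIV. (x \<bullet> f i) *\<^sub>R f i)" using ex by simp
  also have "\<dots> = (\<Sum>i\<in>UNIV. (x \<bullet> f i) *\<^sub>R (l i *\<^sub>R f i))"
    by (simp only: linear_sum[OF matrix_vector_mul_linear] matrix_vector_mult_scaleR ev)
  finally show ?thesis
    by (simp add: inner_sum_right power2_eq_square mult_ac)
qed

text \<open>The Cauchy-Schwarz inequality for a form of Lorentzian type. The form is nonpositive on
  the orthogonal complement of \<open>f p\<close>, and some x - s d lies there; multiplying by <A d,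
  d> and completing the square in s gives the claim.\<close>

lemma one_positive_reverse_Cauchy_Schwarz:
  fixes A :: "real ^ 'n ^ 'n" and f :: "'n \<Rightarrow> real ^ 'n"
  assumes sym: "transpose A = A"
    and ev: "\<And>i. A *v f i = l i *\<^sub>R f i"
    and ex: "\<And>x. x = (\<Sum>i\<in>UNIV. (x \<bullet> f i) *\<^sub>R f i)"
    and np: "\<And>i. i \<noteq> p \<Longrightarrow> l i \<le> 0"
    and d: "d \<bullet> (A *v d) > 0"
  shows "(x \<bullet> (A *v x)) * (d \<bullet> (A *v d)) \<le> (x \<bullet> (A *v d))\<^sup>2"
proof -
  let ?q = "\<lambda>x. x \<bullet> (A *v x)"
  note q = quadratic_form_orthonormal_eigenbasis[of A f l, OF ev ex]
  have neg: "?q z \<le> 0" if "z \<bullet> f p = 0" for z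
    unfolding q by (rule sum_nonpos) (metis np that mult_nonpos_nonneg mult_zero_right power_zero_numeral order_refl zero_le_power2)
  have dp: "d \<bullet> f p \<noteq> 0" using neg d by force
  \<comment> \<open>Chosen so that x - s d has no component along \<open>f p\<close>.\<close>
  define s where "s = (x \<bullet> f p) / (d \<bullet> f p)"
  have "(x - s *\<^sub>R d) \<bullet> f p = 0" using dp by (simp add: s_def inner_diff_left)
  from neg[OF this] have *: "?q x - 2 * s * (x \<bullet> (A *v d)) + s\<^sup>2 * ?q d \<le> 0"
    using symmetric_matrix_inner[OF sym, of d x]
    by (simp add: matrix_vector_mult_diff_distrib matrix_vector_mult_scaleR inner_diff_left
        inner_diff_right inner_commute power2_eq_square algebra_simps)
  have "0 \<le> (s * ?q d - x \<bullet> (A *v d))\<^sup>2" by simp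
  moreover have "?q d * (?q x - 2 * s * (x \<bullet> (A *v d)) + s\<^sup>2 * ?q d) \<le> 0"
    using * d by (simp add: mult_le_0_iff)
  ultimately show ?thesis by (simp add: power2_eq_square algebra_simps)
qed

text \<open>Two eigenvectors with positive eigenvalues span a plane on which the form is positive
  definite, and every plane meets the hyperplane orthogonal to w in a nonzero vector.\<close>

lemma nonpos_on_hyperplane_imp_one_positive:
  fixes A :: "real ^ 'n ^ 'n" and f :: "'n \<Rightarrow> real ^ 'n"
  assumes on: "\<And>i j. f i \<bullet> f j = (if i = j then 1 else 0)"
    and ev: "\<And>i. A *v f i = l i *\<^sub>R f i"
    and ex: "\<And>x. x = (\<Sum>i\<in>UNIV. (x \<bullet> f i) *\<^sub>R f i)"
    and neg: "\<And>x. x \<bullet> w = 0 \<Longrightarrow> x \<bullet> (A *v x) \<le> 0"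
    and d: "d \<bullet> (A *v d) > 0"
  obtains p where "l p > 0" "\<And>i. i \<noteq> p \<Longrightarrow> l i \<le> 0"
proof -
  have "\<exists>p. l p > 0"
  proof (rule ccontr)
    assume "\<nexists>p. l p > 0"
    then have "(\<Sum>i\<in>UNIV. l i * (d \<bullet> f i)\<^sup>2) \<le> 0"
      by (intro sum_nonpos) (auto simp: not_less mult_nonpos_nonneg)
    then show False using d quadratic_form_orthonormal_eigenbasis[of A f l, OF ev ex] by simp
  qed
  then obtain p where p: "l p > 0" by blast
  have "l i \<le> 0" if "i \<noteq> p" for i
  proof (rule ccontr)
    assume "\<not> l i \<le> 0"
    then have li: "l i > 0" by simp
    define a b where "a = f i \<bullet> w" and "b = f p \<bullet> w"
    \<comment> \<open>A nonzero vector in the span of \<open>f i\<close> and \<open>f p\<close> that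
      is orthogonal to w.\<close>
    define x where "x = (if a = 0 then f i else b *\<^sub>R f i - a *\<^sub>R f p)"
    have "x \<bullet> w = 0" by (simp add: x_def a_def b_def inner_diff_left)
    moreover have "x \<bullet> (A *v x) > 0"
    proof (cases "a = 0")
      case True
      then show ?thesis using li by (simp add: x_def ev on)
    next
      case False
      have "x \<bullet> (A *v x) = b\<^sup>2 * l i + a\<^sup>2 * l p"
        using False \<open>i \<noteq> p\<close>
        by (simp add: x_def ev on matrix_vector_mult_diff_distrib matrix_vector_mult_scaleR
            inner_diff_left inner_diff_right power2_eq_square)
      also have "\<dots> > 0" using li p False by (simp add: add_nonneg_pos)
      finally show ?thesis .
    qed
    ultimately show False using neg[of x] by simp
  qed
  then show ?thesis using that p by blast
qed

text \<open>A convex combination of the columns with positive coefficients t is A t with sum t = 1.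
  Rescaling by d = t / e, or back by e = 1 / sum d, exchanges the normalization of the coefficients
  for that of the right-hand side.\<close>

lemma constant_in_rel_interior_hull_columns_iff:
  fixes A :: "real ^ 'n ^ 'n"
  shows "(\<exists>e > 0. (\<chi> i. e) \<in> rel_interior (convex hull (range (\<lambda>j. column j A))))
    \<longleftrightarrow> (\<exists>d. (\<forall>i. d $ i > 0) \<and> A *v d = (\<chi> i. 1))" (is "?L \<longleftrightarrow> ?R")
proof -
  \<comment> \<open>As a union of singletons indexed by j, the hull has one positive coefficient for
    every j even if columns coincide.\<close>
  have "range (\<lambda>j. column j A) = (\<Union>j\<in>UNIV. {column j A})" by auto
  then have ri: "rel_interior (convex hull (range (\<lambda>j. column j A)))
    = {\<Sum>j\<in>UNIV. t j *\<^sub>R column j A |t. (\<forall>j. t j > 0) \<and> sum t UNIV = 1}"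
    by (simp, subst rel_interior_convex_hull_union) (auto 4 4)
  have mv: "A *v d = (\<Sum>j\<in>UNIV. d $ j *\<^sub>R column j A)" for d
    by (simp add: matrix_mult_sum scalar_mult_eq_scaleR)
  show ?thesis
  proof
    assume ?L
    then obtain e t where e: "e > 0" and t: "\<And>j. t j > 0"
      and eq: "(\<chi> i. e) = (\<Sum>j\<in>UNIV. t j *\<^sub>R column j A)"
      unfolding ri by blast
    have "A *v (\<chi> j. t j / e) = (\<Sum>j\<in>UNIV. (t j / e) *\<^sub>R column j A)" by (simp add: mv)
    also have "\<dots> = (1 / e) *\<^sub>R (\<Sum>j\<in>UNIV. t j *\<^sub>R column j A)"
      by (simp add: scaleR_sum_right)
    also have "\<dots> = (\<chi> i. 1)" using e by (simp add: eq[symmetric] vec_eq_iff)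
    finally show ?R using t e by (intro exI[of _ "\<chi> j. t j / e"]) simp
  next
    assume ?R
    then obtain d where d: "\<And>i. d $ i > 0" and Ad: "A *v d = (\<chi> i. 1)" by blast
    let ?s = "sum (($) d) UNIV"
    have s: "?s > 0" using d by (intro sum_pos) auto
    have "(\<Sum>j\<in>UNIV. (d $ j / ?s) *\<^sub>R column j A) = (1 / ?s) *\<^sub>R (A *v d)"
      by (simp add: mv scaleR_sum_right)
    also have "\<dots> = (\<chi> i. 1 / ?s)" by (simp add: Ad vec_eq_iff)
    finally have eq: "(\<chi> i. 1 / ?s) = (\<Sum>j\<in>UNIV. (d $ j / ?s) *\<^sub>R column j A)" by simp
    have "(\<Sum>j\<in>UNIV. d $ j / ?s) = 1" using s by (simp add: sum_divide_distrib[symmetric])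
    then have "(\<chi> i. 1 / ?s) \<in> rel_interior (convex hull (range (\<lambda>j. column j A)))"
      unfolding ri mem_Collect_eq using eq d s by (intro exI[of _ "\<lambda>j. d $ j / ?s"]) auto
    then show ?L using s by (intro exI[of _ "1 / ?s"]) simp
  qed
qed

section \<open>The fundamental lemma of the calculus of variations\<close>

lemma is_Ck_const: "is_Ck k (\<lambda>x. c)"
  by (induction k arbitrary: c) (auto simp: frechet_derivative_const)

lemma is_Ck_imp_continuous: "is_Ck k f \<Longrightarrow> continuous_on UNIV f"
  by (cases k) (auto intro!: differentiable_imp_continuous_within continuous_at_imp_continuous_on)

lemma is_Ck_Suc_imp: "is_Ck (Suc k) f \<Longrightarrow> is_Ck k f"
proof (induction k arbitrary: f)
  case 0
  then show ?case using is_Ck_imp_continuous by (metis is_Ck.simps(1))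
next
  case (Suc k)
  from Suc.prems have "\<forall>x. f differentiable at x"
    "\<forall>b\<in>Basis. is_Ck (Suc k) (\<lambda>x. frechet_derivative f (at x) b)"
    unfolding is_Ck.simps(2)[of "Suc k"] by blast+
  then show ?case using Suc.IH by (auto simp: is_Ck.simps(2)[of k])
qed

lemma frechet_derivative_eq: "(f has_derivative f') (at x) \<Longrightarrow> frechet_derivative f (at x) = f'"
  by (rule frechet_derivative_at[symmetric])

lemma is_Ck_add: "is_Ck k f \<Longrightarrow> is_Ck k g \<Longrightarrow> is_Ck k (\<lambda>x. f x + g x)"
proof (induction k arbitrary: f g)
  case 0
  then show ?case by (auto intro: continuous_intros)
next
  case (Suc k)
  then have d: "f differentiable at x" "g differentiable at x" for x by auto
  have "frechet_derivative (\<lambda>x. f x + g x) (at x)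
      = (\<lambda>h. frechet_derivative f (at x) h + frechet_derivative g (at x) h)" for x
    using d[of x] by (intro frechet_derivative_eq has_derivative_add) (auto simp: frechet_derivative_works)
  then show ?case using Suc d by auto
qed

lemma is_Ck_mult: "is_Ck k f \<Longrightarrow> is_Ck k g \<Longrightarrow> is_Ck k (\<lambda>x. f x * g x)"
proof (induction k arbitrary: f g)
  case 0
  then show ?case by (auto intro: continuous_intros)
next
  case (Suc k)
  then have d: "f differentiable at x" "g differentiable at x" for x by auto
  have "frechet_derivative (\<lambda>x. f x * g x) (at x)
      = (\<lambda>h. f x * frechet_derivative g (at x) h + frechet_derivative f (at x) h * g x)" for x
    using d[of x] by (intro frechet_derivative_eq has_derivative_mult) (auto simp: frechet_derivative_works)
  then show ?case using Suc.IH Suc.prems d is_Ck_Suc_imp[of k f] is_Ck_Suc_imp[of k g]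
    by (auto intro!: is_Ck_add)
qed

lemma is_Ck_prod:
  "finite I \<Longrightarrow> (\<And>i. i \<in> I \<Longrightarrow> is_Ck k (f i)) \<Longrightarrow> is_Ck k (\<lambda>x. \<Prod>i\<in>I. f i x)"
  by (induction I rule: finite_induct) (auto intro: is_Ck_const is_Ck_mult)

text \<open>A whole sequence D of successive derivatives is given, so that the induction on k can
  pass from \<open>D n\<close> to \<open>D (Suc n)\<close>.\<close>

lemma is_Ck_compose_affine:
  fixes v :: "'a :: euclidean_space"
  assumes D: "\<And>n t. (D n has_real_derivative D (Suc n) t) (at t)"
  shows "is_Ck k (\<lambda>x. D n (x \<bullet> v + \<beta>))"
proof (induction k arbitrary: n)
  case 0
  have "continuous_on UNIV (D n)"
    by (intro continuous_at_imp_continuous_on ballI DERIV_isCont[OF D])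
  then show ?case by (auto intro!: continuous_intros continuous_on_compose2[of UNIV "D n"])
next
  case (Suc k)
  have d: "((\<lambda>x. D n (x \<bullet> v + \<beta>)) has_derivative (\<lambda>h. D (Suc n) (x \<bullet> v + \<beta>) * (h \<bullet> v))) (at x)" for x
    using D[of n "x \<bullet> v + \<beta>"]
    unfolding has_field_derivative_def
    by (rule has_derivative_compose[where f = "\<lambda>x. x \<bullet> v + \<beta>", rotated])
       (auto intro!: derivative_eq_intros)
  show ?case using frechet_derivative_eq[OF d] d Suc
    by (auto simp: differentiable_def intro!: is_Ck_mult is_Ck_const)
qed

section \<open>A smooth step function\<close>

text \<open>The derivatives of \<open>exp (- 1 / t)\<close>, extended by 0 to \<open>t \<le> 0\<close>: differentiation turns the
  factor \<open>p (1 / t)\<close> into \<open>q (1 / t)\<close> with \<open>q = X\<^sup>2 (p - p')\<close>.\<close>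

definition psi_deriv :: "nat \<Rightarrow> real \<Rightarrow> real" where
  "psi_deriv n t = (if t > 0 then
     poly (((\<lambda>p. [:0, 0, 1:] * (p - pderiv p)) ^^ n) 1) (1 / t) * exp (- (1 / t)) else 0)"

abbreviation psi :: "real \<Rightarrow> real" where "psi \<equiv> psi_deriv 0"

lemma tendsto_poly_mult_exp_minus:
  fixes p :: "real poly"
  shows "((\<lambda>s. poly p s * exp (- s)) \<longlongrightarrow> 0) at_top"
proof -
  have "((\<lambda>s. \<Sum>i\<le>degree p. coeff p i * (s ^ i / exp s)) \<longlongrightarrow> (\<Sum>i\<le>degree p. coeff p i * 0)) at_top"
    by (intro tendsto_intros tendsto_power_div_exp_0)
  then show ?thesis
    by (simp add: poly_altdef sum_distrib_right exp_minus divide_inverse mult.assoc)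
qed

lemma psi_deriv_has_derivative: "(psi_deriv n has_real_derivative psi_deriv (Suc n) t) (at t)"
proof -
  define p where "p = ((\<lambda>p. [:0, 0, 1:] * (p - pderiv p)) ^^ n) (1 :: real poly)"
  have psi_n: "psi_deriv n t = (if t > 0 then poly p (1 / t) * exp (- (1 / t)) else 0)" for t
    by (simp add: psi_deriv_def p_def)
  have psi_Suc: "psi_deriv (Suc n) t = (if t > 0
      then poly ([:0, 0, 1:] * (p - pderiv p)) (1 / t) * exp (- (1 / t)) else 0)" for t
    by (simp add: psi_deriv_def p_def)
  consider "t > 0" | "t < 0" | "t = 0" by linarith
  then show ?thesis
  proof cases
    case 1
    have "((\<lambda>t. poly p (1 / t) * exp (- (1 / t))) has_real_derivative psi_deriv (Suc n) t) (at t)"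
      using 1 by (auto intro!: derivative_eq_intros simp: psi_Suc poly_diff power2_eq_square field_simps)
    moreover have "eventually (\<lambda>s. psi_deriv n s = poly p (1 / s) * exp (- (1 / s))) (nhds t)"
      using eventually_nhds_in_open[of "{0<..}" t] 1 by (auto simp: psi_n elim!: eventually_mono)
    ultimately show ?thesis by (subst DERIV_cong_ev[OF refl _ refl]) auto
  next
    case 2
    have "eventually (\<lambda>s. psi_deriv n s = 0) (nhds t)"
      using eventually_nhds_in_open[of "{..<0}" t] 2 by (auto simp: psi_n elim!: eventually_mono)
    then have "(psi_deriv n has_real_derivative 0) (at t)"
      by (subst DERIV_cong_ev[OF refl _ refl]) auto
    then show ?thesis using 2 by (simp add: psi_Suc)
  next
    case 3
    \<comment> \<open>With s = 1 / h the difference quotient at 0 is s p(s) exp(-s); the division by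
      h accounts for the extra factor X.\<close>
    have "((\<lambda>h. poly (p * [:0, 1:]) (inverse h) * exp (- (inverse h))) \<longlongrightarrow> 0) (at_right 0)"
      using filterlim_compose[OF tendsto_poly_mult_exp_minus filterlim_inverse_at_top_right] .
    then have "((\<lambda>h. psi_deriv n h / h) \<longlongrightarrow> 0) (at_right 0)"
      by (rule Lim_transform_eventually)
         (auto simp: eventually_at_right_field psi_n field_simps intro!: exI[of _ 1])
    moreover have "((\<lambda>h. psi_deriv n h / h) \<longlongrightarrow> 0) (at_left 0)"
      by (rule Lim_transform_eventually[OF tendsto_const])
         (auto simp: eventually_at_left_field psi_n intro!: exI[of _ "- 1"])
    ultimately have "((\<lambda>h. psi_deriv n h / h) \<longlongrightarrow> 0) (at 0)"
      by (simp add: filterlim_at_split)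
    then show ?thesis using 3 by (simp add: DERIV_def psi_n psi_Suc)
  qed
qed

lemma psi_eq: "psi t = (if t > 0 then exp (- (1 / t)) else 0)"
  by (simp add: psi_deriv_def)

lemma psi_bounds: "0 \<le> psi t" "psi t \<le> 1"
  by (auto simp: psi_eq)

lemma psi_eq_0_iff: "psi t = 0 \<longleftrightarrow> t \<le> 0"
  by (simp add: psi_eq)

lemma psi_scaled_tendsto:
  "(\<lambda>k. psi (real k * t)) \<longlonglongrightarrow> (if t > 0 then 1 else 0)"
proof (cases "t > 0")
  case True
  have "(\<lambda>k. exp (- ((1 / t) * inverse (real k)))) \<longlonglongrightarrow> exp (- ((1 / t) * 0))"
    by (intro tendsto_intros lim_inverse_n)
  moreover have "eventually (\<lambda>k. exp (- ((1 / t) * inverse (real k))) = psi (real k * t)) sequentially"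
    using eventually_gt_at_top[of 0] by eventually_elim (auto simp: psi_eq True field_simps)
  ultimately show ?thesis using True by (auto intro: Lim_transform_eventually)
next
  case False
  then have "psi (real k * t) = 0" for k by (simp add: psi_eq_0_iff mult_nonneg_nonpos)
  then show ?thesis using False by simp
qed

section \<open>Smooth bumps on boxes and the fundamental lemma\<close>

text \<open>A smooth approximation of the indicator of the open box from a to c: each face
  contributes a smoothed step, which sharpens as k grows.\<close>

definition box_bump :: "nat \<Rightarrow> 'a :: euclidean_space \<Rightarrow> 'a \<Rightarrow> 'a \<Rightarrow> real" where
  "box_bump k a c x = (\<Prod>b\<in>Basis. psi (real k * (x \<bullet> b - a \<bullet> b)) * psi (real k * (c \<bullet> b - x \<bullet> b)))"

lemma is_Ck_box_bump: "is_Ck m (box_bump k a c)"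
proof -
  have "is_Ck m (\<lambda>x. psi (x \<bullet> (real k *\<^sub>R b) + (- (real k * (a \<bullet> b))))
      * psi (x \<bullet> (- real k *\<^sub>R b) + real k * (c \<bullet> b)))" for b
    by (intro is_Ck_mult is_Ck_compose_affine psi_deriv_has_derivative)
  then show ?thesis
    unfolding box_bump_def[abs_def] by (intro is_Ck_prod) (auto simp: algebra_simps)
qed

lemma box_bump_bounds: "0 \<le> box_bump k a c x" "box_bump k a c x \<le> 1"
  unfolding box_bump_def
  by (auto intro!: prod_nonneg prod_le_1 mult_le_one simp: psi_bounds)

lemma box_bump_eq_0: "x \<notin> box a c \<Longrightarrow> box_bump k a c x = 0"
proof -
  assume "x \<notin> box a c"
  then obtain b where b: "b \<in> Basis" "x \<bullet> b - a \<bullet> b \<le> 0 \<or> c \<bullet> b - x \<bullet> b \<le> 0"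
    by (auto simp: mem_box not_less)
  then have "psi (real k * (x \<bullet> b - a \<bullet> b)) * psi (real k * (c \<bullet> b - x \<bullet> b)) = 0"
    by (auto simp: psi_eq_0_iff mult_nonneg_nonpos)
  then show ?thesis using b unfolding box_bump_def by (intro prod_zero) auto
qed

lemma box_bump_tendsto: "(\<lambda>k. box_bump k a c x) \<longlonglongrightarrow> indicator (box a c) x"
proof -
  have "(\<lambda>k. box_bump k a c x) \<longlonglongrightarrow> (\<Prod>b\<in>Basis.
      (if x \<bullet> b - a \<bullet> b > 0 then 1 else 0) * (if c \<bullet> b - x \<bullet> b > 0 then 1 else 0))"
    unfolding box_bump_def by (intro tendsto_intros psi_scaled_tendsto)
  also have "(\<Prod>b\<in>Basis. (if x \<bullet> b - a \<bullet> b > 0 then 1 else 0) * (if c \<bullet> b - x \<bullet> b > 0 then 1 else 0))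
      = (indicator (box a c) x :: real)"
    by (cases "x \<in> box a c") (auto simp: mem_box indicator_def)
  finally show ?thesis .
qed

lemma box_bump_test_function:
  assumes "cbox a c \<subseteq> \<Omega>"
  shows "box_bump k a c \<in> test_functions \<Omega>"
proof -
  have "{x. box_bump k a c x \<noteq> 0} \<subseteq> cbox a c"
    using box_bump_eq_0 box_subset_cbox by blast
  moreover from this have "closure {x. box_bump k a c x \<noteq> 0} \<subseteq> cbox a c"
    by (intro closure_minimal) auto
  ultimately show ?thesis using assms is_Ck_box_bump unfolding test_functions_def
    by (auto simp: compact_eq_bounded_closed intro: bounded_subset[OF bounded_cbox] bounded_closure)
qed

text \<open>Bumps tending to the indicator of a box give, by dominated convergence, integral 0 over
  every closed box inside \<Omega>. Lebesgue differentiation along cubes with a corner at x then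
  makes g vanish off a null set. Integrability is asked of g extended by 0, because the
  differentiation theorem is applied on all of space.\<close>

lemma fundamental_lemma:
  fixes g :: "'a :: euclidean_space \<Rightarrow> 'b :: euclidean_space"
  assumes \<Omega>: "open \<Omega>"
    and int: "\<And>a b. set_integrable lebesgue (cbox a b) (\<lambda>x. indicator \<Omega> x *\<^sub>R g x)"
    and zero: "\<And>\<phi>. \<phi> \<in> test_functions \<Omega> \<Longrightarrow> (LINT x:\<Omega>|lebesgue. \<phi> x *\<^sub>R g x) = 0"
  shows "AE x in lebesgue. x \<in> \<Omega> \<longrightarrow> g x = 0"
proof -
  define G where "G x = indicator \<Omega> x *\<^sub>R g x" for x
  have G_int: "set_integrable lebesgue (cbox a b) G" for a b
    using int by (simp add: G_def[abs_def])
  have box_zero: "integral (cbox a c) G = 0" if sub: "cbox a c \<subseteq> \<Omega>" for a c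
  proof -
    have GI: "integrable lebesgue (\<lambda>x. indicator (cbox a c) x *\<^sub>R G x)"
      using G_int[of a c] by (simp add: set_integrable_def)
    have GIb: "set_integrable lebesgue (box a c) G"
      by (rule set_integrable_subset[OF G_int[of a c]]) (auto simp: box_subset_cbox)
    have meas: "box_bump k a c \<in> borel_measurable lebesgue" for k
      using is_Ck_box_bump[of 0] by (auto intro!: measurable_completion borel_measurable_continuous_onI)
    have eq: "box_bump k a c x *\<^sub>R (indicator (cbox a c) x *\<^sub>R G x)
        = indicator \<Omega> x *\<^sub>R (box_bump k a c x *\<^sub>R g x)" for k x
    proof (cases "x \<in> box a c")
      case True
      then have "x \<in> cbox a c" using box_subset_cbox by blast
      then show ?thesis by (simp add: G_def)
    qed (simp add: box_bump_eq_0)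
    have "(\<lambda>k. \<integral>x. box_bump k a c x *\<^sub>R (indicator (cbox a c) x *\<^sub>R G x) \<partial>lebesgue)
      \<longlonglongrightarrow> (\<integral>x. indicator (box a c) x *\<^sub>R (indicator (cbox a c) x *\<^sub>R G x) \<partial>lebesgue)"
    proof (rule integral_dominated_convergence[where w = "\<lambda>x. norm (indicator (cbox a c) x *\<^sub>R G x)"])
      show "(\<lambda>x. indicator (box a c) x *\<^sub>R (indicator (cbox a c) x *\<^sub>R G x)) \<in> borel_measurable lebesgue"
        by (rule borel_measurable_scaleR[OF borel_measurable_indicator borel_measurable_integrable[OF GI]]) auto
      show "(\<lambda>x. box_bump k a c x *\<^sub>R (indicator (cbox a c) x *\<^sub>R G x)) \<in> borel_measurable lebesgue" for k
        by (rule borel_measurable_scaleR[OF meas borel_measurable_integrable[OF GI]])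
      show "integrable lebesgue (\<lambda>x. norm (indicator (cbox a c) x *\<^sub>R G x))"
        using GI by (rule integrable_norm)
      show "AE x in lebesgue. (\<lambda>k. box_bump k a c x *\<^sub>R (indicator (cbox a c) x *\<^sub>R G x))
          \<longlonglongrightarrow> indicator (box a c) x *\<^sub>R (indicator (cbox a c) x *\<^sub>R G x)"
        by (intro AE_I2 tendsto_intros box_bump_tendsto)
      show "AE x in lebesgue. norm (box_bump k a c x *\<^sub>R (indicator (cbox a c) x *\<^sub>R G x))
          \<le> norm (indicator (cbox a c) x *\<^sub>R G x)" for k
        using box_bump_bounds[of k a c]
        by (intro AE_I2) (auto simp del: scaleR_scaleR simp add: mult_left_le_one_le)
    qed
    moreover have "(\<integral>x. box_bump k a c x *\<^sub>R (indicator (cbox a c) x *\<^sub>R G x) \<partial>lebesgue) = 0" for k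
      unfolding eq using zero[OF box_bump_test_function[OF sub]] by (simp add: set_lebesgue_integral_def)
    ultimately have "(\<integral>x. indicator (box a c) x *\<^sub>R (indicator (cbox a c) x *\<^sub>R G x) \<partial>lebesgue) = 0"
      by (simp add: LIMSEQ_const_iff)
    moreover have "indicator (box a c) x *\<^sub>R (indicator (cbox a c) x *\<^sub>R G x) = indicator (box a c) x *\<^sub>R G x" for x
      using box_subset_cbox[of a c] by (auto simp: indicator_def)
    ultimately have "(LINT x:box a c|lebesgue. G x) = 0"
      unfolding set_lebesgue_integral_def by (simp only:)
    then have "integral (box a c) G = 0"
      using set_lebesgue_integral_eq_integral(2)[OF GIb] by simp
    then show ?thesis by (simp add: integral_open_interval)
  qed
  have "G integrable_on cbox a b" for a b
    using G_int set_lebesgue_integral_eq_integral(1) by blast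
  then obtain N where N: "negligible N" and lim: "\<And>x e. \<lbrakk>x \<notin> N; 0 < e\<rbrakk> \<Longrightarrow>
      \<exists>d>0. \<forall>h. 0 < h \<and> h < d \<longrightarrow> norm (integral (cbox x (x + h *\<^sub>R One)) G /\<^sub>R h ^ DIM('a) - G x) < e"
    using integrable_ccontinuous_explicit[of G] by blast
  have "g x = 0" if x: "x \<notin> N" "x \<in> \<Omega>" for x
  proof (rule ccontr)
    assume "g x \<noteq> 0"
    then obtain d where d: "d > 0" and small: "\<And>h. 0 < h \<Longrightarrow> h < d \<Longrightarrow>
        norm (integral (cbox x (x + h *\<^sub>R One)) G /\<^sub>R h ^ DIM('a) - G x) < norm (g x)"
      using lim[of x "norm (g x)"] x by auto
    obtain e where e: "e > 0" "cball x e \<subseteq> \<Omega>" using \<Omega> x open_contains_cball by blast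
    \<comment> \<open>Small enough for the cube with corner x and edge h to stay within distance e
      of x, hence inside \<Omega>.\<close>
    define h where "h = min (d / 2) (e / norm (One :: 'a))"
    have One: "norm (One :: 'a) > 0" by simp
    have h: "0 < h" "h < d" using d e One by (auto simp: h_def)
    have "cbox x (x + h *\<^sub>R One) \<subseteq> cball x e"
    proof
      fix y assume y: "y \<in> cbox x (x + h *\<^sub>R One)"
      have "norm (y - x) \<le> norm (h *\<^sub>R (One :: 'a))"
        using y h by (intro norm_le_componentwise) (auto simp: mem_box inner_simps abs_if algebra_simps)
      also have "\<dots> \<le> e" using h One by (simp add: h_def min_def field_simps split: if_splits)
      finally show "y \<in> cball x e" by (simp add: dist_norm norm_minus_commute)
    qed
    then have "integral (cbox x (x + h *\<^sub>R One)) G = 0" using box_zero e by blast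
    then show False using small[OF h] x by (simp add: G_def)
  qed
  then have "{x. \<not> (x \<in> \<Omega> \<longrightarrow> g x = 0)} \<subseteq> N" by auto
  then show ?thesis
    using N by (intro AE_I'[of N]) (auto simp: negligible_iff_null_sets)
qed

section \<open>Integration by parts for test functions\<close>

lemma lborel_distr_diff: "distr lborel borel (\<lambda>x. x - y) = (lborel :: 'a :: euclidean_space measure)"
proof -
  have "(\<lambda>x. x - y) = (+) (- y)" by (simp add: fun_eq_iff)
  then show ?thesis using lborel_distr_plus[of "- y"] by simp
qed

lemma lborel_distr_reflect: "distr lborel borel (\<lambda>y. x - y) = (lborel :: 'a :: euclidean_space measure)"
  using lborel_affine[of "- 1" x] by (simp add: density_1)

lemma nn_integral_lborel_diff:
  fixes h :: "'a :: euclidean_space \<Rightarrow> ennreal"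
  assumes "h \<in> borel_measurable borel"
  shows "(\<integral>\<^sup>+x. h (x - y) \<partial>lborel) = (\<integral>\<^sup>+x. h x \<partial>lborel)"
  using assms nn_integral_distr[of "\<lambda>x. x - y" lborel borel h] by (simp add: lborel_distr_diff)

lemma nn_integral_lborel_reflect:
  fixes h :: "'a :: euclidean_space \<Rightarrow> ennreal"
  assumes "h \<in> borel_measurable borel"
  shows "(\<integral>\<^sup>+y. h (x - y) \<partial>lborel) = (\<integral>\<^sup>+y. h y \<partial>lborel)"
  using assms nn_integral_distr[of "\<lambda>y. x - y" lborel borel h] by (simp add: lborel_distr_reflect)

lemma integral_lborel_diff:
  fixes h :: "'a :: euclidean_space \<Rightarrow> 'b :: euclidean_space"
  assumes "h \<in> borel_measurable borel"
  shows "(\<integral>x. h (x - y) \<partial>lborel) = (\<integral>x. h x \<partial>lborel)"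
  using assms integral_distr[of "\<lambda>x. x - y" lborel borel h] by (simp add: lborel_distr_diff)

lemma integral_lborel_reflect:
  fixes h :: "'a :: euclidean_space \<Rightarrow> 'b :: euclidean_space"
  assumes "h \<in> borel_measurable borel"
  shows "(\<integral>y. h (x - y) \<partial>lborel) = (\<integral>y. h y \<partial>lborel)"
  using assms integral_distr[of "\<lambda>y. x - y" lborel borel h] by (simp add: lborel_distr_reflect)

section \<open>Supports, gradients and integrals of test functions\<close>

lemma test_functions_continuous: "\<phi> \<in> test_functions \<Omega> \<Longrightarrow> continuous_on UNIV \<phi>"
  using is_Ck.simps(1) unfolding test_functions_def by blast

lemma test_functions_differentiable: "\<phi> \<in> test_functions \<Omega> \<Longrightarrow> \<phi> differentiable (at x)"
  using is_Ck.simps(2)[of 0 \<phi>] unfolding test_functions_def by blast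

lemma grad_inner_Basis: "b \<in> Basis \<Longrightarrow> grad f x \<bullet> b = frechet_derivative f (at x) b"
  by (simp add: grad_def inner_sum_left inner_Basis if_distrib cong: if_cong)

lemma is_Ck_partial_continuous:
  assumes "\<And>k. is_Ck k f" "b \<in> Basis"
  shows "continuous_on UNIV (\<lambda>x. frechet_derivative f (at x) b)"
  using assms(1)[of "Suc 0"] assms(2) by auto

lemma test_functions_grad_continuous: "\<phi> \<in> test_functions \<Omega> \<Longrightarrow> continuous_on UNIV (grad \<phi>)"
  unfolding grad_def[abs_def] test_functions_def
  by (auto intro!: continuous_intros is_Ck_partial_continuous)

lemma frechet_derivative_zero_outside_support:
  assumes "x \<notin> closure {x. f x \<noteq> 0}"
  shows "frechet_derivative f (at x) = (\<lambda>_. 0 :: real)"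
proof -
  have "((\<lambda>_. 0) has_derivative (\<lambda>_. 0)) (at x)" by simp
  then have "(f has_derivative (\<lambda>_. 0)) (at x)"
  proof (rule has_derivative_transform_within_open)
    show "open (- closure {x. f x \<noteq> 0})" by (intro open_Compl closed_closure)
    show "x \<in> - closure {x. f x \<noteq> 0}" using assms by simp
    show "0 = f y" if "y \<in> - closure {x. f x \<noteq> 0}" for y
      using that closure_subset[of "{x. f x \<noteq> 0}"] by auto
  qed
  then show ?thesis by (rule frechet_derivative_eq)
qed

lemma grad_zero_outside_support: "x \<notin> closure {x. f x \<noteq> 0} \<Longrightarrow> grad f x = 0"
  by (simp add: grad_def frechet_derivative_zero_outside_support)

lemma test_functions_support:
  assumes "\<phi> \<in> test_functions \<Omega>"
  obtains K where "compact K" "\<And>x. x \<notin> K \<Longrightarrow> \<phi> x = 0" "\<And>x. x \<notin> K \<Longrightarrow> grad \<phi> x = 0"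
proof (rule that[of "closure {x. \<phi> x \<noteq> 0}"])
  show "compact (closure {x. \<phi> x \<noteq> 0})" using assms by (simp add: test_functions_def)
  fix x assume "x \<notin> closure {x. \<phi> x \<noteq> 0}"
  then show "\<phi> x = 0" "grad \<phi> x = 0"
    using closure_subset[of "{x. \<phi> x \<noteq> 0}"] grad_zero_outside_support by blast+
qed

lemma test_functions_measurable:
  assumes "\<phi> \<in> test_functions \<Omega>"
  shows "\<phi> \<in> borel_measurable borel" "grad \<phi> \<in> borel_measurable borel"
  using test_functions_continuous[OF assms] test_functions_grad_continuous[OF assms]
  by (auto intro: borel_measurable_continuous_onI)

lemma integrable_continuous_compact_support:
  fixes f :: "'a :: euclidean_space \<Rightarrow> 'b :: euclidean_space"
  assumes f: "continuous_on UNIV f" and K: "compact K" "\<And>x. x \<notin> K \<Longrightarrow> f x = 0"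
  shows "integrable lebesgue f" "integrable lborel f"
proof -
  have "integrable lborel (\<lambda>x. indicator K x *\<^sub>R f x)"
    using f K by (intro borel_integrable_compact) (auto intro: continuous_on_subset)
  also have "(\<lambda>x. indicator K x *\<^sub>R f x) = f"
    using K by (auto simp: indicator_def fun_eq_iff)
  finally show "integrable lborel f" .
  then show "integrable lebesgue f" by (simp add: integrable_completion borel_measurable_integrable)
qed

text \<open>By translation invariance every difference quotient of f in direction e has integral 0.
  The quotients converge to the derivative and are uniformly bounded with support in one ball, so
  dominated convergence applies.\<close>

lemma integral_directional_derivative_eq_0:
  fixes f :: "'a :: euclidean_space \<Rightarrow> real"
  assumes d: "\<And>x. f differentiable (at x)"
    and c: "continuous_on UNIV (\<lambda>x. frechet_derivative f (at x) e)"
    and K: "compact (closure {x. f x \<noteq> 0})"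
  shows "(\<integral>x. frechet_derivative f (at x) e \<partial>lebesgue) = 0"
proof -
  define K where "K = closure {x. f x \<noteq> 0}"
  have cK: "compact K" using K by (simp add: K_def)
  have f0: "f x = 0" if "x \<notin> K" for x
    using that closure_subset[of "{x. f x \<noteq> 0}"] by (auto simp: K_def)
  let ?D = "\<lambda>x. frechet_derivative f (at x) e"
  have D0: "?D x = 0" if "x \<notin> K" for x
    using that frechet_derivative_zero_outside_support[of x f] by (simp add: K_def)
  have contf: "continuous_on UNIV f"
    using d differentiable_imp_continuous_within by (auto intro!: continuous_at_imp_continuous_on)
  have "bounded (?D ` K)"
    using compact_imp_bounded[OF compact_continuous_image[OF continuous_on_subset[OF c] cK]] by simp
  then obtain C where C: "\<And>x. x \<in> K \<Longrightarrow> \<bar>?D x\<bar> \<le> C" by (auto simp: bounded_iff)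
  define C' where "C' = max C 0"
  have C': "\<bar>?D x\<bar> \<le> C'" for x
    using C[of x] D0[of x] by (cases "x \<in> K") (auto simp: C'_def)
  obtain R where R: "\<And>x. x \<in> K \<Longrightarrow> norm x \<le> R"
    using compact_imp_bounded[OF cK] by (auto simp: bounded_iff)
  \<comment> \<open>Contains the supports of all quotients, as the step sizes are at most 1.\<close>
  define B where "B = cball (0 :: 'a) (R + norm e)"
  define t where "t n = 1 / real (Suc n)" for n
  have t: "0 < t n" "t n \<le> 1" for n by (auto simp: t_def)
  define q where "q n x = (f (x + t n *\<^sub>R e) - f x) / t n" for n x
  have line: "((\<lambda>s. f (x + s *\<^sub>R e)) has_real_derivative ?D (x + s *\<^sub>R e)) (at s)" for x s
  proof -
    have "(f has_derivative frechet_derivative f (at (x + s *\<^sub>R e))) (at (x + s *\<^sub>R e))"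
      using d frechet_derivative_works by blast
    moreover have "((\<lambda>s. x + s *\<^sub>R e) has_derivative (\<lambda>h. h *\<^sub>R e)) (at s)"
      by (auto intro!: derivative_eq_intros)
    ultimately have "((\<lambda>s. f (x + s *\<^sub>R e)) has_derivative
        (\<lambda>h. frechet_derivative f (at (x + s *\<^sub>R e)) (h *\<^sub>R e))) (at s)"
      by (rule has_derivative_compose[rotated])
    moreover have "frechet_derivative f (at (x + s *\<^sub>R e)) (h *\<^sub>R e) = ?D (x + s *\<^sub>R e) * h" for h
      using linear_frechet_derivative[OF d] by (simp add: linear_cmul mult.commute)
    ultimately show ?thesis by (simp add: has_field_derivative_def)
  qed
  have q_lim: "(\<lambda>n. q n x) \<longlonglongrightarrow> ?D x" for x
  proof -
    have "((\<lambda>h. (f (x + h *\<^sub>R e) - f x) / h) \<longlongrightarrow> ?D x) (at 0)"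
      using line[of x 0] by (simp add: DERIV_def)
    moreover have "filterlim t (at 0) sequentially"
      using t unfolding filterlim_at t_def
      by (intro conjI LIMSEQ_Suc[OF lim_1_over_n]) (auto intro!: always_eventually)
    ultimately show ?thesis unfolding q_def by (rule filterlim_compose)
  qed
  have q_bound: "\<bar>q n x\<bar> \<le> C' * indicator B x" for n x
  proof (cases "x \<in> B")
    case True
    \<comment> \<open>The mean value theorem bounds the quotient by the supremum of the derivative,
      independently of n.\<close>
    obtain z where "f (x + t n *\<^sub>R e) - f (x + 0 *\<^sub>R e) = (t n - 0) * ?D (x + z *\<^sub>R e)"
      using MVT2[of 0 "t n" "\<lambda>s. f (x + s *\<^sub>R e)" "\<lambda>s. ?D (x + s *\<^sub>R e)"] line t by blast
    then have "q n x = ?D (x + z *\<^sub>R e)" using t[of n] by (simp add: q_def)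
    then show ?thesis using C' True by simp
  next
    case False
    then have "norm x > R + norm e" by (simp add: B_def)
    moreover have "norm (t n *\<^sub>R e) \<le> norm e" using t[of n] by (simp add: mult_left_le_one_le)
    moreover have "norm x \<le> norm (x + t n *\<^sub>R e) + norm (t n *\<^sub>R e)"
      using norm_triangle_ineq4[of "x + t n *\<^sub>R e" "t n *\<^sub>R e"] by simp
    ultimately have "norm (x + t n *\<^sub>R e) > R" by linarith
    moreover have "norm x > R" using \<open>norm x > R + norm e\<close> norm_ge_zero[of e] by linarith
    ultimately have "f (x + t n *\<^sub>R e) = 0" "f x = 0" using R f0 by (meson not_less)+
    then show ?thesis using False by (simp add: q_def)
  qed
  have fint: "integrable lborel f"
    by (rule integrable_continuous_compact_support[OF contf cK f0])
  have shift: "integrable lborel (\<lambda>x. f (x + s))" "(\<integral>x. f (x + s) \<partial>lborel) = (\<integral>x. f x \<partial>lborel)" for s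
  proof -
    have fm: "f \<in> borel_measurable borel" using contf by (rule borel_measurable_continuous_onI)
    show "integrable lborel (\<lambda>x. f (x + s))"
      using fint fm integrable_distr_eq[of "\<lambda>x. x - (- s)" lborel borel f] by (simp only: lborel_distr_diff) simp
    show "(\<integral>x. f (x + s) \<partial>lborel) = (\<integral>x. f x \<partial>lborel)"
      using integral_lborel_diff[OF fm, of "- s"] by simp
  qed
  have q_int: "(\<integral>x. q n x \<partial>lborel) = 0" for n
    unfolding q_def using shift[of "t n *\<^sub>R e"] fint by simp
  have Dm: "?D \<in> borel_measurable borel" using c by (rule borel_measurable_continuous_onI)
  have "(\<lambda>n. \<integral>x. q n x \<partial>lborel) \<longlonglongrightarrow> (\<integral>x. ?D x \<partial>lborel)"
  proof (rule integral_dominated_convergence[where w = "\<lambda>x. C' * indicator B x"])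
    have "emeasure lborel B < \<infinity>" "B \<in> sets lborel"
      unfolding B_def by (intro emeasure_bounded_finite bounded_cball) simp
    then show "integrable lborel (\<lambda>x. C' * indicator B x)"
      by (intro integrable_mult_right integrable_real_indicator)
    show "q n \<in> borel_measurable lborel" for n
      unfolding q_def[abs_def] using shift fint borel_measurable_integrable by measurable
  qed (use q_lim q_bound Dm in auto)
  then have "(\<integral>x. ?D x \<partial>lborel) = 0" by (simp add: q_int LIMSEQ_const_iff)
  then show ?thesis using Dm by (simp add: integral_completion)
qed

lemma test_functions_zero:
  assumes "\<phi> \<in> test_functions \<Omega>" "x \<notin> \<Omega>"
  shows "\<phi> x = 0" "grad \<phi> x = 0"
proof -
  have x: "x \<notin> closure {x. \<phi> x \<noteq> 0}" using assms by (auto simp: test_functions_def)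
  then show "\<phi> x = 0" using closure_subset[of "{x. \<phi> x \<noteq> 0}"] by auto
  show "grad \<phi> x = 0" using grad_zero_outside_support[OF x] .
qed

text \<open>The derivatives of the compactly supported product \<phi> \<psi> have integral 0, and
  the product rule splits them. Both integrands vanish outside \<Omega>, so integrals over \<Omega>
  and over the whole space agree.\<close>

lemma test_functions_integration_by_parts:
  assumes \<phi>: "\<phi> \<in> test_functions \<Omega>" and \<psi>: "\<psi> \<in> test_functions \<Omega>"
  shows "(LINT x:\<Omega>|lebesgue. \<phi> x *\<^sub>R grad \<psi> x) = - (LINT x:\<Omega>|lebesgue. \<psi> x *\<^sub>R grad \<phi> x)"
proof -
  obtain K where K: "compact K" and z: "\<And>x. x \<notin> K \<Longrightarrow> \<phi> x = 0" "\<And>x. x \<notin> K \<Longrightarrow> grad \<phi> x = 0"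
    using test_functions_support[OF \<phi>] by blast
  have i1: "integrable lebesgue (\<lambda>x. \<phi> x *\<^sub>R grad \<psi> x)"
    by (rule integrable_continuous_compact_support(1)[OF continuous_on_scaleR[OF
          test_functions_continuous[OF \<phi>] test_functions_grad_continuous[OF \<psi>]] K]) (simp add: z)
  have i2: "integrable lebesgue (\<lambda>x. \<psi> x *\<^sub>R grad \<phi> x)"
    by (rule integrable_continuous_compact_support(1)[OF continuous_on_scaleR[OF
          test_functions_continuous[OF \<psi>] test_functions_grad_continuous[OF \<phi>]] K]) (simp add: z)
  have "((\<integral>x. \<phi> x *\<^sub>R grad \<psi> x \<partial>lebesgue) + (\<integral>x. \<psi> x *\<^sub>R grad \<phi> x \<partial>lebesgue)) \<bullet> b = 0"
    if b: "b \<in> Basis" for b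
  proof -
    let ?f = "\<lambda>x. \<phi> x * \<psi> x"
    have smooth: "\<And>k. is_Ck k ?f" using \<phi> \<psi> by (auto simp: test_functions_def intro: is_Ck_mult)
    have fd: "frechet_derivative ?f (at x) b = (\<phi> x *\<^sub>R grad \<psi> x) \<bullet> b + (\<psi> x *\<^sub>R grad \<phi> x) \<bullet> b" for x
    proof -
      have "(?f has_derivative (\<lambda>h. \<phi> x * frechet_derivative \<psi> (at x) h + frechet_derivative \<phi> (at x) h * \<psi> x)) (at x)"
        using test_functions_differentiable[OF \<phi>] test_functions_differentiable[OF \<psi>]
        by (intro has_derivative_mult) (auto simp: frechet_derivative_works)
      from frechet_derivative_eq[OF this] show ?thesis by (simp add: grad_inner_Basis b)
    qed
    have "{x. ?f x \<noteq> 0} \<subseteq> K" using z(1) by fastforce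
    then have "compact (closure {x. ?f x \<noteq> 0})"
      using bounded_subset[OF compact_imp_bounded[OF K]] by (simp add: compact_closure)
    then have "(\<integral>x. frechet_derivative ?f (at x) b \<partial>lebesgue) = 0"
      using smooth[of "Suc 0"] b by (intro integral_directional_derivative_eq_0) auto
    then have "(\<integral>x. (\<phi> x *\<^sub>R grad \<psi> x) \<bullet> b + (\<psi> x *\<^sub>R grad \<phi> x) \<bullet> b \<partial>lebesgue) = 0"
      by (simp only: fd)
    then have "(\<integral>x. (\<phi> x *\<^sub>R grad \<psi> x) \<bullet> b \<partial>lebesgue) + (\<integral>x. (\<psi> x *\<^sub>R grad \<phi> x) \<bullet> b \<partial>lebesgue) = 0"
      by (subst (asm) Bochner_Integration.integral_add[OF integrable_inner_left[OF i1] integrable_inner_left[OF i2]])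
    then show ?thesis
      by (simp only: integral_inner_left[OF i1] integral_inner_left[OF i2] inner_add_left)
  qed
  then have "(\<integral>x. \<phi> x *\<^sub>R grad \<psi> x \<partial>lebesgue) + (\<integral>x. \<psi> x *\<^sub>R grad \<phi> x \<partial>lebesgue) = 0"
    by (metis euclidean_eqI inner_zero_left)
  moreover have "indicator \<Omega> x *\<^sub>R (\<phi> x *\<^sub>R grad \<psi> x) = \<phi> x *\<^sub>R grad \<psi> x"
    "indicator \<Omega> x *\<^sub>R (\<psi> x *\<^sub>R grad \<phi> x) = \<psi> x *\<^sub>R grad \<phi> x" for x
    using test_functions_zero[OF \<phi>, of x] test_functions_zero[OF \<psi>, of x] by (auto simp: indicator_def)
  ultimately show ?thesis unfolding set_lebesgue_integral_def by (simp only: eq_neg_iff_add_eq_0)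
qed

section \<open>Weak gradients\<close>

text \<open>Extension by zero discards the arbitrary values outside \<Omega> and turns integrals and
  measurability on \<Omega> into the notions on the whole space.\<close>

definition zext :: "'a set \<Rightarrow> ('a \<Rightarrow> 'b :: real_vector) \<Rightarrow> 'a \<Rightarrow> 'b" where
  "zext \<Omega> f x = indicator \<Omega> x *\<^sub>R f x"

lemma zext_simps [simp]: "x \<in> \<Omega> \<Longrightarrow> zext \<Omega> f x = f x" "x \<notin> \<Omega> \<Longrightarrow> zext \<Omega> f x = 0"
  by (simp_all add: zext_def)

lemma zext_add: "zext \<Omega> (\<lambda>x. f x + g x) = (\<lambda>x. zext \<Omega> f x + zext \<Omega> g x)"
  by (auto simp: zext_def scaleR_add_right)

lemma zext_scaleR: "zext \<Omega> (\<lambda>x. c *\<^sub>R f x) = (\<lambda>x. c *\<^sub>R zext \<Omega> f x)"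
  by (auto simp: zext_def)

lemma zext_norm_power2: "zext \<Omega> (\<lambda>x. (norm (f x))\<^sup>2) = (\<lambda>x. (norm (zext \<Omega> f x))\<^sup>2)"
  by (rule ext) (simp add: zext_def indicator_def)

lemma set_integrable_zext: "set_integrable M \<Omega> f \<longleftrightarrow> integrable M (zext \<Omega> f)"
  by (simp add: set_integrable_def zext_def[abs_def])

lemma set_integral_zext: "(LINT x:\<Omega>|M. f x) = (\<integral>x. zext \<Omega> f x \<partial>M)"
  by (simp add: set_lebesgue_integral_def zext_def)

lemma L2_iff: "f \<in> L2 \<Omega> \<longleftrightarrow> zext \<Omega> f \<in> borel_measurable lebesgue \<and>
    integrable lebesgue (\<lambda>x. (norm (zext \<Omega> f x))\<^sup>2)"
proof -
  have "(\<lambda>x. indicator \<Omega> x *\<^sub>R f x) = zext \<Omega> f" by (simp add: zext_def[abs_def])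
  then show ?thesis
    by (simp only: L2_def set_integrable_zext zext_norm_power2 mem_Collect_eq set_borel_measurable_def)
qed

lemma set_integral_linear:
  assumes "set_integrable M \<Omega> f" "set_integrable M \<Omega> g"
  shows "(LINT x:\<Omega>|M. a *\<^sub>R f x + b *\<^sub>R g x) = a *\<^sub>R (LINT x:\<Omega>|M. f x) + b *\<^sub>R (LINT x:\<Omega>|M. g x)"
  using assms unfolding set_integral_zext zext_add zext_scaleR set_integrable_zext by simp

lemma set_integrable_linear:
  assumes "set_integrable M \<Omega> f" "set_integrable M \<Omega> g"
  shows "set_integrable M \<Omega> (\<lambda>x. a *\<^sub>R f x + b *\<^sub>R g x)"
  using assms unfolding set_integrable_zext zext_add zext_scaleR by simp

lemma norm_add_power2_le: "(norm (a + b))\<^sup>2 \<le> 2 * (norm a)\<^sup>2 + 2 * (norm b)\<^sup>2"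
proof -
  have "(norm (a + b))\<^sup>2 \<le> (norm a + norm b)\<^sup>2" by (intro power_mono norm_triangle_ineq) simp
  also have "\<dots> \<le> 2 * (norm a)\<^sup>2 + 2 * (norm b)\<^sup>2"
    using sum_squares_bound[of "norm a" "norm b"] by (simp add: power2_sum)
  finally show ?thesis .
qed

lemma norm_le_1_plus_power2: "norm a \<le> 1 + (norm a)\<^sup>2"
proof -
  have "2 * norm a \<le> (norm a)\<^sup>2 + 1" using sum_squares_bound[of "norm a" 1] by simp
  then show ?thesis using norm_ge_zero[of a] by linarith
qed

lemma norm_mult_norm_le: "norm a * norm b \<le> (norm a)\<^sup>2 + (norm b)\<^sup>2"
proof -
  have "2 * (norm a * norm b) \<le> (norm a)\<^sup>2 + (norm b)\<^sup>2"
    using sum_squares_bound[of "norm a" "norm b"] by simp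
  then show ?thesis using mult_nonneg_nonneg[OF norm_ge_zero[of a] norm_ge_zero[of b]] by linarith
qed

lemma square_integrable_add:
  fixes f g :: "'a \<Rightarrow> 'b :: euclidean_space"
  assumes f: "f \<in> borel_measurable M" "integrable M (\<lambda>x. (norm (f x))\<^sup>2)"
    and g: "g \<in> borel_measurable M" "integrable M (\<lambda>x. (norm (g x))\<^sup>2)"
  shows "integrable M (\<lambda>x. (norm (f x + g x))\<^sup>2)"
proof (rule Bochner_Integration.integrable_bound)
  show "integrable M (\<lambda>x. 2 * (norm (f x))\<^sup>2 + 2 * (norm (g x))\<^sup>2)"
    using f g by simp
  show "(\<lambda>x. (norm (f x + g x))\<^sup>2) \<in> borel_measurable M"
    using f(1) g(1) by measurable
  show "AE x in M. norm ((norm (f x + g x))\<^sup>2) \<le> norm (2 * (norm (f x))\<^sup>2 + 2 * (norm (g x))\<^sup>2)"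
    by (intro AE_I2) (simp add: norm_add_power2_le)
qed

lemma L2_add: "f \<in> L2 \<Omega> \<Longrightarrow> g \<in> L2 \<Omega> \<Longrightarrow> (\<lambda>x. f x + g x) \<in> L2 \<Omega>"
  unfolding L2_iff zext_add by (auto intro: square_integrable_add)

lemma L2_scale: "f \<in> L2 \<Omega> \<Longrightarrow> (\<lambda>x. c *\<^sub>R f x) \<in> L2 \<Omega>"
  unfolding L2_iff zext_scaleR by (auto simp: power_mult_distrib)

lemma L2_diff: "f \<in> L2 \<Omega> \<Longrightarrow> g \<in> L2 \<Omega> \<Longrightarrow> (\<lambda>x. f x - g x) \<in> L2 \<Omega>"
  using L2_add[of f \<Omega> "\<lambda>x. (- 1) *\<^sub>R g x"] L2_scale[of g \<Omega> "- 1"] by simp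

lemma L2_scaleR_integrable:
  fixes g :: "'a :: euclidean_space \<Rightarrow> 'b :: euclidean_space"
  assumes u: "u \<in> L2 \<Omega>" and g: "g \<in> L2 \<Omega>"
  shows "set_integrable lebesgue \<Omega> (\<lambda>x. u x *\<^sub>R g x)"
proof -
  have eq: "zext \<Omega> (\<lambda>x. u x *\<^sub>R g x) = (\<lambda>x. zext \<Omega> u x *\<^sub>R zext \<Omega> g x)"
    by (rule ext) (simp add: zext_def indicator_def)
  have "integrable lebesgue (\<lambda>x. zext \<Omega> u x *\<^sub>R zext \<Omega> g x)"
  proof (rule Bochner_Integration.integrable_bound)
    show "integrable lebesgue (\<lambda>x. (norm (zext \<Omega> u x))\<^sup>2 + (norm (zext \<Omega> g x))\<^sup>2)"
      using u g unfolding L2_iff by (intro Bochner_Integration.integrable_add) auto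
    show "(\<lambda>x. zext \<Omega> u x *\<^sub>R zext \<Omega> g x) \<in> borel_measurable lebesgue"
      using u g unfolding L2_iff by (intro borel_measurable_scaleR) auto
    show "AE x in lebesgue. norm (zext \<Omega> u x *\<^sub>R zext \<Omega> g x)
        \<le> norm ((norm (zext \<Omega> u x))\<^sup>2 + (norm (zext \<Omega> g x))\<^sup>2)"
      using norm_mult_norm_le[of "zext \<Omega> u x" "zext \<Omega> g x" for x] by (intro AE_I2) simp
  qed
  then show ?thesis by (simp only: set_integrable_zext eq)
qed

text \<open>On a set of finite measure |g| is dominated by the integrable function 1 +
  |g|^2.\<close>

lemma integrable_on_bounded_if_square_integrable:
  fixes g :: "'a :: euclidean_space \<Rightarrow> 'b :: euclidean_space"
  assumes m: "g \<in> borel_measurable lebesgue" and i: "integrable lebesgue (\<lambda>x. (norm (g x))\<^sup>2)"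
    and S: "S \<in> sets lebesgue" "emeasure lebesgue S < \<infinity>"
  shows "set_integrable lebesgue S g"
  unfolding set_integrable_def
proof (rule Bochner_Integration.integrable_bound)
  show "integrable lebesgue (\<lambda>x. indicator S x + (norm (g x))\<^sup>2)"
    using i S by (intro Bochner_Integration.integrable_add integrable_real_indicator)
  show "(\<lambda>x. indicator S x *\<^sub>R g x) \<in> borel_measurable lebesgue"
    using m S by (intro borel_measurable_scaleR borel_measurable_indicator)
  show "AE x in lebesgue. norm (indicator S x *\<^sub>R g x) \<le> norm (indicator S x + (norm (g x))\<^sup>2)"
    using norm_le_1_plus_power2 by (intro AE_I2) (auto simp: indicator_def)
qed

lemma test_functions_L2:
  fixes \<phi> :: "'a :: euclidean_space \<Rightarrow> real"
  assumes \<phi>: "\<phi> \<in> test_functions \<Omega>" and \<Omega>: "open \<Omega>"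
  shows "\<phi> \<in> L2 \<Omega>" "grad \<phi> \<in> L2 \<Omega>"
proof -
  obtain K where K: "compact K" and z: "\<And>x. x \<notin> K \<Longrightarrow> \<phi> x = 0" "\<And>x. x \<notin> K \<Longrightarrow> grad \<phi> x = 0"
    using test_functions_support[OF \<phi>] by blast
  have L2: "f \<in> L2 \<Omega>" if f: "continuous_on UNIV f" and z: "\<And>x. x \<notin> K \<Longrightarrow> f x = 0"
    and z': "\<And>x. x \<notin> \<Omega> \<Longrightarrow> f x = 0" for f :: "'a \<Rightarrow> 'c :: euclidean_space"
  proof -
    have "zext \<Omega> f = f" using z' by (auto simp: zext_def indicator_def)
    moreover have "f \<in> borel_measurable lebesgue"
      using f by (intro measurable_completion) (simp add: borel_measurable_continuous_onI)
    moreover have "integrable lebesgue (\<lambda>x. (norm (f x))\<^sup>2)"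
      using f z by (intro integrable_continuous_compact_support(1)[OF _ K]) (auto intro!: continuous_intros)
    ultimately show ?thesis by (simp add: L2_iff)
  qed
  show "\<phi> \<in> L2 \<Omega>"
    using L2[OF test_functions_continuous[OF \<phi>] z(1)] test_functions_zero[OF \<phi>] by blast
  show "grad \<phi> \<in> L2 \<Omega>"
    using L2[OF test_functions_grad_continuous[OF \<phi>] z(2)] test_functions_zero[OF \<phi>] by blast
qed

section \<open>Uniqueness and linearity of weak gradients\<close>

text \<open>The difference of two weak gradients has integral 0 against every test function, so the
  fundamental lemma applies. This makes the arbitrary choice in \<open>wgrad\<close>
  harmless.\<close>

lemma weak_gradient_unique:
  assumes \<Omega>: "open \<Omega>" and g: "L2_weak_gradient \<Omega> u g" and h: "L2_weak_gradient \<Omega> u h"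
  shows "AE x in lebesgue. x \<in> \<Omega> \<longrightarrow> g x = h x"
proof -
  let ?d = "\<lambda>x. g x - h x"
  have L2: "g \<in> L2 \<Omega>" "h \<in> L2 \<Omega>" using g h by (auto simp: L2_weak_gradient_def)
  then have d: "?d \<in> L2 \<Omega>" by (rule L2_diff)
  have "AE x in lebesgue. x \<in> \<Omega> \<longrightarrow> ?d x = 0"
  proof (rule fundamental_lemma[OF \<Omega>])
    show "set_integrable lebesgue (cbox a b) (\<lambda>x. indicator \<Omega> x *\<^sub>R ?d x)" for a b
      using d unfolding L2_iff zext_def[symmetric]
      by (intro integrable_on_bounded_if_square_integrable) (auto simp: emeasure_lborel_cbox_eq zext_def[abs_def])
    show "(LINT x:\<Omega>|lebesgue. \<phi> x *\<^sub>R ?d x) = 0" if \<phi>: "\<phi> \<in> test_functions \<Omega>" for \<phi>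
    proof -
      have "(LINT x:\<Omega>|lebesgue. \<phi> x *\<^sub>R ?d x)
          = (LINT x:\<Omega>|lebesgue. \<phi> x *\<^sub>R g x) - (LINT x:\<Omega>|lebesgue. \<phi> x *\<^sub>R h x)"
        unfolding scaleR_diff_right
        by (intro set_integral_diff L2_scaleR_integrable test_functions_L2[OF \<phi> \<Omega>] L2)
      also have "\<dots> = 0"
        using g h \<phi> unfolding L2_weak_gradient_def by (metis add.inverse_inverse cancel_comm_monoid_add_class.diff_cancel)
      finally show ?thesis .
    qed
  qed
  then show ?thesis by simp
qed

text \<open>Linearity is shown for the relation, since the chosen \<open>wgrad\<close> is linear
  only almost everywhere.\<close>

lemma weak_gradient_linear:
  assumes \<Omega>: "open \<Omega>" and u: "u \<in> L2 \<Omega>" "L2_weak_gradient \<Omega> u g"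
    and v: "v \<in> L2 \<Omega>" "L2_weak_gradient \<Omega> v h"
  shows "L2_weak_gradient \<Omega> (\<lambda>x. a * u x + b * v x) (\<lambda>x. a *\<^sub>R g x + b *\<^sub>R h x)"
proof -
  have L2: "g \<in> L2 \<Omega>" "h \<in> L2 \<Omega>" using u v by (auto simp: L2_weak_gradient_def)
  have "(LINT x:\<Omega>|lebesgue. (a * u x + b * v x) *\<^sub>R grad \<phi> x)
      = - (LINT x:\<Omega>|lebesgue. \<phi> x *\<^sub>R (a *\<^sub>R g x + b *\<^sub>R h x))" if \<phi>: "\<phi> \<in> test_functions \<Omega>" for \<phi>
  proof -
    note t = test_functions_L2[OF \<phi> \<Omega>]
    note i = L2_scaleR_integrable[OF u(1) t(2)] L2_scaleR_integrable[OF v(1) t(2)]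
      L2_scaleR_integrable[OF t(1) L2(1)] L2_scaleR_integrable[OF t(1) L2(2)]
    have "(LINT x:\<Omega>|lebesgue. (a * u x + b * v x) *\<^sub>R grad \<phi> x)
        = (LINT x:\<Omega>|lebesgue. a *\<^sub>R (u x *\<^sub>R grad \<phi> x) + b *\<^sub>R (v x *\<^sub>R grad \<phi> x))"
      by (simp add: scaleR_add_left)
    also have "\<dots> = a *\<^sub>R (LINT x:\<Omega>|lebesgue. u x *\<^sub>R grad \<phi> x) + b *\<^sub>R (LINT x:\<Omega>|lebesgue. v x *\<^sub>R grad \<phi> x)"
      by (rule set_integral_linear[OF i(1,2)])
    also have "\<dots> = - (a *\<^sub>R (LINT x:\<Omega>|lebesgue. \<phi> x *\<^sub>R g x) + b *\<^sub>R (LINT x:\<Omega>|lebesgue. \<phi> x *\<^sub>R h x))"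
      using u v \<phi> by (simp add: L2_weak_gradient_def)
    also have "a *\<^sub>R (LINT x:\<Omega>|lebesgue. \<phi> x *\<^sub>R g x) + b *\<^sub>R (LINT x:\<Omega>|lebesgue. \<phi> x *\<^sub>R h x)
        = (LINT x:\<Omega>|lebesgue. a *\<^sub>R (\<phi> x *\<^sub>R g x) + b *\<^sub>R (\<phi> x *\<^sub>R h x))"
      by (rule set_integral_linear[OF i(3,4), symmetric])
    also have "\<dots> = (LINT x:\<Omega>|lebesgue. \<phi> x *\<^sub>R (a *\<^sub>R g x + b *\<^sub>R h x))"
      by (simp add: scaleR_add_right mult.commute)
    finally show ?thesis .
  qed
  then show ?thesis using L2 by (simp add: L2_weak_gradient_def L2_add L2_scale)
qed

lemma H1_wgrad: "u \<in> H1 \<Omega> \<Longrightarrow> L2_weak_gradient \<Omega> u (wgrad \<Omega> u)"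
  unfolding wgrad_def H1_def using someI_ex[of "L2_weak_gradient \<Omega> u"] by simp

lemma H1_wgrad_L2: "u \<in> H1 \<Omega> \<Longrightarrow> wgrad \<Omega> u \<in> L2 \<Omega>"
  using H1_wgrad by (auto simp: L2_weak_gradient_def)

lemma H1_L2: "u \<in> H1 \<Omega> \<Longrightarrow> u \<in> L2 \<Omega>"
  by (simp add: H1_def)

lemma H1I: "u \<in> L2 \<Omega> \<Longrightarrow> L2_weak_gradient \<Omega> u g \<Longrightarrow> u \<in> H1 \<Omega>"
  by (auto simp: H1_def)

lemma wgrad_eq:
  assumes "open \<Omega>" "u \<in> L2 \<Omega>" "L2_weak_gradient \<Omega> u g"
  shows "AE x in lebesgue. x \<in> \<Omega> \<longrightarrow> wgrad \<Omega> u x = g x"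
  using weak_gradient_unique[OF assms(1) H1_wgrad[OF H1I[OF assms(2,3)]] assms(3)] .

lemma H1_linear:
  assumes \<Omega>: "open \<Omega>" and u: "u \<in> H1 \<Omega>" and v: "v \<in> H1 \<Omega>"
  shows "(\<lambda>x. a * u x + b * v x) \<in> H1 \<Omega>"
    "AE x in lebesgue. x \<in> \<Omega> \<longrightarrow>
      wgrad \<Omega> (\<lambda>x. a * u x + b * v x) x = a *\<^sub>R wgrad \<Omega> u x + b *\<^sub>R wgrad \<Omega> v x"
proof -
  note g = weak_gradient_linear[OF \<Omega> H1_L2[OF u] H1_wgrad[OF u] H1_L2[OF v] H1_wgrad[OF v], of a b]
  have L2: "(\<lambda>x. a * u x + b * v x) \<in> L2 \<Omega>"
    using L2_add[OF L2_scale[OF H1_L2[OF u], of a] L2_scale[OF H1_L2[OF v], of b]] by simp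
  show "(\<lambda>x. a * u x + b * v x) \<in> H1 \<Omega>" using H1I[OF L2 g] .
  show "AE x in lebesgue. x \<in> \<Omega> \<longrightarrow>
      wgrad \<Omega> (\<lambda>x. a * u x + b * v x) x = a *\<^sub>R wgrad \<Omega> u x + b *\<^sub>R wgrad \<Omega> v x"
    using wgrad_eq[OF \<Omega> L2 g] .
qed

lemma H1_scale:
  assumes "open \<Omega>" "u \<in> H1 \<Omega>"
  shows "(\<lambda>x. c * u x) \<in> H1 \<Omega>"
    "AE x in lebesgue. x \<in> \<Omega> \<longrightarrow> wgrad \<Omega> (\<lambda>x. c * u x) x = c *\<^sub>R wgrad \<Omega> u x"
  using H1_linear[OF assms assms(2), of c 0] by simp_all

lemma H1_diff:
  assumes "open \<Omega>" "u \<in> H1 \<Omega>" "v \<in> H1 \<Omega>"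
  shows "(\<lambda>x. u x - v x) \<in> H1 \<Omega>"
    "AE x in lebesgue. x \<in> \<Omega> \<longrightarrow> wgrad \<Omega> (\<lambda>x. u x - v x) x = wgrad \<Omega> u x - wgrad \<Omega> v x"
  using H1_linear[OF assms, of 1 "- 1"] by simp_all

lemma test_functions_H1: "\<phi> \<in> test_functions \<Omega> \<Longrightarrow> open \<Omega> \<Longrightarrow> \<phi> \<in> H1 \<Omega>"
  by (rule H1I[where g = "grad \<phi>"])
     (auto simp: test_functions_L2 L2_weak_gradient_def intro: test_functions_integration_by_parts)

section \<open>Energies, Nehari sets and the least energy inequality\<close>

text \<open>The square of the norm on the space in which the equation has its variational form; for
  \<open>lam = 1\<close> it is the square of \<open>H1_norm\<close>.\<close>

definition hform :: "'a :: euclidean_space set \<Rightarrow> real \<Rightarrow> ('a \<Rightarrow> real) \<Rightarrow> real" where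
  "hform \<Omega> lam u = (LINT x:\<Omega>|lebesgue. (norm (wgrad \<Omega> u x))\<^sup>2 + lam * (u x)\<^sup>2)"

lemma L2_norm_power2_integrable: "f \<in> L2 \<Omega> \<Longrightarrow> set_integrable lebesgue \<Omega> (\<lambda>x. (norm (f x))\<^sup>2)"
  by (simp add: L2_def)

lemma zext_cong_AE:
  "AE x in M. x \<in> \<Omega> \<longrightarrow> f x = g x \<Longrightarrow> AE x in M. zext \<Omega> f x = zext \<Omega> g x"
  by (erule eventually_mono) (auto simp: zext_def indicator_def)

lemma hform_integrand_integrable:
  assumes "g \<in> L2 \<Omega>" "u \<in> L2 \<Omega>"
  shows "set_integrable lebesgue \<Omega> (\<lambda>x. (norm (g x))\<^sup>2 + lam * (u x)\<^sup>2)"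
  using L2_norm_power2_integrable[OF assms(1)] L2_norm_power2_integrable[OF assms(2)]
  by (intro set_integral_add set_integrable_mult_right) auto

lemma set_integral_cong_zext_AE:
  fixes f g :: "'a \<Rightarrow> 'b :: {banach, second_countable_topology}"
  assumes "zext \<Omega> f \<in> borel_measurable M" "zext \<Omega> g \<in> borel_measurable M"
    and "AE x in M. x \<in> \<Omega> \<longrightarrow> f x = g x"
  shows "(LINT x:\<Omega>|M. f x) = (LINT x:\<Omega>|M. g x)"
  unfolding set_integral_zext by (rule integral_cong_AE[OF assms(1,2) zext_cong_AE[OF assms(3)]])

text \<open>Weak gradients agree almost everywhere on \<Omega>. Needed wherever a gradient is known
  explicitly, as for multiples, sums and averages.\<close>

lemma hform_eq:
  assumes \<Omega>: "open \<Omega>" and u: "u \<in> L2 \<Omega>" and g: "L2_weak_gradient \<Omega> u g"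
  shows "hform \<Omega> lam u = (LINT x:\<Omega>|lebesgue. (norm (g x))\<^sup>2 + lam * (u x)\<^sup>2)"
  unfolding hform_def
proof (rule set_integral_cong_zext_AE)
  have "g \<in> L2 \<Omega>" using g by (simp add: L2_weak_gradient_def)
  then show "zext \<Omega> (\<lambda>x. (norm (g x))\<^sup>2 + lam * (u x)\<^sup>2) \<in> borel_measurable lebesgue"
    using hform_integrand_integrable[OF _ u] set_integrable_zext borel_measurable_integrable by blast
  have "wgrad \<Omega> u \<in> L2 \<Omega>" using H1_wgrad_L2[OF H1I[OF u g]] .
  then show "zext \<Omega> (\<lambda>x. (norm (wgrad \<Omega> u x))\<^sup>2 + lam * (u x)\<^sup>2) \<in> borel_measurable lebesgue"
    using hform_integrand_integrable[OF _ u] set_integrable_zext borel_measurable_integrable by blast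
  show "AE x in lebesgue. x \<in> \<Omega> \<longrightarrow>
      (norm (wgrad \<Omega> u x))\<^sup>2 + lam * (u x)\<^sup>2 = (norm (g x))\<^sup>2 + lam * (u x)\<^sup>2"
    using wgrad_eq[OF \<Omega> u g] by (auto elim: eventually_mono)
qed

lemma hform_scale:
  assumes \<Omega>: "open \<Omega>" and u: "u \<in> H1 \<Omega>"
  shows "hform \<Omega> lam (\<lambda>x. c * u x) = c\<^sup>2 * hform \<Omega> lam u"
proof -
  have g: "L2_weak_gradient \<Omega> (\<lambda>x. c * u x) (\<lambda>x. c *\<^sub>R wgrad \<Omega> u x)"
    using weak_gradient_linear[OF \<Omega> H1_L2[OF u] H1_wgrad[OF u] H1_L2[OF u] H1_wgrad[OF u], of c 0] by simp
  have "hform \<Omega> lam (\<lambda>x. c * u x)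
      = (LINT x:\<Omega>|lebesgue. (norm (c *\<^sub>R wgrad \<Omega> u x))\<^sup>2 + lam * (c * u x)\<^sup>2)"
    by (rule hform_eq[OF \<Omega> H1_L2[OF H1_scale(1)[OF \<Omega> u]] g])
  also have "\<dots> = (LINT x:\<Omega>|lebesgue. c\<^sup>2 * ((norm (wgrad \<Omega> u x))\<^sup>2 + lam * (u x)\<^sup>2))"
    by (simp add: power_mult_distrib algebra_simps)
  finally show ?thesis by (simp add: hform_def)
qed

lemma hform_nonneg: "lam \<ge> 0 \<Longrightarrow> hform \<Omega> lam u \<ge> 0"
  unfolding hform_def set_lebesgue_integral_def
  by (intro integral_nonneg_AE AE_I2) (auto simp: indicator_def)

lemma hform_pos:
  assumes u: "u \<in> H1 \<Omega>" and lam: "lam > 0" and nz: "\<not> zero_on \<Omega> u"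
  shows "hform \<Omega> lam u > 0"
proof (rule ccontr)
  let ?f = "\<lambda>x. (norm (wgrad \<Omega> u x))\<^sup>2 + lam * (u x)\<^sup>2"
  assume "\<not> hform \<Omega> lam u > 0"
  then have "hform \<Omega> lam u = 0" using hform_nonneg[of lam \<Omega> u] lam by simp
  then have 0: "integral\<^sup>L lebesgue (zext \<Omega> ?f) = 0" by (simp add: hform_def set_integral_zext)
  have "integrable lebesgue (zext \<Omega> ?f)"
    using hform_integrand_integrable[OF H1_wgrad_L2[OF u] H1_L2[OF u]] by (simp add: set_integrable_zext)
  moreover have "AE x in lebesgue. 0 \<le> zext \<Omega> ?f x"
    using lam by (intro AE_I2) (auto simp: zext_def indicator_def)
  ultimately have "AE x in lebesgue. zext \<Omega> ?f x = 0"
    using 0 integral_nonneg_eq_0_iff_AE by blast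
  then have "zero_on \<Omega> u" unfolding zero_on_def
  proof (rule eventually_mono)
    fix x assume "zext \<Omega> ?f x = 0"
    then show "x \<in> \<Omega> \<longrightarrow> u x = 0"
      using lam by (auto simp: add_nonneg_eq_0_iff)
  qed
  then show False using nz by simp
qed

lemma H1_norm_hform: "H1_norm \<Omega> u = sqrt (hform \<Omega> 1 u)"
  by (simp add: H1_norm_def hform_def)

lemma test_functions_scale: "\<phi> \<in> test_functions \<Omega> \<Longrightarrow> (\<lambda>x. c * \<phi> x) \<in> test_functions \<Omega>"
proof -
  assume \<phi>: "\<phi> \<in> test_functions \<Omega>"
  have "closure {x. c * \<phi> x \<noteq> 0} \<subseteq> closure {x. \<phi> x \<noteq> 0}" by (intro closure_mono) auto
  moreover from this have "compact (closure {x. c * \<phi> x \<noteq> 0})"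
    using \<phi> unfolding test_functions_def by (metis (mono_tags, lifting) closed_closure compact_Int_closed inf.absorb_iff2 mem_Collect_eq)
  ultimately show ?thesis using \<phi> by (auto simp: test_functions_def intro: is_Ck_mult is_Ck_const)
qed

lemma Hspace_H1: "u \<in> Hspace \<Omega> \<Longrightarrow> u \<in> H1 \<Omega>"
  by (auto simp: Hspace_def H10_def split: if_splits)

lemma H10_scale:
  assumes \<Omega>: "open \<Omega>" and u: "u \<in> H10 \<Omega>"
  shows "(\<lambda>x. c * u x) \<in> H10 \<Omega>"
proof -
  obtain \<phi> where u1: "u \<in> H1 \<Omega>" and \<phi>: "\<And>k. \<phi> k \<in> test_functions \<Omega>"
    and lim: "(\<lambda>k. H1_norm \<Omega> (\<lambda>x. \<phi> k x - u x)) \<longlonglongrightarrow> 0"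
    using u unfolding H10_def by auto
  have eq: "H1_norm \<Omega> (\<lambda>x. c * \<phi> k x - c * u x) = \<bar>c\<bar> * H1_norm \<Omega> (\<lambda>x. \<phi> k x - u x)" for k
    using hform_scale[OF \<Omega> H1_diff(1)[OF \<Omega> test_functions_H1[OF \<phi> \<Omega>] u1], of 1 c k]
    by (simp add: H1_norm_hform right_diff_distrib real_sqrt_mult)
  have "(\<lambda>k. H1_norm \<Omega> (\<lambda>x. c * \<phi> k x - c * u x)) \<longlonglongrightarrow> \<bar>c\<bar> * 0"
    unfolding eq by (intro tendsto_intros lim)
  then have "(\<lambda>k. H1_norm \<Omega> (\<lambda>x. c * \<phi> k x - c * u x)) \<longlonglongrightarrow> 0" by simp
  moreover have "\<forall>k. (\<lambda>x. c * \<phi> k x) \<in> test_functions \<Omega>" using test_functions_scale[OF \<phi>] by blast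
  ultimately show ?thesis
    using H1_scale(1)[OF \<Omega> u1] unfolding H10_def mem_Collect_eq
    by (intro conjI exI[of _ "\<lambda>k x. c * \<phi> k x"])
qed

lemma Hspace_scale:
  assumes \<Omega>: "open \<Omega>" and u: "u \<in> Hspace \<Omega>"
  shows "(\<lambda>x. c * u x) \<in> Hspace \<Omega>"
proof (cases "\<Omega> = UNIV")
  case True
  then obtain f where "AE x in lebesgue. u x = f (norm x)"
    using u by (auto simp: Hspace_def radial_def)
  then have "AE x in lebesgue. c * u x = c * f (norm x)" by (rule eventually_mono) simp
  then have "radial (\<lambda>x. c * u x)" unfolding radial_def by (intro exI[of _ "\<lambda>r. c * f r"])
  then show ?thesis using True H1_scale(1)[OF \<Omega> Hspace_H1[OF u]] by (simp add: Hspace_def)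
next
  case False
  then show ?thesis using u H10_scale[OF \<Omega>] by (simp add: Hspace_def)
qed

lemma test_functions_Hspace:
  assumes "open \<Omega>" "\<Omega> \<noteq> UNIV" "\<phi> \<in> test_functions \<Omega>"
  shows "\<phi> \<in> Hspace \<Omega>"
proof -
  have "hform \<Omega> 1 (\<lambda>x. 0 * \<phi> x) = 0\<^sup>2 * hform \<Omega> 1 \<phi>"
    by (rule hform_scale[OF assms(1) test_functions_H1[OF assms(3,1)]])
  then have "H1_norm \<Omega> (\<lambda>x. \<phi> x - \<phi> x) = 0" by (simp add: H1_norm_hform)
  then show ?thesis using assms test_functions_H1[OF assms(3,1)]
    by (auto simp: Hspace_def H10_def intro!: exI[of _ "\<lambda>k. \<phi>"])
qed

section \<open>Nehari identities and the least energy inequality\<close>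

text \<open>Both energies consist of a part homogeneous of degree 2 and one of degree 4, so along
  the ray through u the derivative at t = 0 is Q - F. This turns the Nehari condition into an
  equation between the two parts.\<close>

lemma energy_along_ray_critical_iff:
  "((\<lambda>t. 1/2 * ((1 + t)\<^sup>2 * Q) - 1/4 * ((1 + t)^4 * F)) has_real_derivative 0) (at 0) \<longleftrightarrow> Q = F"
    (is "(?f has_real_derivative 0) (at 0) \<longleftrightarrow> _")
proof -
  have *: "(?f has_real_derivative (Q - F)) (at 0)"
    by (auto intro!: derivative_eq_intros)
  show ?thesis
  proof
    assume "(?f has_real_derivative 0) (at 0)"
    from DERIV_unique[OF this *] show "Q = F" by simp
  qed (use * in simp)
qed

lemma scalar_energy_scale:
  assumes "open \<Omega>" "u \<in> H1 \<Omega>"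
  shows "scalar_energy \<Omega> lam (\<lambda>x. c * u x)
    = 1/2 * (c\<^sup>2 * hform \<Omega> lam u) - 1/4 * (c^4 * (LINT x:\<Omega>|lebesgue. (u x)^4))"
  using hform_scale[OF assms, of lam c]
  by (simp add: scalar_energy_def hform_def power_mult_distrib)

lemma scalar_nehari_iff:
  assumes \<Omega>: "open \<Omega>"
  shows "u \<in> scalar_nehari \<Omega> lam \<longleftrightarrow> u \<in> Hspace \<Omega> \<and> \<not> zero_on \<Omega> u \<and>
    hform \<Omega> lam u = (LINT x:\<Omega>|lebesgue. (u x)^4)"
proof (cases "u \<in> Hspace \<Omega>")
  case True
  have "(\<lambda>t. scalar_energy \<Omega> lam (\<lambda>x. u x + t * u x)) = (\<lambda>t. 1/2 * ((1 + t)\<^sup>2 * hform \<Omega> lam u)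
      - 1/4 * ((1 + t)^4 * (LINT x:\<Omega>|lebesgue. (u x)^4)))"
    unfolding scalar_energy_scale[OF \<Omega> Hspace_H1[OF True], symmetric] by (simp add: distrib_right)
  then show ?thesis
    using True unfolding scalar_nehari_def mem_Collect_eq
    by (simp only: energy_along_ray_critical_iff simp_thms)
qed (simp add: scalar_nehari_def)

definition quartic :: "'a :: euclidean_space set \<Rightarrow> real ^ 'n ^ 'n \<Rightarrow> ('n \<Rightarrow> 'a \<Rightarrow> real) \<Rightarrow> real" where
  "quartic \<Omega> A u = (LINT x:\<Omega>|lebesgue. (\<Sum>i\<in>UNIV. \<Sum>j\<in>UNIV. A $ i $ j * (u i x)\<^sup>2 * (u j x)\<^sup>2))"

lemma energy_scale:
  fixes A :: "real ^ 'n ^ 'n"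
  assumes "open \<Omega>" "\<And>i. u i \<in> H1 \<Omega>"
  shows "energy \<Omega> lam A (\<lambda>i x. c * u i x)
    = 1/2 * (c\<^sup>2 * (\<Sum>i\<in>UNIV. hform \<Omega> lam (u i))) - 1/4 * (c^4 * quartic \<Omega> A u)"
proof -
  have "(\<Sum>i\<in>UNIV. \<Sum>j\<in>UNIV. A $ i $ j * (c * u i x)\<^sup>2 * (c * u j x)\<^sup>2)
      = c^4 * (\<Sum>i\<in>UNIV. \<Sum>j\<in>UNIV. A $ i $ j * (u i x)\<^sup>2 * (u j x)\<^sup>2)" for x
    by (simp add: sum_distrib_left power_mult_distrib power4_eq_xxxx power2_eq_square mult_ac)
  then have "(LINT x:\<Omega>|lebesgue. (\<Sum>i\<in>UNIV. \<Sum>j\<in>UNIV. A $ i $ j * (c * u i x)\<^sup>2 * (c * u j x)\<^sup>2))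
      = c^4 * quartic \<Omega> A u" by (simp add: quartic_def)
  then show ?thesis
    using hform_scale[OF assms(1) assms(2), of lam c]
    by (simp add: energy_def hform_def sum_distrib_left)
qed

lemma nehari_iff:
  fixes A :: "real ^ 'n ^ 'n"
  assumes \<Omega>: "open \<Omega>"
  shows "u \<in> nehari \<Omega> lam A \<longleftrightarrow> (\<forall>i. u i \<in> Hspace \<Omega>) \<and> \<not> (\<forall>i. zero_on \<Omega> (u i)) \<and>
    (\<Sum>i\<in>UNIV. hform \<Omega> lam (u i)) = quartic \<Omega> A u"
proof (cases "\<forall>i. u i \<in> Hspace \<Omega>")
  case True
  have "(\<lambda>i x. u i x + t * u i x) = (\<lambda>i x. (1 + t) * u i x)" for t by (simp add: distrib_right)
  then have "(\<lambda>t. energy \<Omega> lam A (\<lambda>i x. u i x + t * u i x))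
      = (\<lambda>t. 1/2 * ((1 + t)\<^sup>2 * (\<Sum>i\<in>UNIV. hform \<Omega> lam (u i))) - 1/4 * ((1 + t)^4 * quartic \<Omega> A u))"
    unfolding energy_scale[OF \<Omega> Hspace_H1[OF True[rule_format]], symmetric] by simp
  then show ?thesis
    using True unfolding nehari_def mem_Collect_eq
    by (simp only: energy_along_ray_critical_iff simp_thms)
qed (auto simp: nehari_def)

text \<open>With equal quadratic and quartic parts Q, the energy is Q / 2 - Q / 4.\<close>

lemma energy_on_nehari:
  fixes A :: "real ^ 'n ^ 'n"
  assumes \<Omega>: "open \<Omega>" and u: "u \<in> nehari \<Omega> lam A"
  shows "energy \<Omega> lam A u = 1/4 * (\<Sum>i\<in>UNIV. hform \<Omega> lam (u i))"
proof -
  have "u i \<in> H1 \<Omega>" for i using u Hspace_H1 by (auto simp: nehari_def)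
  from energy_scale[OF \<Omega> this, of lam A 1] show ?thesis using u by (simp add: nehari_iff[OF \<Omega>])
qed

lemma scalar_energy_on_nehari:
  assumes \<Omega>: "open \<Omega>" and u: "u \<in> scalar_nehari \<Omega> lam"
  shows "scalar_energy \<Omega> lam u = 1/4 * hform \<Omega> lam u"
proof -
  have "u \<in> H1 \<Omega>" using u Hspace_H1 by (auto simp: scalar_nehari_def)
  from scalar_energy_scale[OF \<Omega> this, of lam 1] show ?thesis
    using u by (simp add: scalar_nehari_iff[OF \<Omega>])
qed

lemma set_integral_even_power_nonneg: "even k \<Longrightarrow> (LINT x:\<Omega>|M. (u x :: real)^k) \<ge> 0"
  unfolding set_lebesgue_integral_def
  by (intro integral_nonneg_AE AE_I2) (auto simp: indicator_def zero_le_even_power)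

text \<open>If \<open>v^4\<close> is not integrable, then its integral is the junk value 0.\<close>

lemma least_energy_Sobolev:
  assumes \<Omega>: "open \<Omega>" and lam: "lam > 0" and U: "least_energy_solution \<Omega> lam U"
    and v: "v \<in> Hspace \<Omega>"
  shows "hform \<Omega> lam U * (LINT x:\<Omega>|lebesgue. (v x)^4) \<le> (hform \<Omega> lam v)\<^sup>2"
proof (cases "(LINT x:\<Omega>|lebesgue. (v x)^4) = 0")
  case False
  let ?P = "LINT x:\<Omega>|lebesgue. (v x)^4"
  let ?N = "hform \<Omega> lam v"
  have P: "?P > 0" using False set_integral_even_power_nonneg[of 4 lebesgue \<Omega> v] by simp
  have nz: "\<not> zero_on \<Omega> v"
  proof
    assume "zero_on \<Omega> v"
    then have "AE x in lebesgue. zext \<Omega> (\<lambda>x. (v x)^4) x = 0"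
      unfolding zero_on_def by (rule eventually_mono) (auto simp: zext_def indicator_def)
    then have "?P = 0" unfolding set_integral_zext by (rule integral_eq_zero_AE)
    then show False using False by simp
  qed
  have N: "?N > 0" by (rule hform_pos[OF Hspace_H1[OF v] lam nz])
  \<comment> \<open>The factor that puts a multiple of v on the Nehari set: s^2 N = s^4 P.\<close>
  define s where "s = sqrt (?N / ?P)"
  have s: "s > 0" "s\<^sup>2 = ?N / ?P" using N P by (auto simp: s_def)
  let ?w = "\<lambda>x. s * v x"
  have wN: "hform \<Omega> lam ?w = s\<^sup>2 * ?N" by (rule hform_scale[OF \<Omega> Hspace_H1[OF v]])
  have "(LINT x:\<Omega>|lebesgue. (?w x)^4) = s^4 * ?P" by (simp add: power_mult_distrib)
  also have "\<dots> = s\<^sup>2 * (s\<^sup>2 * ?P)" by (simp add: power4_eq_xxxx power2_eq_square)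
  also have "\<dots> = s\<^sup>2 * ?N" using s P by simp
  finally have w: "?w \<in> scalar_nehari \<Omega> lam"
    using wN Hspace_scale[OF \<Omega> v] nz s by (simp add: scalar_nehari_iff[OF \<Omega>] zero_on_def)
  \<comment> \<open>Needed for \<open>Inf\<close> to be a lower bound at all.\<close>
  have "bdd_below (scalar_energy \<Omega> lam ` scalar_nehari \<Omega> lam)"
    using lam by (intro bdd_belowI2[of _ 0]) (simp add: scalar_energy_on_nehari[OF \<Omega>] hform_nonneg)
  then have "scalar_energy \<Omega> lam U \<le> scalar_energy \<Omega> lam ?w"
    using U w unfolding least_energy_solution_def by (auto intro: cInf_lower)
  then have "hform \<Omega> lam U \<le> s\<^sup>2 * ?N"
    using U wN scalar_energy_on_nehari[OF \<Omega> w] scalar_energy_on_nehari[OF \<Omega>, of U lam]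
    unfolding least_energy_solution_def by simp
  then have "hform \<Omega> lam U * ?P \<le> s\<^sup>2 * ?N * ?P" using P by (intro mult_right_mono) auto
  also have "\<dots> = ?N\<^sup>2" using s P by (simp add: power2_eq_square)
  finally show ?thesis .
qed simp

lemma least_energy_hform_pos:
  assumes "open \<Omega>" "lam > 0" "least_energy_solution \<Omega> lam U"
  shows "hform \<Omega> lam U > 0"
  using assms hform_pos[of U \<Omega> lam] Hspace_H1
  by (auto simp: least_energy_solution_def scalar_nehari_def)

section \<open>Fourth powers of functions in \<open>H10\<close>\<close>

text \<open>Fatou's lemma, stated for nonnegative integrals so that finiteness of the limit integral
  is a conclusion and not a hypothesis.\<close>

lemma nn_integral_power4_AE_limit_le:
  fixes u :: "'a \<Rightarrow> real"
  assumes m: "\<And>k. (\<lambda>x. (v k x)^4) \<in> borel_measurable M"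
    and b: "\<And>k. (\<integral>\<^sup>+x. ennreal ((v k x)^4) \<partial>M) \<le> C"
    and lim: "AE x in M. (\<lambda>k. v k x) \<longlonglongrightarrow> u x"
  shows "(\<integral>\<^sup>+x. ennreal ((u x)^4) \<partial>M) \<le> C"
proof -
  have "(\<integral>\<^sup>+x. ennreal ((u x)^4) \<partial>M) = (\<integral>\<^sup>+x. liminf (\<lambda>k. ennreal ((v k x)^4)) \<partial>M)"
  proof (rule nn_integral_cong_AE)
    show "AE x in M. ennreal ((u x)^4) = liminf (\<lambda>k. ennreal ((v k x)^4))"
      using lim
    proof (rule eventually_mono)
      fix x assume "(\<lambda>k. v k x) \<longlonglongrightarrow> u x"
      then have "(\<lambda>k. ennreal ((v k x)^4)) \<longlonglongrightarrow> ennreal ((u x)^4)"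
        by (intro tendsto_ennrealI tendsto_power)
      then show "ennreal ((u x)^4) = liminf (\<lambda>k. ennreal ((v k x)^4))"
        using lim_imp_Liminf[OF sequentially_bot] by metis
    qed
  qed
  also have "\<dots> \<le> liminf (\<lambda>k. \<integral>\<^sup>+x. ennreal ((v k x)^4) \<partial>M)"
    using m by (intro nn_integral_liminf) simp
  also have "\<dots> \<le> C" using b by (intro Liminf_le) simp_all
  finally show ?thesis .
qed

lemma L4_if_bounded_AE_limit:
  fixes u :: "'a :: euclidean_space \<Rightarrow> real"
  assumes m: "zext \<Omega> u \<in> borel_measurable lebesgue"
    and i: "\<And>k. set_integrable lebesgue \<Omega> (\<lambda>x. (v k x)^4)"
    and b: "\<And>k. (LINT x:\<Omega>|lebesgue. (v k x)^4) \<le> C"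
    and lim: "AE x in lebesgue. x \<in> \<Omega> \<longrightarrow> (\<lambda>k. v k x) \<longlonglongrightarrow> u x"
  shows "set_integrable lebesgue \<Omega> (\<lambda>x. (u x)^4)"
proof -
  have z4: "zext \<Omega> (\<lambda>x. (w x)^4) = (\<lambda>x. (zext \<Omega> w x)^4)" for w :: "'a \<Rightarrow> real"
    by (rule ext) (simp add: zext_def indicator_def)
  have int: "integrable lebesgue (\<lambda>x. (zext \<Omega> (v k) x)^4)" for k
    using i[of k] by (simp only: set_integrable_zext z4)
  have "AE x in lebesgue. (\<lambda>k. zext \<Omega> (v k) x) \<longlonglongrightarrow> zext \<Omega> u x"
    using lim by (rule eventually_mono) (auto simp: zext_def indicator_def)
  moreover have "(\<integral>\<^sup>+x. ennreal ((zext \<Omega> (v k) x)^4) \<partial>lebesgue) \<le> ennreal C" for k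
    using b[of k] int[of k] by (subst nn_integral_eq_integral) (auto simp: set_integral_zext z4 ennreal_leI)
  ultimately have "(\<integral>\<^sup>+x. ennreal ((zext \<Omega> u x)^4) \<partial>lebesgue) \<le> ennreal C"
    by (rule nn_integral_power4_AE_limit_le[OF borel_measurable_integrable[OF int], rotated])
  then have "(\<integral>\<^sup>+x. ennreal ((zext \<Omega> u x)^4) \<partial>lebesgue) < \<infinity>"
    by (simp add: order_le_less_trans[of _ "ennreal C"])
  then have int_u: "integrable lebesgue (\<lambda>x. (zext \<Omega> u x)^4)"
    using m by (intro integrableI_nonneg) auto
  then show ?thesis by (simp only: set_integrable_zext z4)
qed

lemma test_functions_power4_integrable:
  assumes \<phi>: "\<phi> \<in> test_functions \<Omega>"
  shows "set_integrable lebesgue \<Omega> (\<lambda>x. (\<phi> x)^4)"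
proof -
  obtain K where K: "compact K" and z: "\<And>x. x \<notin> K \<Longrightarrow> \<phi> x = 0" "\<And>x. x \<notin> K \<Longrightarrow> grad \<phi> x = 0"
    using test_functions_support[OF \<phi>] by blast
  have "integrable lebesgue (\<lambda>x. (\<phi> x)^4)"
    by (rule integrable_continuous_compact_support(1)[OF continuous_on_power[OF test_functions_continuous[OF \<phi>]] K])
      (simp add: z(1))
  moreover have "zext \<Omega> (\<lambda>x. (\<phi> x)^4) = (\<lambda>x. (\<phi> x)^4)"
    using test_functions_zero(1)[OF \<phi>] by (intro ext) (auto simp: zext_def indicator_def)
  ultimately show ?thesis by (simp only: set_integrable_zext)
qed

text \<open>The approximating test functions belong to \<open>Hspace\<close> and to L^4, so for them
  the least energy inequality has content and bounds the L^4 norms by norms that stay bounded.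
  Fatou's lemma passes the bound on to u. As \<Omega> is not the whole space, the test functions
  need not be radial.\<close>

lemma H10_L4:
  assumes \<Omega>: "open \<Omega>" "\<Omega> \<noteq> UNIV" and lam: "lam > 0" and U: "least_energy_solution \<Omega> lam U"
    and u: "u \<in> H10 \<Omega>"
  shows "set_integrable lebesgue \<Omega> (\<lambda>x. (u x)^4)"
proof -
  obtain \<phi> where u1: "u \<in> H1 \<Omega>" and \<phi>: "\<And>k. \<phi> k \<in> test_functions \<Omega>"
    and lim: "(\<lambda>k. H1_norm \<Omega> (\<lambda>x. \<phi> k x - u x)) \<longlonglongrightarrow> 0"
    using u unfolding H10_def by auto
  define d where "d k x = \<phi> k x - u x" for k x
  have d1: "d k \<in> H1 \<Omega>" for k
    unfolding d_def by (rule H1_diff(1)[OF \<Omega>(1) test_functions_H1[OF \<phi> \<Omega>(1)] u1])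
  have "(\<lambda>k. (H1_norm \<Omega> (d k))\<^sup>2) \<longlonglongrightarrow> 0\<^sup>2"
    using lim by (intro tendsto_power) (simp add: d_def[abs_def])
  then have lim2: "(\<lambda>k. hform \<Omega> 1 (d k)) \<longlonglongrightarrow> 0"
    by (simp add: H1_norm_hform hform_nonneg)
  have dsq: "integrable lebesgue (\<lambda>x. (zext \<Omega> (d k) x)\<^sup>2)"
    "(\<integral>x. (zext \<Omega> (d k) x)\<^sup>2 \<partial>lebesgue) \<le> hform \<Omega> 1 (d k)" for k
  proof -
    show i: "integrable lebesgue (\<lambda>x. (zext \<Omega> (d k) x)\<^sup>2)"
      using H1_L2[OF d1] by (simp add: L2_iff)
    show "(\<integral>x. (zext \<Omega> (d k) x)\<^sup>2 \<partial>lebesgue) \<le> hform \<Omega> 1 (d k)"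
      unfolding hform_def set_integral_zext
      using hform_integrand_integrable[OF H1_wgrad_L2[OF d1[of k]] H1_L2[OF d1[of k]], of 1]
      by (intro integral_mono i) (auto simp: set_integrable_zext zext_def indicator_def)
  qed
  have "(\<lambda>k. \<integral>x. norm ((zext \<Omega> (d k) x)\<^sup>2) \<partial>lebesgue) \<longlonglongrightarrow> 0"
    by (rule tendsto_sandwich[OF _ _ tendsto_const lim2]) (use dsq(2) in auto)
  \<comment> \<open>The squares of the differences tend to 0 in L^1, which gives convergence almost
    everywhere along a subsequence; Fatou's lemma needs no more.\<close>
  from tendsto_L1_AE_subseq[OF dsq(1) this]
  obtain r :: "nat \<Rightarrow> nat" where r: "strict_mono r"
    and ae: "AE x in lebesgue. (\<lambda>k. (zext \<Omega> (d (r k)) x)\<^sup>2) \<longlonglongrightarrow> 0" by auto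
  have ae': "AE x in lebesgue. x \<in> \<Omega> \<longrightarrow> (\<lambda>k. \<phi> (r k) x) \<longlonglongrightarrow> u x"
    using ae
  proof (rule eventually_mono)
    fix x assume *: "(\<lambda>k. (zext \<Omega> (d (r k)) x)\<^sup>2) \<longlonglongrightarrow> 0"
    show "x \<in> \<Omega> \<longrightarrow> (\<lambda>k. \<phi> (r k) x) \<longlonglongrightarrow> u x"
    proof
      assume "x \<in> \<Omega>"
      then have "(\<lambda>k. sqrt ((d (r k) x)\<^sup>2)) \<longlonglongrightarrow> sqrt 0"
        using * by (intro tendsto_real_sqrt) simp
      then have "(\<lambda>k. d (r k) x) \<longlonglongrightarrow> 0" by (simp add: tendsto_rabs_zero_iff)
      then show "(\<lambda>k. \<phi> (r k) x) \<longlonglongrightarrow> u x" unfolding d_def by (simp add: LIM_zero_iff)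
    qed
  qed
  \<comment> \<open>Dominates both the weight 1 of the gradient and the weight \<open>lam\<close>,
    so it compares the form with weight \<open>lam\<close> to the one with weight 1, in which the
    convergence is given.\<close>
  let ?m = "max 1 lam"
  have bound: "hform \<Omega> lam (\<phi> k) \<le> 2 * ?m * hform \<Omega> 1 (d k) + 2 * hform \<Omega> lam u" for k
  proof -
    let ?Wd = "wgrad \<Omega> (d k)" and ?Wu = "wgrad \<Omega> u"
    have eq: "\<phi> k = (\<lambda>x. 1 * d k x + 1 * u x)" by (auto simp: d_def)
    have g: "L2_weak_gradient \<Omega> (\<phi> k) (\<lambda>x. ?Wd x + ?Wu x)"
      using weak_gradient_linear[OF \<Omega>(1) H1_L2[OF d1[of k]] H1_wgrad[OF d1] H1_L2[OF u1] H1_wgrad[OF u1], of 1 1]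
      unfolding eq by (simp add: d_def)
    have \<phi>L2: "\<phi> k \<in> L2 \<Omega>" by (rule test_functions_L2(1)[OF \<phi> \<Omega>(1)])
    have gL2: "(\<lambda>x. ?Wd x + ?Wu x) \<in> L2 \<Omega>" using g by (simp add: L2_weak_gradient_def)
    let ?f1 = "\<lambda>x. (norm (?Wd x))\<^sup>2 + 1 * (d k x)\<^sup>2" and ?f2 = "\<lambda>x. (norm (?Wu x))\<^sup>2 + lam * (u x)\<^sup>2"
    have i1: "set_integrable lebesgue \<Omega> ?f1"
      by (rule hform_integrand_integrable[OF H1_wgrad_L2[OF d1] H1_L2[OF d1]])
    have i2: "set_integrable lebesgue \<Omega> ?f2"
      by (rule hform_integrand_integrable[OF H1_wgrad_L2[OF u1] H1_L2[OF u1]])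
    have "hform \<Omega> lam (\<phi> k) = (LINT x:\<Omega>|lebesgue. (norm (?Wd x + ?Wu x))\<^sup>2 + lam * (\<phi> k x)\<^sup>2)"
      by (rule hform_eq[OF \<Omega>(1) \<phi>L2 g])
    also have "\<dots> \<le> (LINT x:\<Omega>|lebesgue. (2 * ?m) *\<^sub>R ?f1 x + 2 *\<^sub>R ?f2 x)"
    proof (rule set_integral_mono)
      show "set_integrable lebesgue \<Omega> (\<lambda>x. (norm (?Wd x + ?Wu x))\<^sup>2 + lam * (\<phi> k x)\<^sup>2)"
        by (rule hform_integrand_integrable[OF gL2 \<phi>L2])
      show "set_integrable lebesgue \<Omega> (\<lambda>x. (2 * ?m) *\<^sub>R ?f1 x + 2 *\<^sub>R ?f2 x)"
        by (rule set_integrable_linear[OF i1 i2])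
      fix x
      have "(norm (?Wd x + ?Wu x))\<^sup>2 \<le> 2 * (?m * (norm (?Wd x))\<^sup>2) + 2 * (norm (?Wu x))\<^sup>2"
        using norm_add_power2_le[of "?Wd x" "?Wu x"] mult_right_mono[of 1 ?m "(norm (?Wd x))\<^sup>2"] by simp
      moreover have "lam * (\<phi> k x)\<^sup>2 \<le> lam * (2 * (d k x)\<^sup>2 + 2 * (u x)\<^sup>2)"
        using norm_add_power2_le[of "d k x" "u x"] lam by (intro mult_left_mono) (auto simp: d_def)
      moreover have "lam * (d k x)\<^sup>2 \<le> ?m * (d k x)\<^sup>2" by (intro mult_right_mono) auto
      ultimately show "(norm (?Wd x + ?Wu x))\<^sup>2 + lam * (\<phi> k x)\<^sup>2 \<le> (2 * ?m) *\<^sub>R ?f1 x + 2 *\<^sub>R ?f2 x"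
        by (simp add: algebra_simps)
    qed
    also have "\<dots> = 2 * ?m * hform \<Omega> 1 (d k) + 2 * hform \<Omega> lam u"
      by (subst set_integral_linear[OF i1 i2]) (simp add: hform_def)
    finally show ?thesis .
  qed
  obtain D where D: "\<And>k. hform \<Omega> 1 (d k) \<le> D"
    using convergent_imp_Bseq[OF convergentI[OF lim2]] unfolding Bseq_def by (metis abs_le_D1 real_norm_def)
  define C where "C = 2 * ?m * D + 2 * hform \<Omega> lam u"
  have C: "hform \<Omega> lam (\<phi> k) \<le> C" for k
    using bound[of k] mult_left_mono[OF D[of k], of "2 * ?m"] by (simp add: C_def)
  have P: "(LINT x:\<Omega>|lebesgue. (\<phi> k x)^4) \<le> C\<^sup>2 / hform \<Omega> lam U" for k
  proof -
    have "hform \<Omega> lam U * (LINT x:\<Omega>|lebesgue. (\<phi> k x)^4) \<le> (hform \<Omega> lam (\<phi> k))\<^sup>2"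
      by (rule least_energy_Sobolev[OF \<Omega>(1) lam U test_functions_Hspace[OF \<Omega> \<phi>]])
    also have "\<dots> \<le> C\<^sup>2" using C lam by (intro power_mono) (auto simp: hform_nonneg)
    finally show ?thesis
      using least_energy_hform_pos[OF \<Omega>(1) lam U] by (simp add: field_simps)
  qed
  have "zext \<Omega> u \<in> borel_measurable lebesgue" using H1_L2[OF u1] by (simp add: L2_iff)
  from L4_if_bounded_AE_limit[OF this test_functions_power4_integrable[OF \<phi>] P ae']
  show ?thesis .
qed

section \<open>Averages over translates\<close>

text \<open>Borel functions can be composed with (x, y) \<mapsto> x - y, as is needed for Fubini's
  theorem below.\<close>

lemma borel_representative:
  fixes f :: "'a :: euclidean_space \<Rightarrow> 'b :: euclidean_space"
  assumes f: "f \<in> borel_measurable lebesgue"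
  obtains f' where "f' \<in> borel_measurable borel" "AE x in lebesgue. f x = f' x"
proof -
  have "\<exists>F. F \<in> borel_measurable lborel \<and> (AE x in lborel. f x \<bullet> b = F x)" for b
    using completion_ex_borel_measurable_real[of "\<lambda>x. f x \<bullet> b" lborel] f by auto
  then obtain F where F: "\<And>b. F b \<in> borel_measurable lborel" "\<And>b. AE x in lborel. f x \<bullet> b = F b x"
    by metis
  define f' where "f' x = (\<Sum>b\<in>Basis. F b x *\<^sub>R b)" for x
  have "f' \<in> borel_measurable borel"
    unfolding f'_def[abs_def] using F(1) by simp
  moreover have "AE x in lborel. \<forall>b\<in>Basis. f x \<bullet> b = F b x"
    using F(2) by (intro AE_ball_countable[THEN iffD2]) (auto intro: countable_finite)
  then have "AE x in lborel. f x = f' x"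
  proof (rule eventually_mono)
    fix x assume *: "\<forall>b\<in>Basis. f x \<bullet> b = F b x"
    have "f x = (\<Sum>b\<in>Basis. (f x \<bullet> b) *\<^sub>R b)" by (simp add: euclidean_representation)
    then show "f x = f' x" using * by (simp add: f'_def)
  qed
  ultimately show ?thesis using that AE_completion by blast
qed

lemma L2_UNIV_iff:
  fixes f :: "'a :: euclidean_space \<Rightarrow> 'b :: euclidean_space"
  assumes "f \<in> borel_measurable borel"
  shows "f \<in> L2 UNIV \<longleftrightarrow> integrable lborel (\<lambda>x. (norm (f x))\<^sup>2)"
proof -
  have "zext UNIV f = f" by auto
  moreover have "f \<in> borel_measurable lebesgue" using assms by (intro measurable_completion) simp
  ultimately show ?thesis using assms by (simp add: L2_iff integrable_completion)
qed

lemma L2_UNIV_nn_integral: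
  fixes f :: "'a :: euclidean_space \<Rightarrow> 'b :: euclidean_space"
  assumes "f \<in> L2 UNIV" "f \<in> borel_measurable borel"
  obtains C where "C \<ge> 0" "(\<integral>\<^sup>+x. ennreal ((norm (f x))\<^sup>2) \<partial>lborel) = ennreal C"
  using assms nn_integral_eq_integral[of lborel "\<lambda>x. (norm (f x))\<^sup>2"]
  by (intro that[of "\<integral>x. (norm (f x))\<^sup>2 \<partial>lborel"]) (auto simp: L2_UNIV_iff)

lemma L2_UNIV_borel_representative:
  fixes f :: "'a :: euclidean_space \<Rightarrow> 'b :: euclidean_space"
  assumes "f \<in> L2 UNIV"
  obtains f' where "f' \<in> borel_measurable borel" "AE x in lebesgue. f x = f' x" "f' \<in> L2 UNIV"
proof -
  have z: "zext UNIV h = h" for h :: "'a \<Rightarrow> 'b" by auto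
  have f: "f \<in> borel_measurable lebesgue" "integrable lebesgue (\<lambda>x. (norm (f x))\<^sup>2)"
    using assms by (auto simp: L2_iff z)
  obtain f' where [measurable]: "f' \<in> borel_measurable borel" and ae: "AE x in lebesgue. f x = f' x"
    using borel_representative[OF f(1)] by blast
  have m: "f' \<in> borel_measurable lebesgue" by (intro measurable_completion) simp
  have "integrable lebesgue (\<lambda>x. (norm (f' x))\<^sup>2)"
  proof (rule integrable_cong_AE_imp[OF f(2)])
    show "(\<lambda>x. (norm (f' x))\<^sup>2) \<in> borel_measurable lebesgue" using m by measurable
    show "AE x in lebesgue. (norm (f x))\<^sup>2 = (norm (f' x))\<^sup>2" using ae by eventually_elim simp
  qed
  then have "f' \<in> L2 UNIV" using m by (simp add: L2_iff z)
  then show ?thesis using that[OF _ ae] by simp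
qed

lemma frechet_derivative_shift:
  assumes "f differentiable (at (x + y))"
  shows "frechet_derivative (\<lambda>x. f (x + y)) (at x) = frechet_derivative f (at (x + y))"
    and "(\<lambda>x. f (x + y)) differentiable (at x)"
proof -
  have "(f has_derivative frechet_derivative f (at (x + y))) (at (x + y))"
    using assms frechet_derivative_works by blast
  moreover have "((\<lambda>x. x + y) has_derivative (\<lambda>h. h)) (at x)" by (auto intro!: derivative_eq_intros)
  ultimately have "((\<lambda>x. f (x + y)) has_derivative frechet_derivative f (at (x + y))) (at x)"
    using has_derivative_compose[of "\<lambda>x. x + y" "\<lambda>h. h" x UNIV f] by simp
  then show "frechet_derivative (\<lambda>x. f (x + y)) (at x) = frechet_derivative f (at (x + y))"
    and "(\<lambda>x. f (x + y)) differentiable (at x)"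
    by (auto intro: frechet_derivative_eq simp: differentiable_def)
qed

lemma is_Ck_shift: "is_Ck k f \<Longrightarrow> is_Ck k (\<lambda>x. f (x + y))"
proof (induction k arbitrary: f)
  case 0
  then show ?case by (auto intro!: continuous_intros continuous_on_compose2[of UNIV f])
next
  case (Suc k)
  then show ?case by (auto simp: frechet_derivative_shift)
qed

lemma test_functions_shift:
  fixes \<phi> :: "'a :: euclidean_space \<Rightarrow> real"
  assumes "\<phi> \<in> test_functions UNIV"
  shows "(\<lambda>x. \<phi> (x + y)) \<in> test_functions UNIV" "grad (\<lambda>x. \<phi> (x + y)) x = grad \<phi> (x + y)"
proof -
  have "{x. \<phi> (x + y) \<noteq> 0} = (\<lambda>z. z - y) ` {x. \<phi> x \<noteq> 0}"
    by (auto simp: image_iff) (metis add_diff_cancel_right')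
  moreover have "bounded {x. \<phi> x \<noteq> 0}" using assms by (auto simp: test_functions_def compact_closure)
  ultimately have "compact (closure {x. \<phi> (x + y) \<noteq> 0})"
    by (simp add: compact_closure bounded_translation_minus)
  then show "(\<lambda>x. \<phi> (x + y)) \<in> test_functions UNIV"
    using assms by (auto simp: test_functions_def intro: is_Ck_shift)
  show "grad (\<lambda>x. \<phi> (x + y)) x = grad \<phi> (x + y)"
    by (simp add: grad_def frechet_derivative_shift(1)[OF test_functions_differentiable[OF assms]])
qed

text \<open>The Cauchy-Schwarz inequality against the constant 1, or Jensen's inequality for the
  square.\<close>

lemma nn_integral_power2_le:
  assumes [measurable]: "h \<in> borel_measurable M" and mass: "emeasure M (space M) = 1"
  shows "(\<integral>\<^sup>+x. h x \<partial>M)\<^sup>2 \<le> (\<integral>\<^sup>+x. (h x)\<^sup>2 \<partial>M)"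
  using Cauchy_Schwarz_nn_integral[of h M "\<lambda>_. 1"] mass by simp

section \<open>Averaging operators\<close>

text \<open>A probability measure dominated by K times Lebesgue measure; normalized balls and cubes
  are the instances. The domination makes y \<mapsto> f (x - y) integrable for every x if f is in
  L^2, and not only for almost every x.\<close>

locale averaging =
  fixes M :: "'a :: euclidean_space measure" and K :: real
  assumes sets_M [measurable_cong]: "sets M = sets borel"
    and mass: "emeasure M UNIV = 1"
    and dominated: "\<And>h. h \<in> borel_measurable borel \<Longrightarrow> (\<integral>\<^sup>+y. h y \<partial>M) \<le> ennreal K * (\<integral>\<^sup>+y. h y \<partial>lborel)"
begin

lemma space_M [simp]: "space M = UNIV"
  using sets_eq_imp_space_eq[OF sets_M] by simp

sublocale finite_measure M
  by standard (simp add: mass)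

lemmas nn_integral_fst_M = nn_integral_fst

sublocale pair_sigma_finite lborel M
  by unfold_locales

text \<open>The convolution of f with M; its value is 0 where the integral does not exist.\<close>

definition avg :: "('a \<Rightarrow> 'b :: euclidean_space) \<Rightarrow> 'a \<Rightarrow> 'b" where
  "avg f x = (\<integral>y. f (x - y) \<partial>M)"

lemma avg_measurable [measurable]:
  assumes [measurable]: "f \<in> borel_measurable borel"
  shows "avg f \<in> borel_measurable borel"
  unfolding avg_def[abs_def] by measurable

text \<open>Jensen's inequality. If the average does not exist, its value 0 satisfies the
  bound.\<close>

lemma avg_power2_le:
  assumes [measurable]: "f \<in> borel_measurable borel"
  shows "ennreal ((norm (avg f x))\<^sup>2) \<le> (\<integral>\<^sup>+y. ennreal ((norm (f (x - y)))\<^sup>2) \<partial>M)"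
proof -
  have "ennreal (norm (avg f x)) \<le> (\<integral>\<^sup>+y. ennreal (norm (f (x - y))) \<partial>M)"
  proof (cases "integrable M (\<lambda>y. f (x - y))")
    case True
    then show ?thesis unfolding avg_def by (rule integral_norm_bound_ennreal)
  qed (simp add: avg_def not_integrable_integral_eq)
  then have "(ennreal (norm (avg f x)))\<^sup>2 \<le> (\<integral>\<^sup>+y. ennreal (norm (f (x - y))) \<partial>M)\<^sup>2"
    by (rule power_mono) simp
  also have "\<dots> \<le> (\<integral>\<^sup>+y. (ennreal (norm (f (x - y))))\<^sup>2 \<partial>M)"
    by (rule nn_integral_power2_le) (auto simp: mass)
  finally show ?thesis by (simp add: ennreal_power)
qed

text \<open>Squaring the bound for squares and applying Jensen's inequality once more.\<close>

lemma avg_power4_le: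
  fixes f :: "'a \<Rightarrow> real"
  assumes [measurable]: "f \<in> borel_measurable borel"
  shows "ennreal ((avg f x)^4) \<le> (\<integral>\<^sup>+y. ennreal ((f (x - y))^4) \<partial>M)"
proof -
  have p4: "ennreal (a^4) = (ennreal ((norm a)\<^sup>2))\<^sup>2" for a :: real
    by (simp add: ennreal_power power_mult[symmetric])
  have "ennreal ((avg f x)^4) \<le> (\<integral>\<^sup>+y. ennreal ((norm (f (x - y)))\<^sup>2) \<partial>M)\<^sup>2"
    unfolding p4 by (intro power_mono avg_power2_le) auto
  also have "\<dots> \<le> (\<integral>\<^sup>+y. (ennreal ((norm (f (x - y)))\<^sup>2))\<^sup>2 \<partial>M)"
    by (rule nn_integral_power2_le) (auto simp: mass)
  finally show ?thesis by (simp only: p4)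
qed

text \<open>Tonelli's theorem, translation invariance and total mass 1. Together with Jensen's
  inequality it shows that averaging increases neither L^2 nor L^4 norms.\<close>

lemma nn_integral_avg:
  fixes h :: "'a \<Rightarrow> ennreal"
  assumes [measurable]: "h \<in> borel_measurable borel"
  shows "(\<integral>\<^sup>+x. \<integral>\<^sup>+y. h (x - y) \<partial>M \<partial>lborel) = (\<integral>\<^sup>+x. h x \<partial>lborel)"
proof -
  have "(\<integral>\<^sup>+x. \<integral>\<^sup>+y. h (x - y) \<partial>M \<partial>lborel) = (\<integral>\<^sup>+y. \<integral>\<^sup>+x. h (x - y) \<partial>lborel \<partial>M)"
    by (rule Fubini'[symmetric]) measurable
  also have "\<dots> = (\<integral>\<^sup>+x. h x \<partial>lborel)"
    by (simp add: nn_integral_lborel_diff mass)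
  finally show ?thesis .
qed

lemma nn_integral_avg_power2_le:
  assumes [measurable]: "f \<in> borel_measurable borel"
  shows "(\<integral>\<^sup>+x. ennreal ((norm (avg f x))\<^sup>2) \<partial>lborel) \<le> (\<integral>\<^sup>+x. ennreal ((norm (f x))\<^sup>2) \<partial>lborel)"
proof -
  have "(\<integral>\<^sup>+x. ennreal ((norm (avg f x))\<^sup>2) \<partial>lborel)
      \<le> (\<integral>\<^sup>+x. \<integral>\<^sup>+y. ennreal ((norm (f (x - y)))\<^sup>2) \<partial>M \<partial>lborel)"
    by (intro nn_integral_mono avg_power2_le) auto
  also have "\<dots> = (\<integral>\<^sup>+x. ennreal ((norm (f x))\<^sup>2) \<partial>lborel)"
    by (rule nn_integral_avg[of "\<lambda>x. ennreal ((norm (f x))\<^sup>2)"]) measurable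
  finally show ?thesis .
qed

lemma avg_L2:
  assumes [measurable]: "f \<in> borel_measurable borel" and "C \<ge> 0"
    and f: "(\<integral>\<^sup>+x. ennreal ((norm (f x))\<^sup>2) \<partial>lborel) = ennreal C"
  shows "avg f \<in> L2 UNIV" "(\<integral>x. (norm (avg f x))\<^sup>2 \<partial>lborel) \<le> C"
proof -
  have le: "(\<integral>\<^sup>+x. ennreal ((norm (avg f x))\<^sup>2) \<partial>lborel) \<le> ennreal C"
    using nn_integral_avg_power2_le[of f] f by simp
  then have i: "integrable lborel (\<lambda>x. (norm (avg f x))\<^sup>2)"
    by (intro integrableI_nonneg) (auto intro: order_le_less_trans)
  then show "avg f \<in> L2 UNIV" by (simp add: L2_UNIV_iff)
  have "ennreal (\<integral>x. (norm (avg f x))\<^sup>2 \<partial>lborel) \<le> ennreal C"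
    using le nn_integral_eq_integral[OF i] by simp
  then show "(\<integral>x. (norm (avg f x))\<^sup>2 \<partial>lborel) \<le> C" using \<open>C \<ge> 0\<close> by (simp add: ennreal_le_iff)
qed

lemma nn_integral_avg_power4_le:
  fixes f :: "'a \<Rightarrow> real"
  assumes [measurable]: "f \<in> borel_measurable borel"
  shows "(\<integral>\<^sup>+x. ennreal ((avg f x)^4) \<partial>lborel) \<le> (\<integral>\<^sup>+x. ennreal ((f x)^4) \<partial>lborel)"
proof -
  have "(\<integral>\<^sup>+x. ennreal ((avg f x)^4) \<partial>lborel)
      \<le> (\<integral>\<^sup>+x. \<integral>\<^sup>+y. ennreal ((f (x - y))^4) \<partial>M \<partial>lborel)"
    by (intro nn_integral_mono avg_power4_le) auto
  also have "\<dots> = (\<integral>\<^sup>+x. ennreal ((f x)^4) \<partial>lborel)"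
    by (rule nn_integral_avg[of "\<lambda>x. ennreal ((f x)^4)"]) measurable
  finally show ?thesis .
qed

lemma nn_integral_translate_finite:
  assumes [measurable]: "f \<in> borel_measurable borel"
    and f: "(\<integral>\<^sup>+x. ennreal ((norm (f x))\<^sup>2) \<partial>lborel) = ennreal C"
  shows "(\<integral>\<^sup>+y. ennreal ((norm (f (x - y)))\<^sup>2) \<partial>M) \<le> ennreal K * ennreal C"
proof -
  have "(\<integral>\<^sup>+y. ennreal ((norm (f (x - y)))\<^sup>2) \<partial>M)
      \<le> ennreal K * (\<integral>\<^sup>+y. ennreal ((norm (f (x - y)))\<^sup>2) \<partial>lborel)"
    by (rule dominated) measurable
  then show ?thesis
    using nn_integral_lborel_reflect[of "\<lambda>x. ennreal ((norm (f x))\<^sup>2)" x] by (simp add: f)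
qed

lemma nn_integral_norm_translate_le:
  assumes [measurable]: "f \<in> borel_measurable borel"
    and f: "(\<integral>\<^sup>+x. ennreal ((norm (f x))\<^sup>2) \<partial>lborel) = ennreal C"
  shows "(\<integral>\<^sup>+y. ennreal (norm (f (x - y))) \<partial>M) \<le> 1 + ennreal K * ennreal C"
proof -
  have "(\<integral>\<^sup>+y. ennreal (norm (f (x - y))) \<partial>M) \<le> (\<integral>\<^sup>+y. 1 + ennreal ((norm (f (x - y)))\<^sup>2) \<partial>M)"
    using norm_le_1_plus_power2 by (intro nn_integral_mono) (auto simp flip: ennreal_1 ennreal_plus intro!: ennreal_leI)
  also have "\<dots> = 1 + (\<integral>\<^sup>+y. ennreal ((norm (f (x - y)))\<^sup>2) \<partial>M)"
    by (subst nn_integral_add) (auto simp: mass)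
  finally show ?thesis
    using nn_integral_translate_finite[OF assms, of x] by (meson add_left_mono order_trans)
qed

lemma integrable_translate:
  fixes f :: "'a \<Rightarrow> 'b :: euclidean_space"
  assumes [measurable]: "f \<in> borel_measurable borel"
    and f: "(\<integral>\<^sup>+x. ennreal ((norm (f x))\<^sup>2) \<partial>lborel) = ennreal C"
  shows "integrable M (\<lambda>y. f (x - y))"
proof (rule integrableI_bounded)
  have "1 + ennreal K * ennreal C < \<infinity>" by (simp add: ennreal_mult_less_top)
  then show "(\<integral>\<^sup>+y. ennreal (norm (f (x - y))) \<partial>M) < \<infinity>"
    using nn_integral_norm_translate_le[OF assms, of x] by (rule order_le_less_trans[rotated])
qed measurable

text \<open>Supplies the hypothesis of Fubini's theorem for \<open>avg_weak_gradient\<close>: the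
  product is dominated by |a (x - y)|^2 + |b x|^2, which is integrable because M is finite.\<close>

lemma integrable_product_translate:
  fixes a :: "'a \<Rightarrow> 'c :: euclidean_space" and b :: "'a \<Rightarrow> 'd :: euclidean_space"
    and F :: "'a \<Rightarrow> 'a \<Rightarrow> 'b :: euclidean_space"
  assumes [measurable]: "a \<in> borel_measurable borel" "b \<in> borel_measurable borel"
    and a: "(\<integral>\<^sup>+x. ennreal ((norm (a x))\<^sup>2) \<partial>lborel) = ennreal C"
    and b: "(\<integral>\<^sup>+x. ennreal ((norm (b x))\<^sup>2) \<partial>lborel) = ennreal D"
    and [measurable]: "case_prod F \<in> borel_measurable (lborel \<Otimes>\<^sub>M M)"
    and F: "\<And>x y. norm (F x y) \<le> norm (a (x - y)) * norm (b x)"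
  shows "integrable (lborel \<Otimes>\<^sub>M M) (case_prod F)"
proof (rule integrableI_bounded)
  have le: "norm (F x y) \<le> (norm (a (x - y)))\<^sup>2 + (norm (b x))\<^sup>2" for x y
    using F[of x y] norm_mult_norm_le[of "a (x - y)" "b x"] by linarith
  have "(\<integral>\<^sup>+p. ennreal (norm (case_prod F p)) \<partial>(lborel \<Otimes>\<^sub>M M))
      = (\<integral>\<^sup>+x. \<integral>\<^sup>+y. ennreal (norm (F x y)) \<partial>M \<partial>lborel)"
    by (subst nn_integral_fst_M[symmetric]) auto
  also have "\<dots> \<le> (\<integral>\<^sup>+x. \<integral>\<^sup>+y. ennreal ((norm (a (x - y)))\<^sup>2) + ennreal ((norm (b x))\<^sup>2) \<partial>M \<partial>lborel)"
    using le by (intro nn_integral_mono) (auto simp flip: ennreal_plus intro!: ennreal_leI)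
  also have "\<dots> = (\<integral>\<^sup>+x. (\<integral>\<^sup>+y. ennreal ((norm (a (x - y)))\<^sup>2) \<partial>M) + ennreal ((norm (b x))\<^sup>2) \<partial>lborel)"
    by (intro nn_integral_cong, subst nn_integral_add) (auto simp: mass)
  also have "\<dots> = (\<integral>\<^sup>+x. \<integral>\<^sup>+y. ennreal ((norm (a (x - y)))\<^sup>2) \<partial>M \<partial>lborel) + (\<integral>\<^sup>+x. ennreal ((norm (b x))\<^sup>2) \<partial>lborel)"
    by (rule nn_integral_add) measurable
  also have "(\<integral>\<^sup>+x. \<integral>\<^sup>+y. ennreal ((norm (a (x - y)))\<^sup>2) \<partial>M \<partial>lborel) = ennreal C"
    using nn_integral_avg[of "\<lambda>x. ennreal ((norm (a x))\<^sup>2)"] a by simp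
  also have "ennreal C + (\<integral>\<^sup>+x. ennreal ((norm (b x))\<^sup>2) \<partial>lborel) < \<infinity>" by (simp add: b)
  finally show "(\<integral>\<^sup>+p. ennreal (norm (case_prod F p)) \<partial>(lborel \<Otimes>\<^sub>M M)) < \<infinity>" .
qed measurable

text \<open>Averaging commutes with weak differentiation: for fixed y the translation is moved onto
  the test function, whose translates are again test functions on the whole space, and Fubini's
  theorem exchanges the integrals over x and y.\<close>

lemma avg_weak_gradient:
  fixes u :: "'a \<Rightarrow> real" and g :: "'a \<Rightarrow> 'a"
  assumes um [measurable]: "u \<in> borel_measurable borel" and gm [measurable]: "g \<in> borel_measurable borel"
    and u: "(\<integral>\<^sup>+x. ennreal ((norm (u x))\<^sup>2) \<partial>lborel) = ennreal C"
    and g: "(\<integral>\<^sup>+x. ennreal ((norm (g x))\<^sup>2) \<partial>lborel) = ennreal D"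
    and wg: "L2_weak_gradient UNIV u g" and \<phi>: "\<phi> \<in> test_functions UNIV"
  shows "(\<integral>x. avg u x *\<^sub>R grad \<phi> x \<partial>lborel) = - (\<integral>x. \<phi> x *\<^sub>R avg g x \<partial>lborel)"
proof -
  have [measurable]: "\<phi> \<in> borel_measurable borel" "grad \<phi> \<in> borel_measurable borel"
    by (rule test_functions_measurable[OF \<phi>])+
  obtain E where E: "(\<integral>\<^sup>+x. ennreal ((norm (\<phi> x))\<^sup>2) \<partial>lborel) = ennreal E"
    using L2_UNIV_nn_integral[OF test_functions_L2(1)[OF \<phi> open_UNIV] test_functions_measurable(1)[OF \<phi>]] .
  obtain G where G: "(\<integral>\<^sup>+x. ennreal ((norm (grad \<phi> x))\<^sup>2) \<partial>lborel) = ennreal G"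
    using L2_UNIV_nn_integral[OF test_functions_L2(2)[OF \<phi> open_UNIV] test_functions_measurable(2)[OF \<phi>]] .
  have i1: "integrable (lborel \<Otimes>\<^sub>M M) (\<lambda>(x, y). u (x - y) *\<^sub>R grad \<phi> x)"
    by (rule integrable_product_translate[OF _ _ u G]) auto
  have i2: "integrable (lborel \<Otimes>\<^sub>M M) (\<lambda>(x, y). \<phi> x *\<^sub>R g (x - y))"
    by (rule integrable_product_translate[OF _ _ g E]) (auto simp: mult.commute)
  have parts: "(\<integral>x. u (x - y) *\<^sub>R grad \<phi> x \<partial>lborel) = - (\<integral>x. \<phi> x *\<^sub>R g (x - y) \<partial>lborel)" for y
  proof -
    let ?\<psi> = "\<lambda>x. \<phi> (x + y)"
    have "(\<integral>x. u (x - y) *\<^sub>R grad \<phi> x \<partial>lborel) = (\<integral>x. u x *\<^sub>R grad \<phi> (x + y) \<partial>lborel)"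
      using integral_lborel_diff[of "\<lambda>x. u x *\<^sub>R grad \<phi> (x + y)" y] by simp
    also have "\<dots> = (\<integral>x. u x *\<^sub>R grad ?\<psi> x \<partial>lebesgue)"
      by (simp add: test_functions_shift(2)[OF \<phi>] integral_completion)
    also have "\<dots> = - (\<integral>x. ?\<psi> x *\<^sub>R g x \<partial>lebesgue)"
      using wg test_functions_shift(1)[OF \<phi>, of y]
      by (simp add: L2_weak_gradient_def set_lebesgue_integral_def)
    also have "(\<integral>x. ?\<psi> x *\<^sub>R g x \<partial>lebesgue) = (\<integral>x. \<phi> (x + y) *\<^sub>R g x \<partial>lborel)"
      by (simp add: integral_completion)
    also have "\<dots> = (\<integral>x. \<phi> x *\<^sub>R g (x - y) \<partial>lborel)"
      using integral_lborel_diff[of "\<lambda>x. \<phi> (x + y) *\<^sub>R g x" y] by simp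
    finally show ?thesis .
  qed
  have "(\<integral>x. avg u x *\<^sub>R grad \<phi> x \<partial>lborel) = (\<integral>x. \<integral>y. u (x - y) *\<^sub>R grad \<phi> x \<partial>M \<partial>lborel)"
    by (simp add: avg_def integral_scaleR_left integrable_translate[OF um u])
  also have "\<dots> = (\<integral>y. \<integral>x. u (x - y) *\<^sub>R grad \<phi> x \<partial>lborel \<partial>M)"
    by (rule Fubini_integral[OF i1, symmetric])
  also have "\<dots> = - (\<integral>y. \<integral>x. \<phi> x *\<^sub>R g (x - y) \<partial>lborel \<partial>M)"
    unfolding parts by simp
  also have "(\<integral>y. \<integral>x. \<phi> x *\<^sub>R g (x - y) \<partial>lborel \<partial>M) = (\<integral>x. \<integral>y. \<phi> x *\<^sub>R g (x - y) \<partial>M \<partial>lborel)"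
    by (rule Fubini_integral[OF i2])
  also have "\<dots> = (\<integral>x. \<phi> x *\<^sub>R avg g x \<partial>lborel)"
    by (simp add: avg_def)
  finally show ?thesis .
qed

end

section \<open>Averages over cubes and balls\<close>

lemma positive_finite_measure:
  assumes "emeasure M S \<noteq> 0" "emeasure M S \<noteq> \<infinity>"
  shows "emeasure M S = ennreal (measure M S)" "measure M S > 0"
proof -
  show *: "emeasure M S = ennreal (measure M S)"
    using assms by (intro emeasure_eq_ennreal_measure) simp
  then have "measure M S \<noteq> 0" using assms(1) by (metis ennreal_0)
  then show "measure M S > 0" using measure_nonneg[of M S] by linarith
qed

lemma averaging_uniform:
  assumes S: "S \<in> sets borel" "emeasure lborel S \<noteq> 0" "emeasure lborel S \<noteq> \<infinity>"
  shows "averaging (uniform_measure lborel S) (1 / measure lborel S)"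
proof
  note V = positive_finite_measure[OF S(2,3)]
  show "sets (uniform_measure lborel S) = sets borel" by simp
  show "emeasure (uniform_measure lborel S) UNIV = 1"
    using S V by (simp add: divide_ennreal)
  fix h :: "'a \<Rightarrow> ennreal" assume h [measurable]: "h \<in> borel_measurable borel"
  have "(\<integral>\<^sup>+y. h y \<partial>uniform_measure lborel S) = (\<integral>\<^sup>+y. h y * indicator S y \<partial>lborel) / emeasure lborel S"
    using S by (subst nn_integral_uniform_measure) auto
  also have "\<dots> \<le> (\<integral>\<^sup>+y. h y \<partial>lborel) / emeasure lborel S"
    by (intro divide_right_mono_ennreal nn_integral_mono) (auto simp: indicator_def)
  also have "\<dots> = ennreal (1 / measure lborel S) * (\<integral>\<^sup>+y. h y \<partial>lborel)"
    using V by (simp add: divide_ennreal_def inverse_ennreal mult.commute inverse_eq_divide)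
  finally show "(\<integral>\<^sup>+y. h y \<partial>uniform_measure lborel S) \<le> ennreal (1 / measure lborel S) * (\<integral>\<^sup>+y. h y \<partial>lborel)" .
qed

lemma integral_uniform_measure:
  fixes f :: "'a :: euclidean_space \<Rightarrow> real"
  assumes S: "S \<in> sets borel" "emeasure lborel S \<noteq> 0" "emeasure lborel S \<noteq> \<infinity>"
    and [measurable]: "f \<in> borel_measurable borel"
  shows "(\<integral>y. f y \<partial>uniform_measure lborel S) = (\<integral>y. indicator S y * f y \<partial>lborel) / measure lborel S"
proof -
  note V = positive_finite_measure[OF S(2,3)]
  have [measurable]: "S \<in> sets borel" by (rule S)
  have "indicator S y / emeasure lborel S = ennreal (indicator S y / measure lborel S)" for y
    using V by (auto simp: indicator_def divide_ennreal simp flip: ennreal_1)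
  then have "uniform_measure lborel S = density lborel (\<lambda>y. ennreal (indicator S y / measure lborel S))"
    by (simp add: uniform_measure_def)
  then have "(\<integral>y. f y \<partial>uniform_measure lborel S) = (\<integral>y. (indicator S y / measure lborel S) *\<^sub>R f y \<partial>lborel)"
    by (simp only:) (rule integral_density, auto)
  then show ?thesis by simp
qed

text \<open>Fubini's theorem on the product of the two measures. The domination by Lebesgue measure
  makes the integrand integrable for every x, so the identity holds at every point.\<close>

lemma avg_commute:
  fixes u :: "'a :: euclidean_space \<Rightarrow> real"
  assumes M: "averaging M K" and N: "averaging N L"
    and [measurable]: "u \<in> borel_measurable borel"
    and u: "(\<integral>\<^sup>+x. ennreal ((norm (u x))\<^sup>2) \<partial>lborel) = ennreal C"
  shows "averaging.avg M (averaging.avg N u) x = averaging.avg N (averaging.avg M u) x"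
proof -
  interpret A: averaging M K by (rule M)
  interpret B: averaging N L by (rule N)
  interpret P: pair_sigma_finite M N by unfold_locales
  have "integrable (M \<Otimes>\<^sub>M N) (\<lambda>(y, z). u (x - y - z))"
  proof (rule integrableI_bounded)
    have "(\<integral>\<^sup>+p. ennreal (norm (case p of (y, z) \<Rightarrow> u (x - y - z))) \<partial>(M \<Otimes>\<^sub>M N))
        = (\<integral>\<^sup>+y. \<integral>\<^sup>+z. ennreal (norm (u (x - y - z))) \<partial>N \<partial>M)"
      by (subst B.nn_integral_fst_M[symmetric]) auto
    also have "\<dots> \<le> (\<integral>\<^sup>+y. 1 + ennreal L * ennreal C \<partial>M)"
      by (intro nn_integral_mono B.nn_integral_norm_translate_le u) simp
    also have "\<dots> < \<infinity>" by (simp add: A.mass ennreal_mult_less_top)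
    finally show "(\<integral>\<^sup>+p. ennreal (norm (case p of (y, z) \<Rightarrow> u (x - y - z))) \<partial>(M \<Otimes>\<^sub>M N)) < \<infinity>" .
  qed measurable
  from P.Fubini_integral[OF this]
  show ?thesis by (simp add: A.avg_def B.avg_def algebra_simps)
qed

lemma L2_locally_integrable:
  fixes u :: "'a :: euclidean_space \<Rightarrow> real"
  assumes u: "u \<in> L2 UNIV" and S: "S \<in> lmeasurable"
  shows "set_integrable lebesgue S u"
proof (rule integrable_on_bounded_if_square_integrable)
  have "zext UNIV u = u" by auto
  then show "u \<in> borel_measurable lebesgue" "integrable lebesgue (\<lambda>x. (norm (u x))\<^sup>2)"
    using u by (auto simp: L2_iff)
qed (use S in \<open>auto simp: fmeasurable_def\<close>)

text \<open>Lebesgue differentiation is available for cubes only, while radial symmetry survives averaging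
  over balls only. Both averages commute, and cube averages are continuous, so that averaging them
  over balls of radius tending to 0 recovers them at every point.\<close>

definition cube_measure :: "real \<Rightarrow> 'a :: euclidean_space measure" where
  "cube_measure h = uniform_measure lborel (cbox (- h *\<^sub>R One) 0)"

lemma cube_measure_content:
  assumes "h > 0"
  shows "emeasure lborel (cbox (- h *\<^sub>R One :: 'a :: euclidean_space) 0) = ennreal (h ^ DIM('a))"
  using assms by (subst emeasure_lborel_cbox) (auto simp: inner_diff_left)

lemma averaging_cube: "h > 0 \<Longrightarrow> averaging (cube_measure h :: 'a measure) (1 / measure lborel (cbox (- h *\<^sub>R One :: 'a :: euclidean_space) 0))"
  unfolding cube_measure_def using cube_measure_content[of h, where 'a = 'a]
  by (intro averaging_uniform) auto

text \<open>As the averaging cube lies on the negative side of 0, x - y runs through the cube with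
  lower corner x, the shape used by the differentiation theorem.\<close>

lemma cube_avg_eq:
  fixes u :: "'a :: euclidean_space \<Rightarrow> real"
  assumes h: "h > 0" and [measurable]: "u \<in> borel_measurable borel"
  shows "averaging.avg (cube_measure h) u x
    = (\<integral>z. indicator (cbox x (x + h *\<^sub>R One)) z * u z \<partial>lborel) / h ^ DIM('a)"
proof -
  interpret averaging "cube_measure h :: 'a measure" "1 / measure lborel (cbox (- h *\<^sub>R One :: 'a) 0)"
    using h by (rule averaging_cube)
  let ?S = "cbox (- h *\<^sub>R One :: 'a) 0"
  have V: "emeasure lborel ?S = ennreal (h ^ DIM('a))" using cube_measure_content[OF h] .
  have "avg u x = (\<integral>y. indicator ?S y * u (x - y) \<partial>lborel) / measure lborel ?S"
    unfolding avg_def unfolding cube_measure_def using V zero_less_power[OF h, of "DIM('a)"]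
    by (intro integral_uniform_measure) (auto simp: ennreal_eq_0_iff)
  also have "measure lborel ?S = h ^ DIM('a)" using V h by (simp add: measure_def)
  also have "(\<integral>y. indicator ?S y * u (x - y) \<partial>lborel)
      = (\<integral>z. indicator ?S (x - z) * u z \<partial>lborel)"
    using integral_lborel_reflect[of "\<lambda>z. indicator ?S (x - z) * u z" x] by simp
  also have "(\<lambda>z. indicator ?S (x - z) * u z) = (\<lambda>z. indicator (cbox x (x + h *\<^sub>R One)) z * u z)"
    by (auto simp: indicator_def mem_box inner_simps fun_eq_iff algebra_simps)
  finally show ?thesis .
qed

text \<open>When x moves, the indicators of the cubes converge off the boundary of the limit cube,
  which is a null set, and all cubes lie in one ball, on which u is integrable.\<close>

lemma cube_avg_continuous:
  fixes u :: "'a :: euclidean_space \<Rightarrow> real"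
  assumes h: "h > 0" and um [measurable]: "u \<in> borel_measurable borel" and u: "u \<in> L2 UNIV"
  shows "continuous_on UNIV (averaging.avg (cube_measure h) u)"
proof (intro continuous_at_imp_continuous_on ballI continuous_at_sequentiallyI)
  fix x :: 'a and X assume X: "X \<longlonglongrightarrow> x"
  let ?e = "h *\<^sub>R One :: 'a"
  obtain R where R: "\<And>n. norm (X n) \<le> R"
    using convergent_imp_bounded[OF X] by (auto simp: bounded_iff)
  define B where "B = cball (0 :: 'a) (R + norm ?e)"
  have Bsub: "z \<in> B" if "z \<in> cbox (X n) (X n + ?e)" for n z
  proof -
    have "norm (z - X n) \<le> norm ?e"
      using that h by (intro norm_le_componentwise) (auto simp: mem_box inner_simps abs_if algebra_simps)
    moreover have "norm z \<le> norm (X n) + norm (z - X n)"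
      using norm_triangle_ineq[of "X n" "z - X n"] by simp
    ultimately show ?thesis using R[of n] by (simp add: B_def)
  qed
  have "set_integrable lebesgue B u"
    by (rule L2_locally_integrable[OF u]) (simp add: B_def)
  moreover have [measurable]: "B \<in> sets borel" by (simp add: B_def)
  ultimately have w: "integrable lborel (\<lambda>z. indicator B z * u z)"
    unfolding set_integrable_def by (subst (asm) integrable_completion) auto
  have "(\<lambda>n. \<integral>z. indicator (cbox (X n) (X n + ?e)) z * u z \<partial>lborel)
      \<longlonglongrightarrow> (\<integral>z. indicator (cbox x (x + ?e)) z * u z \<partial>lborel)"
  proof (rule integral_dominated_convergence[where w = "\<lambda>z. norm (indicator B z * u z)"])
    show "integrable lborel (\<lambda>z. norm (indicator B z * u z))" using w by (rule integrable_norm)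
    show "AE z in lborel. norm (indicator (cbox (X n) (X n + ?e)) z * u z) \<le> norm (indicator B z * u z)" for n
      using Bsub by (intro AE_I2) (auto simp: indicator_def)
    have "negligible (cbox x (x + ?e) - box x (x + ?e))" by (rule negligible_frontier_interval)
    then have "AE z in lebesgue. z \<notin> cbox x (x + ?e) - box x (x + ?e)"
      unfolding negligible_iff_null_sets by (rule AE_not_in)
    then have "AE z in lborel. z \<notin> cbox x (x + ?e) - box x (x + ?e)" by (simp only: AE_completion_iff)
    then show "AE z in lborel. (\<lambda>n. indicator (cbox (X n) (X n + ?e)) z * u z)
        \<longlonglongrightarrow> indicator (cbox x (x + ?e)) z * u z"
    proof (rule eventually_mono)
      fix z assume z: "z \<notin> cbox x (x + ?e) - box x (x + ?e)"
      have Xb: "(\<lambda>n. X n \<bullet> b) \<longlonglongrightarrow> x \<bullet> b" for b by (intro tendsto_intros X)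
      have Xb': "(\<lambda>n. (X n + ?e) \<bullet> b) \<longlonglongrightarrow> (x + ?e) \<bullet> b" for b by (intro tendsto_intros X)
      have "eventually (\<lambda>n. indicator (cbox (X n) (X n + ?e)) z = (indicator (cbox x (x + ?e)) z :: real)) sequentially"
      proof (cases "z \<in> box x (x + ?e)")
        case True
        then have "\<forall>b\<in>Basis. eventually (\<lambda>n. X n \<bullet> b < z \<bullet> b \<and> z \<bullet> b < (X n + ?e) \<bullet> b) sequentially"
          by (intro ballI eventually_conj order_tendstoD(2)[OF Xb] order_tendstoD(1)[OF Xb']) (auto simp: mem_box)
        then have "eventually (\<lambda>n. \<forall>b\<in>Basis. X n \<bullet> b < z \<bullet> b \<and> z \<bullet> b < (X n + ?e) \<bullet> b) sequentially"
          by (rule eventually_ball_finite[OF finite_Basis])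
        then show ?thesis
        proof (rule eventually_mono)
          fix n assume "\<forall>b\<in>Basis. X n \<bullet> b < z \<bullet> b \<and> z \<bullet> b < (X n + ?e) \<bullet> b"
          then have "z \<in> box (X n) (X n + ?e)" by (simp add: mem_box)
          then show "indicator (cbox (X n) (X n + ?e)) z = (indicator (cbox x (x + ?e)) z :: real)"
            using True box_subset_cbox by (auto simp: indicator_def)
        qed
      next
        case False
        then have out: "z \<notin> cbox x (x + ?e)" using z by blast
        then obtain b where b: "b \<in> Basis" "z \<bullet> b < x \<bullet> b \<or> (x + ?e) \<bullet> b < z \<bullet> b"
          by (auto simp: mem_box not_le)
        then have "eventually (\<lambda>n. z \<bullet> b < X n \<bullet> b \<or> (X n + ?e) \<bullet> b < z \<bullet> b) sequentially"
          using order_tendstoD(1)[OF Xb, of "z \<bullet> b" b] order_tendstoD(2)[OF Xb', of b "z \<bullet> b"]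
          by (auto elim: eventually_mono)
        then show ?thesis
        proof (rule eventually_mono)
          fix n assume "z \<bullet> b < X n \<bullet> b \<or> (X n + ?e) \<bullet> b < z \<bullet> b"
          then have "z \<notin> cbox (X n) (X n + ?e)" using b by (auto simp: mem_box not_le)
          then show "indicator (cbox (X n) (X n + ?e)) z = (indicator (cbox x (x + ?e)) z :: real)"
            using out by simp
        qed
      qed
      then have "eventually (\<lambda>n. indicator (cbox x (x + ?e)) z * u z = indicator (cbox (X n) (X n + ?e)) z * u z) sequentially"
        by (rule eventually_mono) simp
      then show "(\<lambda>n. indicator (cbox (X n) (X n + ?e)) z * u z) \<longlonglongrightarrow> indicator (cbox x (x + ?e)) z * u z"
        by (rule Lim_transform_eventually[OF tendsto_const])
    qed
  qed measurable
  then show "(\<lambda>n. averaging.avg (cube_measure h) u (X n)) \<longlonglongrightarrow> averaging.avg (cube_measure h) u x"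
    unfolding cube_avg_eq[OF h um] using h by (intro tendsto_intros) auto
qed

lemma cube_avg_AE_tendsto:
  fixes u :: "'a :: euclidean_space \<Rightarrow> real"
  assumes um [measurable]: "u \<in> borel_measurable borel" and u: "u \<in> L2 UNIV"
  shows "AE x in lborel. (\<lambda>n. averaging.avg (cube_measure (1 / real (Suc n))) u x) \<longlonglongrightarrow> u x"
proof -
  have i: "set_integrable lebesgue (cbox a b) u" for a b
    by (rule L2_locally_integrable[OF u]) simp
  then have "u integrable_on cbox a b" for a b
    using set_lebesgue_integral_eq_integral(1) by blast
  then obtain N where N: "negligible N" and lim: "\<And>x e. \<lbrakk>x \<notin> N; 0 < e\<rbrakk> \<Longrightarrow>
      \<exists>d>0. \<forall>h. 0 < h \<and> h < d \<longrightarrow> norm (integral (cbox x (x + h *\<^sub>R One)) u /\<^sub>R h ^ DIM('a) - u x) < e"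
    using integrable_ccontinuous_explicit[of u] by blast
  have eq: "averaging.avg (cube_measure h) u x = integral (cbox x (x + h *\<^sub>R One)) u /\<^sub>R h ^ DIM('a)"
    if "h > 0" for h x
  proof -
    have "(\<integral>z. indicator (cbox x (x + h *\<^sub>R One)) z * u z \<partial>lborel)
        = (LINT z:cbox x (x + h *\<^sub>R One)|lebesgue. u z)"
      unfolding set_lebesgue_integral_def by (subst integral_completion) auto
    also have "\<dots> = integral (cbox x (x + h *\<^sub>R One)) u"
      by (rule set_lebesgue_integral_eq_integral(2)[OF i])
    finally show ?thesis using cube_avg_eq[OF that um] by (simp add: field_simps)
  qed
  have conv: "(\<lambda>n. averaging.avg (cube_measure (1 / real (Suc n))) u x) \<longlonglongrightarrow> u x" if x: "x \<notin> N" for x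
  proof (rule LIMSEQ_I)
    fix e :: real assume "e > 0"
    then obtain d where d: "d > 0" "\<And>h. 0 < h \<Longrightarrow> h < d \<Longrightarrow>
        norm (integral (cbox x (x + h *\<^sub>R One)) u /\<^sub>R h ^ DIM('a) - u x) < e"
      using lim[OF x] by blast
    obtain m where m: "1 / real (Suc m) < d" using nat_approx_posE[OF d(1)] by blast
    have "1 / real (Suc n) < d" if "n \<ge> m" for n
    proof -
      have "1 / real (Suc n) \<le> 1 / real (Suc m)" using that by (intro divide_left_mono) auto
      then show ?thesis using m by linarith
    qed
    then show "\<exists>m. \<forall>n\<ge>m. norm (averaging.avg (cube_measure (1 / real (Suc n))) u x - u x) < e"
      using d(2) eq by (intro exI[of _ m]) (auto simp del: of_nat_Suc)
  qed
  have "AE x in lebesgue. x \<notin> N" using N unfolding negligible_iff_null_sets by (rule AE_not_in)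
  then have "AE x in lborel. x \<notin> N" by (simp only: AE_completion_iff)
  then show ?thesis by (rule eventually_mono) (rule conv)
qed

definition ball_measure :: "real \<Rightarrow> 'a :: euclidean_space measure" where
  "ball_measure r = uniform_measure lborel (ball 0 r)"

lemma ball_measure_content:
  assumes "r > 0"
  shows "emeasure lborel (ball (0 :: 'a :: euclidean_space) r) \<noteq> 0"
    "emeasure lborel (ball (0 :: 'a) r) \<noteq> \<infinity>"
  using content_ball_pos[OF assms, of "0 :: 'a"] emeasure_bounded_finite[OF bounded_ball, of "0 :: 'a" r]
  by (auto simp: measure_def)

lemma averaging_ball: "r > 0 \<Longrightarrow> averaging (ball_measure r :: 'a measure) (1 / measure lborel (ball (0 :: 'a :: euclidean_space) r))"
  unfolding ball_measure_def using ball_measure_content by (intro averaging_uniform) auto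

lemma ball_avg_tendsto:
  fixes F :: "'a :: euclidean_space \<Rightarrow> real"
  assumes F: "continuous_on UNIV F"
    and i: "\<And>n. integrable (ball_measure (1 / real (Suc n))) (\<lambda>y. F (x - y))"
  shows "(\<lambda>n. averaging.avg (ball_measure (1 / real (Suc n))) F x) \<longlonglongrightarrow> F x"
proof (rule LIMSEQ_I)
  fix e :: real assume e: "e > 0"
  have "isCont F x" using F by (simp add: continuous_on_eq_continuous_at)
  then obtain d where d: "d > 0" "\<And>z. dist z x < d \<Longrightarrow> dist (F z) (F x) < e / 2"
    unfolding continuous_at_eps_delta using e half_gt_zero by blast
  obtain m where m: "1 / real (Suc m) < d" using nat_approx_posE[OF d(1)] by blast
  have "norm (averaging.avg (ball_measure (1 / real (Suc n))) F x - F x) < e" if "n \<ge> m" for n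
  proof -
    define r where "r = 1 / real (Suc n)"
    have r: "r > 0" by (simp add: r_def)
    interpret averaging "ball_measure r :: 'a measure" "1 / measure lborel (ball (0 :: 'a) r)"
      using r by (rule averaging_ball)
    have "r \<le> 1 / real (Suc m)" unfolding r_def using that by (intro divide_left_mono) auto
    then have rd: "r < d" using m by linarith
    have int: "integrable (ball_measure r) (\<lambda>y. F (x - y))" using i by (simp add: r_def)
    have mass1: "measure (ball_measure r :: 'a measure) UNIV = 1" using mass by (simp add: measure_def)
    have "AE y in ball_measure r. y \<in> ball (0 :: 'a) r"
      unfolding ball_measure_def by (rule AE_uniform_measureI) auto
    then have ae: "AE y in ball_measure r. norm (F (x - y) - F x) \<le> e / 2"
    proof (rule eventually_mono)
      fix y :: 'a assume "y \<in> ball 0 r"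
      then have "dist (x - y) x < d" using rd by (simp add: dist_norm)
      then show "norm (F (x - y) - F x) \<le> e / 2" using d(2) by (simp add: dist_norm less_imp_le)
    qed
    have int': "integrable (ball_measure r) (\<lambda>y. F (x - y) - F x)" using int by simp
    have "avg F x - F x = (\<integral>y. F (x - y) - F x \<partial>ball_measure r)"
      using int mass1 by (simp add: avg_def)
    also have "norm \<dots> \<le> (\<integral>y. norm (F (x - y) - F x) \<partial>ball_measure r)" by (rule integral_norm_bound)
    also have "\<dots> \<le> (\<integral>y. e / 2 \<partial>(ball_measure r :: 'a measure))"
      by (rule Bochner_Integration.integral_mono_AE[OF integrable_norm[OF int'] _ ae]) simp
    also have "\<dots> < e" using e mass1 by simp
    finally show ?thesis by (simp add: r_def)
  qed
  then show "\<exists>m. \<forall>n\<ge>m. norm (averaging.avg (ball_measure (1 / real (Suc n))) F x - F x) < e" by blast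
qed

text \<open>Fatou's lemma is used twice. For a fixed cube, the ball averages of the cube average of
  u equal cube averages of ball averages of u, so their fourth powers have integral at most C; as
  the balls shrink, the cube average inherits the bound. As the cubes shrink, u inherits it.\<close>

lemma power4_bound_from_ball_averages:
  fixes u :: "'a :: euclidean_space \<Rightarrow> real"
  assumes um [measurable]: "u \<in> borel_measurable borel" and u: "u \<in> L2 UNIV"
    and b: "\<And>n. (\<integral>\<^sup>+x. ennreal ((averaging.avg (ball_measure (1 / real (Suc n))) u x)^4) \<partial>lborel) \<le> C"
  shows "(\<integral>\<^sup>+x. ennreal ((u x)^4) \<partial>lborel) \<le> C"
proof -
  let ?b = "\<lambda>n. ball_measure (1 / real (Suc n)) :: 'a measure"
  let ?c = "\<lambda>k. cube_measure (1 / real (Suc k)) :: 'a measure"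
  have A: "averaging (?b n) (1 / measure lborel (ball (0 :: 'a) (1 / real (Suc n))))" for n
    by (rule averaging_ball) simp
  have B: "averaging (?c k) (1 / measure lborel (cbox (- (1 / real (Suc k)) *\<^sub>R One :: 'a) 0))" for k
    by (rule averaging_cube) simp
  obtain D where "D \<ge> 0" and D: "(\<integral>\<^sup>+x. ennreal ((norm (u x))\<^sup>2) \<partial>lborel) = ennreal D"
    by (rule L2_UNIV_nn_integral[OF u um])
  have cm [measurable]: "averaging.avg (?c k) u \<in> borel_measurable borel" for k
    using averaging.avg_measurable[OF B um] .
  have bm [measurable]: "averaging.avg (?b n) u \<in> borel_measurable borel" for n
    using averaging.avg_measurable[OF A um] .
  have cube_bound: "(\<integral>\<^sup>+x. ennreal ((averaging.avg (?c k) u x)^4) \<partial>lborel) \<le> C" for k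
  proof (rule nn_integral_power4_AE_limit_le)
    let ?F = "averaging.avg (?c k) u"
    show "(\<lambda>x. (averaging.avg (?b n) ?F x)^4) \<in> borel_measurable lborel" for n
      using averaging.avg_measurable[OF A cm] by simp
    show "(\<integral>\<^sup>+x. ennreal ((averaging.avg (?b n) ?F x)^4) \<partial>lborel) \<le> C" for n
    proof -
      have eq: "averaging.avg (?b n) ?F x = averaging.avg (?c k) (averaging.avg (?b n) u) x" for x
        by (rule avg_commute[OF A B um D])
      show ?thesis
        unfolding eq by (rule order_trans[OF averaging.nn_integral_avg_power4_le[OF B bm] b])
    qed
    obtain D' where D': "(\<integral>\<^sup>+x. ennreal ((norm (?F x))\<^sup>2) \<partial>lborel) = ennreal D'"
      by (rule L2_UNIV_nn_integral[OF averaging.avg_L2(1)[OF B um \<open>D \<ge> 0\<close> D] cm])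
    have "integrable (?b n) (\<lambda>y. ?F (x - y))" for n x
      by (rule averaging.integrable_translate[OF A cm D'])
    then show "AE x in lborel. (\<lambda>n. averaging.avg (?b n) ?F x) \<longlonglongrightarrow> ?F x"
      by (intro AE_I2 ball_avg_tendsto cube_avg_continuous um u) auto
  qed
  show ?thesis
    by (rule nn_integral_power4_AE_limit_le[OF _ cube_bound cube_avg_AE_tendsto[OF um u]]) measurable
qed

section \<open>Rotations and radial functions\<close>

text \<open>The image measure is translation invariant, and comparing the two iterated integrals of
  the indicator of \<open>{(x, y). T x \<in> A \<and> y - T x \<in> B}\<close> for the unit ball \<open>B\<close>,
  which \<open>T\<close> preserves, identifies it with Lebesgue measure.\<close>

lemma lborel_distr_orthogonal:
  fixes T :: "'a :: euclidean_space \<Rightarrow> 'a"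
  assumes T: "orthogonal_transformation T"
  shows "distr lborel borel T = lborel"
proof (rule measure_eqI)
  have lin: "linear T" using T by (rule orthogonal_transformation_linear)
  have Tm [measurable]: "T \<in> borel_measurable borel"
    using lin by (intro borel_measurable_continuous_onI linear_continuous_on) (simp add: linear_linear)
  show "sets (distr lborel borel T) = sets lborel" by simp
  fix A assume "A \<in> sets (distr lborel borel T)"
  then have A [measurable]: "A \<in> sets borel" by simp
  let ?B = "ball (0 :: 'a) 1"
  have B [measurable]: "?B \<in> sets borel" by simp
  have Bfin: "emeasure lborel ?B \<noteq> 0" "emeasure lborel ?B \<noteq> \<infinity>"
    by (rule ball_measure_content; simp)+
  let ?i = "\<lambda>S x. indicator S x :: ennreal"
  have "(\<integral>\<^sup>+x. ?i A (T x) \<partial>lborel) * emeasure lborel ?B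
      = (\<integral>\<^sup>+x. ?i A (T x) * emeasure lborel ?B \<partial>lborel)"
    by (rule nn_integral_multc[symmetric]) measurable
  also have "\<dots> = (\<integral>\<^sup>+x. ?i A (T x) * (\<integral>\<^sup>+y. ?i ?B (y - T x) \<partial>lborel) \<partial>lborel)"
    by (subst nn_integral_lborel_diff) auto
  also have "\<dots> = (\<integral>\<^sup>+x. \<integral>\<^sup>+y. ?i A (T x) * ?i ?B (y - T x) \<partial>lborel \<partial>lborel)"
    by (intro nn_integral_cong nn_integral_cmult[symmetric]) measurable
  also have "\<dots> = (\<integral>\<^sup>+y. \<integral>\<^sup>+x. ?i A (T x) * ?i ?B (y - T x) \<partial>lborel \<partial>lborel)"
    by (rule lborel_pair.Fubini'[symmetric]) measurable
  also have "\<dots> = (\<integral>\<^sup>+y. \<integral>\<^sup>+x. ?i ?B x * ?i A (y + T x) \<partial>lborel \<partial>lborel)"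
  proof (rule nn_integral_cong)
    fix y :: 'a
    have surj: "T (inv T y) = y" using orthogonal_transformation_surj[OF T] by (rule surj_f_inv_f)
    \<comment> \<open>The shift by the preimage of y removes y from the argument of the indicator of
      A. As T preserves norms, x minus this preimage lies in the ball iff y - T x does.\<close>
    have "(\<integral>\<^sup>+x. ?i ?B x * ?i A (y + T x) \<partial>lborel)
        = (\<integral>\<^sup>+x. ?i ?B (x - inv T y) * ?i A (y + T (x - inv T y)) \<partial>lborel)"
      by (rule nn_integral_lborel_diff[symmetric]) measurable
    also have "\<dots> = (\<integral>\<^sup>+x. ?i A (T x) * ?i ?B (y - T x) \<partial>lborel)"
    proof (rule nn_integral_cong)
      fix x
      have Td: "T (x - inv T y) = T x - y" using linear_diff[OF lin] surj by simp
      then have "norm (y - T x) = norm (x - inv T y)"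
        using orthogonal_transformation_norm[OF T, of "x - inv T y"] by (simp add: norm_minus_commute)
      then show "?i ?B (x - inv T y) * ?i A (y + T (x - inv T y)) = ?i A (T x) * ?i ?B (y - T x)"
        by (simp add: Td indicator_def)
    qed
    finally show "(\<integral>\<^sup>+x. ?i A (T x) * ?i ?B (y - T x) \<partial>lborel)
        = (\<integral>\<^sup>+x. ?i ?B x * ?i A (y + T x) \<partial>lborel)" by simp
  qed
  also have "\<dots> = (\<integral>\<^sup>+x. \<integral>\<^sup>+y. ?i ?B x * ?i A (y + T x) \<partial>lborel \<partial>lborel)"
    by (rule lborel_pair.Fubini') measurable
  also have "\<dots> = (\<integral>\<^sup>+x. ?i ?B x * emeasure lborel A \<partial>lborel)"
  proof (rule nn_integral_cong)
    fix x
    have "(\<integral>\<^sup>+y. ?i A (y + T x) \<partial>lborel) = emeasure lborel A"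
      using nn_integral_lborel_diff[of "?i A" "- T x"] by simp
    then show "(\<integral>\<^sup>+y. ?i ?B x * ?i A (y + T x) \<partial>lborel) = ?i ?B x * emeasure lborel A"
      by (subst nn_integral_cmult) auto
  qed
  also have "\<dots> = emeasure lborel A * emeasure lborel ?B"
    by (subst nn_integral_multc) (auto simp: mult.commute)
  finally have "(\<integral>\<^sup>+x. ?i A (T x) \<partial>lborel) = emeasure lborel A"
    using Bfin by (simp add: mult.commute[of _ "emeasure lborel ?B"] ennreal_mult_cancel_left)
  moreover have "emeasure (distr lborel borel T) A = (\<integral>\<^sup>+x. ?i A (T x) \<partial>lborel)"
  proof -
    have "emeasure (distr lborel borel T) A = (\<integral>\<^sup>+x. ?i A x \<partial>distr lborel borel T)" by simp
    also have "\<dots> = (\<integral>\<^sup>+x. ?i A (T x) \<partial>lborel)" by (subst nn_integral_distr) auto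
    finally show ?thesis .
  qed
  ultimately show "emeasure (distr lborel borel T) A = emeasure lborel A" by simp
qed

text \<open>An orthogonal map taking x to x' preserves the ball, Lebesgue measure and, almost
  everywhere, u. The average is thus radial at every point, although u is so only up to a null
  set.\<close>

lemma ball_avg_radial:
  fixes u :: "real ^ 'n \<Rightarrow> real"
  assumes r: "r > 0" and um [measurable]: "u \<in> borel_measurable borel"
    and rad: "AE x in lborel. u x = f (norm x)" and eq: "norm x = norm x'"
  shows "averaging.avg (ball_measure r) u x = averaging.avg (ball_measure r) u x'"
proof -
  interpret averaging "ball_measure r :: (real ^ 'n) measure" "1 / measure lborel (ball (0 :: real ^ 'n) r)"
    using r by (rule averaging_ball)
  obtain T where T: "orthogonal_transformation T" "T x = x'"
    using orthogonal_transformation_exists[OF eq] by blast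
  have Tm [measurable]: "T \<in> borel_measurable borel"
    using orthogonal_transformation_linear[OF T(1)]
    by (intro borel_measurable_continuous_onI linear_continuous_on) (simp add: linear_linear)
  have normT: "norm (T z) = norm z" for z by (rule orthogonal_transformation_norm[OF T(1)])
  have T_diff: "T (a - b) = T a - T b" for a b
    using orthogonal_transformation_linear[OF T(1)] by (rule linear_diff)
  let ?B = "ball (0 :: real ^ 'n) r"
  have um' [measurable]: "(\<lambda>y. u (z - y)) \<in> borel_measurable borel" for z
    by (rule measurable_compose[OF _ um]) (intro borel_measurable_continuous_onI continuous_intros)
  have [measurable]: "?B \<in> sets borel" by simp
  have avg_eq: "avg u z = (\<integral>y. indicator ?B y * u (z - y) \<partial>lborel) / measure lborel ?B" for z
    unfolding avg_def unfolding ball_measure_def using ball_measure_content[OF r]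
    by (intro integral_uniform_measure) auto
  have "AE z in distr lborel borel T. u z = f (norm z)"
    using rad by (simp only: lborel_distr_orthogonal[OF T(1)])
  then have "AE z in lborel. u (T z) = f (norm (T z))" by (rule AE_distrD[rotated]) simp
  then have "AE z in lborel. u (T z) = u z"
    using rad by eventually_elim (simp add: normT)
  then have "AE z in distr lborel borel (\<lambda>y. x - y). u (T z) = u z" by (simp only: lborel_distr_reflect)
  then have ae: "AE y in lborel. u (T (x - y)) = u (x - y)" by (rule AE_distrD[rotated]) simp
  have "(\<integral>y. indicator ?B y * u (x' - y) \<partial>lborel)
      = (\<integral>y. indicator ?B y * u (x' - y) \<partial>distr lborel borel T)"
    by (simp only: lborel_distr_orthogonal[OF T(1)])
  also have "\<dots> = (\<integral>y. indicator ?B (T y) * u (x' - T y) \<partial>lborel)"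
    by (rule integral_distr) measurable
  also have "\<dots> = (\<integral>y. indicator ?B y * u (T (x - y)) \<partial>lborel)"
    by (simp add: indicator_def normT T_diff T(2))
  also have "\<dots> = (\<integral>y. indicator ?B y * u (x - y) \<partial>lborel)"
    using ae by (intro integral_cong_AE) auto
  finally show ?thesis by (simp add: avg_eq)
qed

text \<open>Ball averages of u stay radial with a weak gradient in L^2, so they belong to
  \<open>Hspace\<close>; being bounded and in L^2 they are also in L^4. The least energy inequality
  therefore bounds their fourth powers, and the bound is uniform in the radius because averaging
  does not increase the L^2 norms of u and of its gradient.\<close>

lemma radial_H1_L4:
  fixes u U :: "real ^ 'n \<Rightarrow> real"
  assumes lam: "lam > 0" and U: "least_energy_solution UNIV lam U" and u: "u \<in> Hspace UNIV"
  shows "set_integrable lebesgue UNIV (\<lambda>x. (u x)^4)"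
proof -
  have z: "zext UNIV f = f" for f :: "real ^ 'n \<Rightarrow> 'b :: real_vector" by auto
  have uH1: "u \<in> H1 UNIV" by (rule Hspace_H1[OF u])
  let ?G = "wgrad UNIV u"
  obtain f where f: "AE x in lebesgue. u x = f (norm x)"
    using u by (auto simp: Hspace_def radial_def)
  have um: "u \<in> borel_measurable lebesgue" using H1_L2[OF uH1] by (simp add: L2_iff z)
  have Gm: "?G \<in> borel_measurable lebesgue" using H1_wgrad_L2[OF uH1] by (simp add: L2_iff z)
  obtain w where w [measurable]: "w \<in> borel_measurable borel" and uw: "AE x in lebesgue. u x = w x"
    and wL2: "w \<in> L2 UNIV"
    using L2_UNIV_borel_representative[OF H1_L2[OF uH1]] .
  obtain g where g [measurable]: "g \<in> borel_measurable borel" and Gg: "AE x in lebesgue. ?G x = g x"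
    and gL2: "g \<in> L2 UNIV"
    using L2_UNIV_borel_representative[OF H1_wgrad_L2[OF uH1]] .
  have leb: "h \<in> borel_measurable lebesgue" if "h \<in> borel_measurable borel" for h :: "real ^ 'n \<Rightarrow> 'b :: euclidean_space"
    using that by (intro measurable_completion) simp
  have wg: "L2_weak_gradient UNIV w g"
    unfolding L2_weak_gradient_def
  proof (intro conjI ballI gL2)
    fix \<phi> :: "real ^ 'n \<Rightarrow> real" assume \<phi>: "\<phi> \<in> test_functions UNIV"
    note \<phi>m = test_functions_measurable[OF \<phi>]
    have "(\<integral>x. w x *\<^sub>R grad \<phi> x \<partial>lebesgue) = (\<integral>x. u x *\<^sub>R grad \<phi> x \<partial>lebesgue)"
      using uw by (intro integral_cong_AE borel_measurable_scaleR leb w \<phi>m um) auto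
    moreover have "(\<integral>x. \<phi> x *\<^sub>R ?G x \<partial>lebesgue) = (\<integral>x. \<phi> x *\<^sub>R g x \<partial>lebesgue)"
      using Gg by (intro integral_cong_AE borel_measurable_scaleR leb g \<phi>m Gm) auto
    ultimately show "(LINT x:UNIV|lebesgue. w x *\<^sub>R grad \<phi> x) = - (LINT x:UNIV|lebesgue. \<phi> x *\<^sub>R g x)"
      using H1_wgrad[OF uH1] \<phi> unfolding L2_weak_gradient_def set_integral_zext z by simp
  qed
  have rad: "AE x in lborel. w x = f (norm x)"
  proof -
    have "AE x in lebesgue. w x = f (norm x)" using uw f by eventually_elim simp
    then show ?thesis by (simp only: AE_completion_iff)
  qed
  obtain Cw where Cw: "Cw \<ge> 0" "(\<integral>\<^sup>+x. ennreal ((norm (w x))\<^sup>2) \<partial>lborel) = ennreal Cw"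
    by (rule L2_UNIV_nn_integral[OF wL2 w])
  obtain Cg where Cg: "Cg \<ge> 0" "(\<integral>\<^sup>+x. ennreal ((norm (g x))\<^sup>2) \<partial>lborel) = ennreal Cg"
    by (rule L2_UNIV_nn_integral[OF gL2 g])
  define D where "D = Cg + lam * Cw"
  define m where "m = hform UNIV lam U"
  have m: "m > 0" unfolding m_def by (rule least_energy_hform_pos[OF open_UNIV lam U])
  have bound: "(\<integral>\<^sup>+x. ennreal ((averaging.avg (ball_measure r) w x)^4) \<partial>lborel) \<le> ennreal (D\<^sup>2 / m)"
    if r: "r > 0" for r
  proof -
    interpret averaging "ball_measure r :: (real ^ 'n) measure" "1 / measure lborel (ball (0 :: real ^ 'n) r)"
      using r by (rule averaging_ball)
    let ?K = "1 / measure lborel (ball (0 :: real ^ 'n) r)"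
    let ?v = "avg w" and ?h = "avg g"
    have vm [measurable]: "?v \<in> borel_measurable borel" by measurable
    have hm [measurable]: "?h \<in> borel_measurable borel" by measurable
    have vL2: "?v \<in> L2 UNIV" and hL2: "?h \<in> L2 UNIV"
      and v2: "integrable lborel (\<lambda>x. (norm (?v x))\<^sup>2)" and h2: "integrable lborel (\<lambda>x. (norm (?h x))\<^sup>2)"
      using avg_L2(1)[OF w Cw] avg_L2(1)[OF g Cg] by (auto simp: L2_UNIV_iff)
    have vh: "L2_weak_gradient UNIV ?v ?h"
      unfolding L2_weak_gradient_def
    proof (intro conjI ballI hL2)
      fix \<phi> :: "real ^ 'n \<Rightarrow> real" assume \<phi>: "\<phi> \<in> test_functions UNIV"
      have [measurable]: "\<phi> \<in> borel_measurable borel" "grad \<phi> \<in> borel_measurable borel"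
        by (rule test_functions_measurable[OF \<phi>])+
      show "(LINT x:UNIV|lebesgue. ?v x *\<^sub>R grad \<phi> x) = - (LINT x:UNIV|lebesgue. \<phi> x *\<^sub>R ?h x)"
        unfolding set_integral_zext z using avg_weak_gradient[OF w g Cw(2) Cg(2) wg \<phi>]
        by (simp add: integral_completion)
    qed
    have "radial ?v"
      unfolding radial_def
    proof (intro exI AE_I2)
      fix x :: "real ^ 'n"
      \<comment> \<open>The profile at s is read off at an arbitrary point of norm s.\<close>
      show "?v x = (\<lambda>s. ?v (SOME y. norm y = s)) (norm x)"
        by (rule ball_avg_radial[OF r w rad]) (rule someI[of "\<lambda>y. norm y = norm x", symmetric, OF refl])
    qed
    then have vH: "?v \<in> Hspace UNIV" using H1I[OF vL2 vh] by (simp add: Hspace_def)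
    have "hform UNIV lam ?v = (LINT x:UNIV|lebesgue. (norm (?h x))\<^sup>2 + lam * (?v x)\<^sup>2)"
      by (rule hform_eq[OF open_UNIV vL2 vh])
    also have "\<dots> = (\<integral>x. (norm (?h x))\<^sup>2 + lam * (norm (?v x))\<^sup>2 \<partial>lborel)"
      unfolding set_integral_zext z by (subst integral_completion) auto
    also have "\<dots> = (\<integral>x. (norm (?h x))\<^sup>2 \<partial>lborel) + lam * (\<integral>x. (norm (?v x))\<^sup>2 \<partial>lborel)"
      using v2 h2 by simp
    also have "\<dots> \<le> D" unfolding D_def using avg_L2(2)[OF w Cw] avg_L2(2)[OF g Cg] lam by (intro add_mono mult_left_mono) auto
    finally have "(hform UNIV lam ?v)\<^sup>2 \<le> D\<^sup>2" using lam by (intro power_mono) (auto simp: hform_nonneg)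
    then have P: "(LINT x:UNIV|lebesgue. (?v x)^4) \<le> D\<^sup>2 / m"
      using least_energy_Sobolev[OF open_UNIV lam U vH] m by (simp add: m_def field_simps)
    have K: "?K \<ge> 0" by simp
    \<comment> \<open>A pointwise bound which depends on r and serves only to make the fourth power
      integrable; the uniform bound is \<open>P\<close>.\<close>
    define B where "B = ?K * Cw"
    have vB: "(?v x)\<^sup>2 \<le> B" for x
    proof -
      have "ennreal ((?v x)\<^sup>2) \<le> ennreal ?K * ennreal Cw"
        using order_trans[OF avg_power2_le[OF w] nn_integral_translate_finite[OF w Cw(2)], of x] by simp
      also have "\<dots> = ennreal B" unfolding B_def by (rule ennreal_mult[OF K Cw(1), symmetric])
      finally show ?thesis
        using mult_nonneg_nonneg[OF K Cw(1)] by (simp only: B_def ennreal_le_iff)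
    qed
    have v4: "integrable lborel (\<lambda>x. (?v x)^4)"
    proof (rule Bochner_Integration.integrable_bound)
      show "integrable lborel (\<lambda>x. B * (norm (?v x))\<^sup>2)" using v2 by simp
      have "(?v x)^4 \<le> B * (norm (?v x))\<^sup>2" for x
        using mult_right_mono[OF vB[of x], of "(?v x)\<^sup>2"] by (simp add: power4_eq_xxxx power2_eq_square mult.assoc)
      then show "AE x in lborel. norm ((?v x)^4) \<le> norm (B * (norm (?v x))\<^sup>2)"
        by (intro AE_I2) (auto intro: order_trans[OF _ abs_ge_self])
    qed measurable
    have "(\<integral>\<^sup>+x. ennreal ((?v x)^4) \<partial>lborel) = ennreal (\<integral>x. (?v x)^4 \<partial>lborel)"
      by (rule nn_integral_eq_integral[OF v4]) simp
    also have "(\<integral>x. (?v x)^4 \<partial>lborel) = (LINT x:UNIV|lebesgue. (?v x)^4)"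
      unfolding set_integral_zext z by (subst integral_completion) auto
    finally show ?thesis using P by (simp add: ennreal_leI)
  qed
  have "(\<integral>\<^sup>+x. ennreal ((w x)^4) \<partial>lborel) \<le> ennreal (D\<^sup>2 / m)"
    by (rule power4_bound_from_ball_averages[OF w wL2 bound]) simp
  then have "(\<integral>\<^sup>+x. ennreal ((w x)^4) \<partial>lborel) < \<infinity>" by (rule order_le_less_trans) simp
  then have "integrable lborel (\<lambda>x. (w x)^4)" by (intro integrableI_nonneg) auto
  then have "integrable lebesgue (\<lambda>x. (w x)^4)" by (subst integrable_completion) auto
  then have "integrable lebesgue (\<lambda>x. (u x)^4)"
  proof (rule integrable_cong_AE_imp)
    show "(\<lambda>x. (u x)^4) \<in> borel_measurable lebesgue" using um by measurable
    show "AE x in lebesgue. (w x)^4 = (u x)^4" using uw by eventually_elim simp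
  qed
  then show ?thesis by (simp add: set_integrable_zext z)
qed

lemma Hspace_L4:
  fixes u :: "real ^ 'n \<Rightarrow> real"
  assumes \<Omega>: "open \<Omega>" and lam: "lam > 0" and U: "least_energy_solution \<Omega> lam U" and u: "u \<in> Hspace \<Omega>"
  shows "set_integrable lebesgue \<Omega> (\<lambda>x. (u x)^4)"
proof (cases "\<Omega> = UNIV")
  case True
  then show ?thesis using radial_H1_L4[of lam U u] lam U u by simp
next
  case False
  then show ?thesis using H10_L4[OF \<Omega> False lam U] u by (simp add: Hspace_def)
qed

section \<open>Multiples of a least energy solution\<close>

lemma hform_eq_0_imp_zero_on:
  "u \<in> H1 \<Omega> \<Longrightarrow> lam > 0 \<Longrightarrow> hform \<Omega> lam u = 0 \<Longrightarrow> zero_on \<Omega> u"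
  using hform_pos[of u \<Omega> lam] by force

lemma Hspace_zext_measurable: "u \<in> Hspace \<Omega> \<Longrightarrow> zext \<Omega> u \<in> borel_measurable lebesgue"
  using H1_L2[OF Hspace_H1, of u \<Omega>] by (simp add: L2_iff)

lemma set_integral_zero_on:
  fixes f :: "'a :: euclidean_space \<Rightarrow> real"
  assumes "zero_on \<Omega> u" "\<And>x. u x = 0 \<Longrightarrow> f x = 0"
  shows "(LINT x:\<Omega>|lebesgue. f x) = 0"
proof -
  have "AE x in lebesgue. zext \<Omega> f x = 0"
    using assms(1) unfolding zero_on_def
    by (rule eventually_mono) (auto simp: zext_def indicator_def assms(2))
  then show ?thesis unfolding set_integral_zext by (rule integral_eq_zero_AE)
qed

text \<open>The elementary inequality 2 t u^2 v^2 \<le> u^4 + t^2 v^4 is integrated, the least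
  energy inequality is applied to u and to v, and t is optimized. If one of the norms is 0, that
  function vanishes on \<Omega> and so does the product.\<close>

lemma square_products_bound:
  fixes u v U :: "real ^ 'n \<Rightarrow> real"
  assumes \<Omega>: "open \<Omega>" and lam: "lam > 0" and U: "least_energy_solution \<Omega> lam U"
    and u: "u \<in> Hspace \<Omega>" and v: "v \<in> Hspace \<Omega>"
  shows "set_integrable lebesgue \<Omega> (\<lambda>x. (u x)\<^sup>2 * (v x)\<^sup>2)"
    and "hform \<Omega> lam U * (LINT x:\<Omega>|lebesgue. (u x)\<^sup>2 * (v x)\<^sup>2) \<le> hform \<Omega> lam u * hform \<Omega> lam v"
proof -
  note u4 = Hspace_L4[OF \<Omega> lam U u] and v4 = Hspace_L4[OF \<Omega> lam U v]
  have [measurable]: "zext \<Omega> u \<in> borel_measurable lebesgue" "zext \<Omega> v \<in> borel_measurable lebesgue"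
    using u v by (auto intro: Hspace_zext_measurable)
  have le: "2 * t * (a\<^sup>2 * b\<^sup>2) \<le> a^4 + t\<^sup>2 * b^4" for a b t :: real
  proof -
    have "0 \<le> (a\<^sup>2 - t * b\<^sup>2)\<^sup>2" by simp
    then show ?thesis by (simp add: power2_diff power_mult_distrib power4_eq_xxxx power2_eq_square algebra_simps)
  qed
  let ?p = "\<lambda>x. (u x)\<^sup>2 * (v x)\<^sup>2"
  show i: "set_integrable lebesgue \<Omega> ?p"
    unfolding set_integrable_zext
  proof (rule Bochner_Integration.integrable_bound)
    have "set_integrable lebesgue \<Omega> (\<lambda>x. 1 *\<^sub>R (u x)^4 + 1 *\<^sub>R (v x)^4)"
      by (rule set_integrable_linear[OF u4 v4])
    then show "integrable lebesgue (zext \<Omega> (\<lambda>x. 1 *\<^sub>R (u x)^4 + 1 *\<^sub>R (v x)^4))"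
      by (simp only: set_integrable_zext)
    have "zext \<Omega> ?p = (\<lambda>x. (zext \<Omega> u x)\<^sup>2 * (zext \<Omega> v x)\<^sup>2)"
      by (rule ext) (simp add: zext_def indicator_def)
    then show "zext \<Omega> ?p \<in> borel_measurable lebesgue" by simp
    have "a\<^sup>2 * b\<^sup>2 \<le> a^4 + b^4" for a b :: real
    proof -
      have "2 * (a\<^sup>2 * b\<^sup>2) \<le> a^4 + b^4" using le[of 1 a b] by simp
      then show ?thesis
        using mult_nonneg_nonneg[OF zero_le_power2[of a] zero_le_power2[of b]] by linarith
    qed
    then have "norm (zext \<Omega> ?p x) \<le> norm (zext \<Omega> (\<lambda>x. 1 *\<^sub>R (u x)^4 + 1 *\<^sub>R (v x)^4) x)" for x
      by (cases "x \<in> \<Omega>") simp_all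
    then show "AE x in lebesgue. norm (zext \<Omega> ?p x) \<le> norm (zext \<Omega> (\<lambda>x. 1 *\<^sub>R (u x)^4 + 1 *\<^sub>R (v x)^4) x)"
      by (rule AE_I2)
  qed
  let ?m = "hform \<Omega> lam U" and ?a = "hform \<Omega> lam u" and ?b = "hform \<Omega> lam v"
  let ?c = "LINT x:\<Omega>|lebesgue. ?p x"
  have m: "?m > 0" by (rule least_energy_hform_pos[OF \<Omega> lam U])
  have nn: "?a \<ge> 0" "?b \<ge> 0" using lam by (auto simp: hform_nonneg)
  show "?m * ?c \<le> ?a * ?b"
  proof (cases "?a = 0 \<or> ?b = 0")
    case True
    then have "?c = 0"
      using hform_eq_0_imp_zero_on[OF Hspace_H1[OF u] lam] hform_eq_0_imp_zero_on[OF Hspace_H1[OF v] lam]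
        set_integral_zero_on[of \<Omega> u ?p] set_integral_zero_on[of \<Omega> v ?p] by auto
    then show ?thesis using nn by simp
  next
    case False
    then have ab: "?a > 0" "?b > 0" using nn by auto
    \<comment> \<open>The optimal weight: it makes \<open>?a\<close>^2 + t^2 \<open>?b\<close>^2
      equal to 2 t \<open>?a\<close> \<open>?b\<close>.\<close>
    define t where "t = ?a / ?b"
    have t: "t > 0" using ab by (simp add: t_def)
    have "2 * t * ?c = (LINT x:\<Omega>|lebesgue. (2 * t) *\<^sub>R ?p x + 0 *\<^sub>R ?p x)"
      by (subst set_integral_linear[OF i i]) simp
    also have "\<dots> \<le> (LINT x:\<Omega>|lebesgue. 1 *\<^sub>R (u x)^4 + t\<^sup>2 *\<^sub>R (v x)^4)"
      by (rule set_integral_mono[OF set_integrable_linear[OF i i] set_integrable_linear[OF u4 v4]])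
        (use le in simp)
    also have "\<dots> = (LINT x:\<Omega>|lebesgue. (u x)^4) + t\<^sup>2 * (LINT x:\<Omega>|lebesgue. (v x)^4)"
      by (subst set_integral_linear[OF u4 v4]) simp
    finally have "?m * (2 * t * ?c) \<le> ?m * (LINT x:\<Omega>|lebesgue. (u x)^4) + t\<^sup>2 * (?m * (LINT x:\<Omega>|lebesgue. (v x)^4))"
      using mult_left_mono[OF _ less_imp_le[OF m]] by (fastforce simp: algebra_simps)
    also have "\<dots> \<le> ?a\<^sup>2 + t\<^sup>2 * ?b\<^sup>2"
      by (intro add_mono mult_left_mono least_energy_Sobolev[OF \<Omega> lam U u] least_energy_Sobolev[OF \<Omega> lam U v]) simp
    also have "\<dots> = 2 * t * (?a * ?b)" using ab by (simp add: t_def power2_eq_square field_simps)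
    finally have "2 * t * (?m * ?c) \<le> 2 * t * (?a * ?b)" by (simp add: mult_ac)
    then show ?thesis using t by simp
  qed
qed

lemma quartic_bound:
  fixes A :: "real ^ 'm ^ 'm" and U :: "real ^ 'n \<Rightarrow> real"
  assumes \<Omega>: "open \<Omega>" and lam: "lam > 0" and U: "least_energy_solution \<Omega> lam U"
    and s: "s > 0" and A: "\<And>x. (x \<bullet> (A *v x)) * s \<le> (\<Sum>i\<in>UNIV. x $ i)\<^sup>2"
    and u: "\<And>i. u i \<in> Hspace \<Omega>"
  shows "hform \<Omega> lam U * s * quartic \<Omega> A u \<le> (\<Sum>i\<in>UNIV. hform \<Omega> lam (u i))\<^sup>2"
proof -
  let ?m = "hform \<Omega> lam U"
  let ?p = "\<lambda>i j x. (u i x)\<^sup>2 * (u j x)\<^sup>2"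
  have m: "?m > 0" by (rule least_energy_hform_pos[OF \<Omega> lam U])
  have i: "set_integrable lebesgue \<Omega> (?p i j)" for i j
    by (rule square_products_bound(1)[OF \<Omega> lam U u u])
  have z: "zext \<Omega> (\<lambda>x. \<Sum>i\<in>UNIV. \<Sum>j\<in>UNIV. ?p i j x) = (\<lambda>x. \<Sum>i\<in>UNIV. \<Sum>j\<in>UNIV. zext \<Omega> (?p i j) x)"
    by (rule ext) (simp add: zext_def sum_distrib_left)
  have int: "integrable lebesgue (zext \<Omega> (\<lambda>x. \<Sum>i\<in>UNIV. \<Sum>j\<in>UNIV. ?p i j x))"
    unfolding z using i by (intro Bochner_Integration.integrable_sum) (simp add: set_integrable_zext)
  have "s * quartic \<Omega> A u = (\<integral>x. s * zext \<Omega> (\<lambda>x. \<Sum>i\<in>UNIV. \<Sum>j\<in>UNIV. A $ i $ j * (u i x)\<^sup>2 * (u j x)\<^sup>2) x \<partial>lebesgue)"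
    by (simp add: quartic_def set_integral_zext)
  also have "\<dots> \<le> (\<integral>x. zext \<Omega> (\<lambda>x. \<Sum>i\<in>UNIV. \<Sum>j\<in>UNIV. ?p i j x) x \<partial>lebesgue)"
  \<comment> \<open>Only the upper function has to be integrable and nonnegative, so integrability
    of the integrand of \<open>quartic\<close> need not be discussed.\<close>
  proof (rule integral_mono'[OF int])
    fix x
    have "s * (\<Sum>i\<in>UNIV. \<Sum>j\<in>UNIV. A $ i $ j * (u i x)\<^sup>2 * (u j x)\<^sup>2) \<le> (\<Sum>i\<in>UNIV. \<Sum>j\<in>UNIV. ?p i j x)"
    proof -
      let ?w = "\<chi> i. (u i x)\<^sup>2"
      have "(\<Sum>i\<in>UNIV. \<Sum>j\<in>UNIV. A $ i $ j * (u i x)\<^sup>2 * (u j x)\<^sup>2) = ?w \<bullet> (A *v ?w)"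
        by (simp add: inner_vec_def matrix_vector_mult_def sum_distrib_left mult_ac)
      moreover have "(\<Sum>i\<in>UNIV. \<Sum>j\<in>UNIV. ?p i j x) = (\<Sum>i\<in>UNIV. ?w $ i)\<^sup>2"
        by (simp add: power2_eq_square sum_product)
      ultimately show ?thesis using A[of ?w] by (simp add: mult.commute)
    qed
    then show "s * zext \<Omega> (\<lambda>x. \<Sum>i\<in>UNIV. \<Sum>j\<in>UNIV. A $ i $ j * (u i x)\<^sup>2 * (u j x)\<^sup>2) x
        \<le> zext \<Omega> (\<lambda>x. \<Sum>i\<in>UNIV. \<Sum>j\<in>UNIV. ?p i j x) x"
      by (cases "x \<in> \<Omega>") auto
    show "0 \<le> zext \<Omega> (\<lambda>x. \<Sum>i\<in>UNIV. \<Sum>j\<in>UNIV. ?p i j x) x"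
      by (cases "x \<in> \<Omega>") (auto intro!: sum_nonneg)
  qed
  also have "\<dots> = (\<Sum>i\<in>UNIV. \<Sum>j\<in>UNIV. LINT x:\<Omega>|lebesgue. ?p i j x)"
    unfolding z set_integral_zext using i by (simp add: set_integrable_zext)
  finally have "?m * (s * quartic \<Omega> A u) \<le> ?m * (\<Sum>i\<in>UNIV. \<Sum>j\<in>UNIV. LINT x:\<Omega>|lebesgue. ?p i j x)"
    using m by (intro mult_left_mono) auto
  also have "\<dots> = (\<Sum>i\<in>UNIV. \<Sum>j\<in>UNIV. ?m * (LINT x:\<Omega>|lebesgue. ?p i j x))"
    by (simp add: sum_distrib_left)
  also have "\<dots> \<le> (\<Sum>i\<in>UNIV. \<Sum>j\<in>UNIV. hform \<Omega> lam (u i) * hform \<Omega> lam (u j))"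
    by (intro sum_mono square_products_bound(2)[OF \<Omega> lam U u u])
  also have "\<dots> = (\<Sum>i\<in>UNIV. hform \<Omega> lam (u i))\<^sup>2" by (simp add: power2_eq_square sum_product)
  finally show ?thesis by (simp add: mult.assoc)
qed

section \<open>Energy and equation for multiples of \<open>U\<close>\<close>

text \<open>On the scalar Nehari set the integral of U^4 is \<open>hform \<Omega> lam U\<close>, so
  both parts of the energy become multiples of the same number, with coefficients depending only on
  the c_i^2.\<close>

lemma multiples_forms:
  fixes A :: "real ^ 'm ^ 'm" and c :: "real ^ 'm"
  assumes \<Omega>: "open \<Omega>" and U: "U \<in> scalar_nehari \<Omega> lam"
  shows "(\<Sum>i\<in>UNIV. hform \<Omega> lam (\<lambda>x. c $ i * U x)) = (\<Sum>i\<in>UNIV. (c $ i)\<^sup>2) * hform \<Omega> lam U"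
    and "quartic \<Omega> A (\<lambda>i x. c $ i * U x)
      = ((\<chi> i. (c $ i)\<^sup>2) \<bullet> (A *v (\<chi> i. (c $ i)\<^sup>2))) * hform \<Omega> lam U"
proof -
  have UH: "U \<in> H1 \<Omega>" and P: "hform \<Omega> lam U = (LINT x:\<Omega>|lebesgue. (U x)^4)"
    using U Hspace_H1 by (auto simp: scalar_nehari_iff[OF \<Omega>])
  show "(\<Sum>i\<in>UNIV. hform \<Omega> lam (\<lambda>x. c $ i * U x)) = (\<Sum>i\<in>UNIV. (c $ i)\<^sup>2) * hform \<Omega> lam U"
    by (simp add: hform_scale[OF \<Omega> UH] sum_distrib_right)
  let ?q = "(\<chi> i. (c $ i)\<^sup>2) \<bullet> (A *v (\<chi> i. (c $ i)\<^sup>2))"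
  have q: "?q = (\<Sum>i\<in>UNIV. \<Sum>j\<in>UNIV. A $ i $ j * (c $ i)\<^sup>2 * (c $ j)\<^sup>2)"
    by (simp add: inner_vec_def matrix_vector_mult_def sum_distrib_left mult_ac)
  have "(\<Sum>i\<in>UNIV. \<Sum>j\<in>UNIV. A $ i $ j * (c $ i * U x)\<^sup>2 * (c $ j * U x)\<^sup>2) = ?q * (U x)^4" for x
    unfolding q sum_distrib_right
    by (intro sum.cong refl) (simp add: power_mult_distrib power4_eq_xxxx power2_eq_square mult_ac)
  then show "quartic \<Omega> A (\<lambda>i x. c $ i * U x) = ?q * hform \<Omega> lam U"
    by (simp add: quartic_def P)
qed

lemma multiples_in_nehari:
  fixes A :: "real ^ 'm ^ 'm" and c :: "real ^ 'm"
  assumes \<Omega>: "open \<Omega>" and U: "U \<in> scalar_nehari \<Omega> lam" and c: "c $ k \<noteq> 0"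
    and eq: "(\<Sum>i\<in>UNIV. (c $ i)\<^sup>2) = (\<chi> i. (c $ i)\<^sup>2) \<bullet> (A *v (\<chi> i. (c $ i)\<^sup>2))"
  shows "(\<lambda>i x. c $ i * U x) \<in> nehari \<Omega> lam A"
proof -
  have "U \<in> Hspace \<Omega>" "\<not> zero_on \<Omega> U" using U by (auto simp: scalar_nehari_def)
  moreover from this c have "\<not> zero_on \<Omega> (\<lambda>x. c $ k * U x)" by (simp add: zero_on_def)
  ultimately show ?thesis
    unfolding nehari_iff[OF \<Omega>] multiples_forms[OF \<Omega> U] using eq Hspace_scale[OF \<Omega>] by auto
qed

text \<open>The chosen gradient of c u is c times that of u only almost everywhere, which is why
  measurability of both integrands enters.\<close>

lemma weak_form_scale:
  assumes \<Omega>: "open \<Omega>" and u: "u \<in> H1 \<Omega>" and \<phi>: "\<phi> \<in> test_functions \<Omega>"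
  shows "(LINT x:\<Omega>|lebesgue. wgrad \<Omega> (\<lambda>x. c * u x) x \<bullet> grad \<phi> x + lam * (c * u x) * \<phi> x)
    = c * (LINT x:\<Omega>|lebesgue. wgrad \<Omega> u x \<bullet> grad \<phi> x + lam * u x * \<phi> x)"
proof -
  have \<phi>m: "\<phi> \<in> borel_measurable lebesgue" "grad \<phi> \<in> borel_measurable lebesgue"
    using test_functions_measurable[OF \<phi>] by (auto intro!: measurable_completion)
  have meas: "zext \<Omega> (\<lambda>x. g x \<bullet> grad \<phi> x + lam * (c * u x) * \<phi> x) \<in> borel_measurable lebesgue"
    if "g \<in> L2 \<Omega>" for g
  proof -
    have "zext \<Omega> (\<lambda>x. g x \<bullet> grad \<phi> x + lam * (c * u x) * \<phi> x)
        = (\<lambda>x. zext \<Omega> g x \<bullet> grad \<phi> x + lam * (c * zext \<Omega> u x) * \<phi> x)"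
      by (rule ext) (simp add: zext_def indicator_def)
    moreover have "zext \<Omega> g \<in> borel_measurable lebesgue" "zext \<Omega> u \<in> borel_measurable lebesgue"
      using that H1_L2[OF u] by (auto simp: L2_iff)
    ultimately show ?thesis using \<phi>m by simp
  qed
  have "(LINT x:\<Omega>|lebesgue. wgrad \<Omega> (\<lambda>x. c * u x) x \<bullet> grad \<phi> x + lam * (c * u x) * \<phi> x)
      = (LINT x:\<Omega>|lebesgue. (c *\<^sub>R wgrad \<Omega> u x) \<bullet> grad \<phi> x + lam * (c * u x) * \<phi> x)"
  proof (rule set_integral_cong_zext_AE[OF meas meas])
    show "wgrad \<Omega> (\<lambda>x. c * u x) \<in> L2 \<Omega>" by (rule H1_wgrad_L2[OF H1_scale(1)[OF \<Omega> u]])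
    show "(\<lambda>x. c *\<^sub>R wgrad \<Omega> u x) \<in> L2 \<Omega>" by (rule L2_scale[OF H1_wgrad_L2[OF u]])
    show "AE x in lebesgue. x \<in> \<Omega> \<longrightarrow> wgrad \<Omega> (\<lambda>x. c * u x) x \<bullet> grad \<phi> x + lam * (c * u x) * \<phi> x
        = (c *\<^sub>R wgrad \<Omega> u x) \<bullet> grad \<phi> x + lam * (c * u x) * \<phi> x"
      using H1_scale(2)[OF \<Omega> u, of c] by (auto elim: eventually_mono)
  qed
  also have "\<dots> = (LINT x:\<Omega>|lebesgue. c * (wgrad \<Omega> u x \<bullet> grad \<phi> x + lam * u x * \<phi> x))"
    by (simp add: algebra_simps)
  finally show ?thesis by simp
qed

lemma multiples_reaction:
  fixes A :: "real ^ 'm ^ 'm" and c :: "real ^ 'm"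
  shows "(LINT x:\<Omega>|lebesgue. (\<Sum>j\<in>UNIV. A $ i $ j * (c $ i * U x) * (c $ j * U x)\<^sup>2) * \<phi> x)
    = (A *v (\<chi> i. (c $ i)\<^sup>2)) $ i * (c $ i * (LINT x:\<Omega>|lebesgue. (U x)^3 * \<phi> x))"
proof -
  have "(\<Sum>j\<in>UNIV. A $ i $ j * (c $ i * U x) * (c $ j * U x)\<^sup>2) * \<phi> x
      = ((A *v (\<chi> i. (c $ i)\<^sup>2)) $ i * c $ i) * ((U x)^3 * \<phi> x)" for x
    by (simp add: matrix_vector_mult_def sum_distrib_left sum_distrib_right power_mult_distrib
        power3_eq_cube power2_eq_square mult_ac)
  then have "(LINT x:\<Omega>|lebesgue. (\<Sum>j\<in>UNIV. A $ i $ j * (c $ i * U x) * (c $ j * U x)\<^sup>2) * \<phi> x)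
      = (LINT x:\<Omega>|lebesgue. ((A *v (\<chi> i. (c $ i)\<^sup>2)) $ i * c $ i) * ((U x)^3 * \<phi> x))"
    by (simp only:)
  also have "\<dots> = ((A *v (\<chi> i. (c $ i)\<^sup>2)) $ i * c $ i) * (LINT x:\<Omega>|lebesgue. (U x)^3 * \<phi> x)"
    by (rule set_integral_mult_right)
  finally show ?thesis by (simp only: mult.assoc)
qed

text \<open>Tested against \<phi>, the two sides of equation i are c_i and (A d)_i c_i times the
  integral of U^3 \<phi>. To cancel the latter, some \<phi> must make it nonzero; otherwise the
  fundamental lemma would give U^3 = 0. That lemma applies because U^3 is integrable, being
  dominated by U^2 + U^4.\<close>

lemma multiples_solution_iff:
  fixes A :: "real ^ 'm ^ 'm" and c :: "real ^ 'm" and U :: "real ^ 'n \<Rightarrow> real"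
  assumes \<Omega>: "open \<Omega>" and lam: "lam > 0" and U: "least_energy_solution \<Omega> lam U"
    and c: "\<And>i. c $ i \<noteq> 0"
  shows "system_solution \<Omega> lam A (\<lambda>i x. c $ i * U x) \<longleftrightarrow> A *v (\<chi> i. (c $ i)\<^sup>2) = (\<chi> i. 1)"
proof -
  let ?d = "\<chi> i. (c $ i)\<^sup>2"
  have UH: "U \<in> Hspace \<Omega>" and nz: "\<not> zero_on \<Omega> U"
    using U by (auto simp: least_energy_solution_def scalar_nehari_def)
  have weak: "(LINT x:\<Omega>|lebesgue. wgrad \<Omega> U x \<bullet> grad \<phi> x + lam * U x * \<phi> x)
      = (LINT x:\<Omega>|lebesgue. (U x)^3 * \<phi> x)" if "\<phi> \<in> test_functions \<Omega>" for \<phi>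
    using U that by (simp add: least_energy_solution_def scalar_solution_def)
  have ex: "\<exists>\<phi>\<in>test_functions \<Omega>. (LINT x:\<Omega>|lebesgue. (U x)^3 * \<phi> x) \<noteq> 0"
  proof (rule ccontr)
    assume "\<not> ?thesis"
    then have zero: "(LINT x:\<Omega>|lebesgue. \<phi> x *\<^sub>R (U x)^3) = 0" if "\<phi> \<in> test_functions \<Omega>" for \<phi>
      using that by (simp add: mult.commute)
    have [measurable]: "zext \<Omega> U \<in> borel_measurable lebesgue" by (rule Hspace_zext_measurable[OF UH])
    have z: "(\<lambda>x. indicator \<Omega> x *\<^sub>R (U x)^3) = (\<lambda>x. (zext \<Omega> U x)^3)"
      by (rule ext) (simp add: zext_def indicator_def)
    have "set_integrable lebesgue \<Omega> (\<lambda>x. 1 *\<^sub>R (norm (U x))\<^sup>2 + 1 *\<^sub>R (U x)^4)"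
      by (intro set_integrable_linear Hspace_L4[OF \<Omega> lam U UH] L2_norm_power2_integrable H1_L2 Hspace_H1 UH)
    then have "integrable lebesgue (zext \<Omega> (\<lambda>x. 1 *\<^sub>R (norm (U x))\<^sup>2 + 1 *\<^sub>R (U x)^4))"
      by (simp only: set_integrable_zext)
    then have i3: "integrable lebesgue (\<lambda>x. (zext \<Omega> U x)^3)"
    proof (rule Bochner_Integration.integrable_bound)
      have "\<bar>a^3\<bar> \<le> a\<^sup>2 + a^4" for a :: real
      proof -
        have "2 * \<bar>a\<bar> * a\<^sup>2 \<le> (1 + a\<^sup>2) * a\<^sup>2"
          using sum_squares_bound[of "\<bar>a\<bar>" 1] by (intro mult_right_mono) auto
        moreover have "0 \<le> \<bar>a\<bar> * a\<^sup>2" by simp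
        moreover have "\<bar>a^3\<bar> = \<bar>a\<bar> * a\<^sup>2" by (simp add: power3_eq_cube power2_eq_square abs_mult)
        ultimately show ?thesis by (simp add: algebra_simps power4_eq_xxxx power2_eq_square)
      qed
      then show "AE x in lebesgue. norm ((zext \<Omega> U x)^3) \<le> norm (zext \<Omega> (\<lambda>x. 1 *\<^sub>R (norm (U x))\<^sup>2 + 1 *\<^sub>R (U x)^4) x)"
        by (intro AE_I2) (auto simp: zext_def indicator_def)
    qed measurable
    have "AE x in lebesgue. x \<in> \<Omega> \<longrightarrow> (U x)^3 = 0"
    proof (rule fundamental_lemma[OF \<Omega> _ zero])
      show "set_integrable lebesgue (cbox a b) (\<lambda>x. indicator \<Omega> x *\<^sub>R (U x)^3)" for a b
        unfolding z set_integrable_def using i3 by (intro integrable_mult_indicator) auto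
    qed
    then have "zero_on \<Omega> U" unfolding zero_on_def by (rule eventually_mono) simp
    then show False using nz by simp
  qed
  have lhs: "(LINT x:\<Omega>|lebesgue. wgrad \<Omega> (\<lambda>x. c $ i * U x) x \<bullet> grad \<phi> x + lam * (c $ i * U x) * \<phi> x)
      = c $ i * (LINT x:\<Omega>|lebesgue. (U x)^3 * \<phi> x)" if "\<phi> \<in> test_functions \<Omega>" for i \<phi>
    using weak_form_scale[OF \<Omega> Hspace_H1[OF UH] that] weak[OF that] by simp
  show ?thesis
  proof
    assume sol: "system_solution \<Omega> lam A (\<lambda>i x. c $ i * U x)"
    obtain \<phi> where \<phi>: "\<phi> \<in> test_functions \<Omega>" "(LINT x:\<Omega>|lebesgue. (U x)^3 * \<phi> x) \<noteq> 0"
      using ex by blast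
    have "(A *v ?d) $ i = 1" for i
    proof -
      have "(LINT x:\<Omega>|lebesgue. wgrad \<Omega> (\<lambda>x. c $ i * U x) x \<bullet> grad \<phi> x + lam * (c $ i * U x) * \<phi> x)
          = (LINT x:\<Omega>|lebesgue. (\<Sum>j\<in>UNIV. A $ i $ j * (c $ i * U x) * (c $ j * U x)\<^sup>2) * \<phi> x)"
        using sol \<phi>(1) unfolding system_solution_def by blast
      then have "c $ i * (LINT x:\<Omega>|lebesgue. (U x)^3 * \<phi> x)
          = (A *v ?d) $ i * (c $ i * (LINT x:\<Omega>|lebesgue. (U x)^3 * \<phi> x))"
        unfolding lhs[OF \<phi>(1)] multiples_reaction .
      then show ?thesis using \<phi>(2) c[of i] by simp
    qed
    then show "A *v ?d = (\<chi> i. 1)" by (simp add: vec_eq_iff)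
  next
    assume Ad: "A *v ?d = (\<chi> i. 1)"
    show "system_solution \<Omega> lam A (\<lambda>i x. c $ i * U x)"
      unfolding system_solution_def
    proof (intro allI conjI ballI)
      fix i and \<phi> assume "\<phi> \<in> test_functions \<Omega>"
      from lhs[OF this, of i] show "(LINT x:\<Omega>|lebesgue.
          wgrad \<Omega> (\<lambda>x. c $ i * U x) x \<bullet> grad \<phi> x + lam * (c $ i * U x) * \<phi> x)
        = (LINT x:\<Omega>|lebesgue. (\<Sum>j\<in>UNIV. A $ i $ j * (c $ i * U x) * (c $ j * U x)\<^sup>2) * \<phi> x)"
        unfolding multiples_reaction Ad by simp
    qed (rule Hspace_scale[OF \<Omega> UH])
  qed
qed

text \<open>A nonempty open set is not null. This rules out c_i = 0, for which the i-th component
  would vanish identically.\<close>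

lemma positive_on_imp_ex_pos:
  fixes u :: "'a :: euclidean_space \<Rightarrow> real"
  assumes "open \<Omega>" "\<Omega> \<noteq> {}" "positive_on \<Omega> u"
  shows "\<exists>x\<in>\<Omega>. u x > 0"
proof (rule ccontr)
  assume no: "\<not> ?thesis"
  have "AE x in lebesgue. x \<notin> \<Omega>"
    using assms(3) unfolding positive_on_def by (rule eventually_mono) (use no in blast)
  then have "\<Omega> \<in> null_sets lebesgue"
    using assms(1) by (subst AE_iff_null_sets) auto
  then show False using assms open_not_negligible negligible_iff_null_sets by blast
qed

section \<open>Minimality and the sign of the form on the hyperplane\<close>

text \<open>Moving d to d + t x keeps the sum s of the entries. The term of first order in t of the
  form is proportional to <A d, x> = \<Sum>x_i = 0, so the form increases from s by t^2 <A x, x>.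
  The Nehari condition then forces a rescaling by a factor r < 1, and the energy drops by this
  factor.\<close>

lemma hyperplane_nonpos_if_minimizer:
  fixes A :: "real ^ 'm ^ 'm" and c :: "real ^ 'm" and U :: "real ^ 'n \<Rightarrow> real"
  assumes \<Omega>: "open \<Omega>" and lam: "lam > 0" and U: "least_energy_solution \<Omega> lam U"
    and sym: "transpose A = A" and c: "\<And>i. c $ i \<noteq> 0" and Ad: "A *v (\<chi> i. (c $ i)\<^sup>2) = (\<chi> i. 1)"
    and neh: "(\<lambda>i x. c $ i * U x) \<in> nehari \<Omega> lam A"
    and min: "energy \<Omega> lam A (\<lambda>i x. c $ i * U x) = Mval \<Omega> lam A"
    and x: "x \<bullet> (\<chi> i. 1) = 0"
  shows "x \<bullet> (A *v x) \<le> 0"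
proof (rule ccontr)
  assume "\<not> x \<bullet> (A *v x) \<le> 0"
  then have qx: "x \<bullet> (A *v x) > 0" by simp
  let ?d = "\<chi> i. (c $ i)\<^sup>2"
  have US: "U \<in> scalar_nehari \<Omega> lam" using U by (simp add: least_energy_solution_def)
  have m: "hform \<Omega> lam U > 0" by (rule least_energy_hform_pos[OF \<Omega> lam U])
  have d: "?d $ i > 0" for i using c[of i] by simp
  define s where "s = (\<Sum>i\<in>UNIV. (c $ i)\<^sup>2)"
  have s: "s > 0" using c by (auto simp: s_def intro!: sum_pos)
  \<comment> \<open>Small enough to keep all entries of d + t x positive; the added 1 makes this
    strict and avoids division by 0.\<close>
  define t where "t = Min (range (\<lambda>i. ?d $ i / (\<bar>x $ i\<bar> + 1)))"
  have t: "t > 0" unfolding t_def using d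
    by (subst Min_gr_iff) (auto intro!: divide_pos_pos)
  define e where "e = ?d + t *\<^sub>R x"
  have e: "e $ i > 0" for i
  proof -
    have "t \<le> ?d $ i / (\<bar>x $ i\<bar> + 1)" unfolding t_def by (intro Min_le) auto
    then have "t * (\<bar>x $ i\<bar> + 1) \<le> ?d $ i" by (simp add: pos_le_divide_eq)
    moreover have "t * \<bar>x $ i\<bar> \<ge> - (t * x $ i)" using t mult_left_mono[of "- (x $ i)" "\<bar>x $ i\<bar>" t] by simp
    ultimately show ?thesis using t by (simp add: e_def algebra_simps)
  qed
  have sum_x: "(\<Sum>i\<in>UNIV. x $ i) = 0" using x by (simp add: inner_vec_def)
  have sum_e: "(\<Sum>i\<in>UNIV. e $ i) = s"
    using sum_x by (simp add: e_def s_def sum.distrib sum_distrib_left[symmetric])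
  have "e \<bullet> (A *v e) = ?d \<bullet> (A *v ?d) + 2 * t * (x \<bullet> (A *v ?d)) + t\<^sup>2 * (x \<bullet> (A *v x))"
    using symmetric_matrix_inner[OF sym, of ?d x]
    by (simp add: e_def matrix_vector_right_distrib matrix_vector_mult_scaleR inner_add_left
        inner_add_right inner_commute power2_eq_square algebra_simps)
  also have "\<dots> = s + t\<^sup>2 * (x \<bullet> (A *v x))"
    using x by (simp add: Ad s_def inner_vec_def)
  finally have qe: "e \<bullet> (A *v e) > s" using qx t by simp
  \<comment> \<open>The solution of the Nehari equation r s = r^2 <A e, e> for the squares r
    e_i.\<close>
  define r where "r = s / (e \<bullet> (A *v e))"
  have r: "0 < r" "r < 1" using qe s by (auto simp: r_def)
  define b where "b = (\<chi> i. sqrt (r * e $ i))"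
  have b2: "(b $ i)\<^sup>2 = r * e $ i" for i using r e[of i] by (simp add: b_def)
  have b2v: "(\<chi> i. (b $ i)\<^sup>2) = r *\<^sub>R e" using b2 by (simp add: vec_eq_iff)
  have sum_b: "(\<Sum>i\<in>UNIV. (b $ i)\<^sup>2) = r * s" by (simp add: b2 sum_distrib_left[symmetric] sum_e)
  have "b $ undefined \<noteq> 0" using r e[of undefined] by (simp add: b_def)
  moreover have "(\<Sum>i\<in>UNIV. (b $ i)\<^sup>2) = (\<chi> i. (b $ i)\<^sup>2) \<bullet> (A *v (\<chi> i. (b $ i)\<^sup>2))"
    unfolding sum_b b2v using qe s by (simp add: matrix_vector_mult_scaleR r_def)
  ultimately have bn: "(\<lambda>i x. b $ i * U x) \<in> nehari \<Omega> lam A"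
    by (rule multiples_in_nehari[OF \<Omega> US])
  have "bdd_below (energy \<Omega> lam A ` nehari \<Omega> lam A)"
    using lam by (intro bdd_belowI2[of _ 0]) (simp add: energy_on_nehari[OF \<Omega>] hform_nonneg sum_nonneg)
  then have "energy \<Omega> lam A (\<lambda>i x. c $ i * U x) \<le> energy \<Omega> lam A (\<lambda>i x. b $ i * U x)"
    unfolding min Mval_def using bn by (intro cInf_lower) auto
  then have "s * hform \<Omega> lam U \<le> r * s * hform \<Omega> lam U"
    unfolding energy_on_nehari[OF \<Omega> neh] energy_on_nehari[OF \<Omega> bn] multiples_forms(1)[OF \<Omega> US] sum_b s_def[symmetric]
    by simp
  then show False using r s m by simp
qed

text \<open>The multiple of \<open>U\<close> has quadratic part s \<parallel>U\<parallel>^2, and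
  this is exactly the lower bound which the quartic bound forces on every element of the Nehari
  set.\<close>

lemma minimizer_if_reverse_Cauchy_Schwarz:
  fixes A :: "real ^ 'm ^ 'm" and d :: "real ^ 'm" and U :: "real ^ 'n \<Rightarrow> real"
  assumes \<Omega>: "open \<Omega>" and lam: "lam > 0" and U: "least_energy_solution \<Omega> lam U"
    and d: "\<And>i. d $ i > 0" and Ad: "A *v d = (\<chi> i. 1)"
    and A: "\<And>x. (x \<bullet> (A *v x)) * (\<Sum>i\<in>UNIV. d $ i) \<le> (\<Sum>i\<in>UNIV. x $ i)\<^sup>2"
  defines "c \<equiv> (\<chi> i. sqrt (d $ i))"
  shows "(\<lambda>i x. c $ i * U x) \<in> nehari \<Omega> lam A"
    and "energy \<Omega> lam A (\<lambda>i x. c $ i * U x) = Mval \<Omega> lam A"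
proof -
  let ?u = "\<lambda>i x. c $ i * U x"
  let ?m = "hform \<Omega> lam U"
  define s where "s = (\<Sum>i\<in>UNIV. d $ i)"
  have s: "s > 0" using d by (auto simp: s_def intro!: sum_pos)
  have US: "U \<in> scalar_nehari \<Omega> lam" using U by (simp add: least_energy_solution_def)
  have m: "?m > 0" by (rule least_energy_hform_pos[OF \<Omega> lam U])
  have c2: "(c $ i)\<^sup>2 = d $ i" for i using d[of i] by (simp add: c_def)
  have c2v: "(\<chi> i. (c $ i)\<^sup>2) = d" by (simp add: vec_eq_iff c2)
  have "c $ undefined \<noteq> 0" using d[of undefined] by (simp add: c_def)
  moreover have "(\<Sum>i\<in>UNIV. (c $ i)\<^sup>2) = (\<chi> i. (c $ i)\<^sup>2) \<bullet> (A *v (\<chi> i. (c $ i)\<^sup>2))"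
    unfolding c2v by (simp add: Ad c2 inner_vec_def)
  ultimately show neh: "?u \<in> nehari \<Omega> lam A" by (rule multiples_in_nehari[OF \<Omega> US])
  have en: "energy \<Omega> lam A ?u = 1/4 * (s * ?m)"
    unfolding energy_on_nehari[OF \<Omega> neh] multiples_forms(1)[OF \<Omega> US] by (simp add: c2 s_def)
  have "energy \<Omega> lam A ?u \<le> energy \<Omega> lam A v" if v: "v \<in> nehari \<Omega> lam A" for v
  proof -
    let ?Q = "\<Sum>i\<in>UNIV. hform \<Omega> lam (v i)"
    have vH: "\<And>i. v i \<in> Hspace \<Omega>" and eq: "?Q = quartic \<Omega> A v" and "\<not> (\<forall>i. zero_on \<Omega> (v i))"
      using v by (auto simp: nehari_iff[OF \<Omega>])
    then obtain k where "\<not> zero_on \<Omega> (v k)" by blast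
    then have "hform \<Omega> lam (v k) > 0" by (rule hform_pos[OF Hspace_H1[OF vH] lam])
    moreover have "hform \<Omega> lam (v k) \<le> ?Q"
      using lam by (intro member_le_sum) (auto simp: hform_nonneg)
    ultimately have Q: "?Q > 0" by simp
    \<comment> \<open>On the Nehari set the quartic form is itself \<open>?Q\<close>, so one factor
      \<open>?Q\<close> > 0 cancels.\<close>
    have "?m * s * ?Q \<le> ?Q\<^sup>2"
      using quartic_bound[where u = v and A = A, OF \<Omega> lam U s _ vH] A eq by (simp add: s_def)
    then have "?m * s \<le> ?Q" using Q by (simp add: power2_eq_square)
    then show ?thesis unfolding en energy_on_nehari[OF \<Omega> v] by (simp add: mult.commute)
  qed
  then show "energy \<Omega> lam A ?u = Mval \<Omega> lam A"
    unfolding Mval_def using neh by (intro cInf_eq_minimum[symmetric]) auto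
qed

section \<open>The equivalence\<close>

theorem theorem4p1:
  fixes \<Omega> :: "(real ^ 'N) set" and A :: "real ^ 'n ^ 'n" and lam :: real
  assumes "CARD('N) \<le> 3"
    and "open \<Omega>" and "connected \<Omega>" and "\<Omega> \<noteq> {}"
    and "transpose A = A" and "\<forall>i j. A $ i $ j \<ge> 0"
    and "lam > 0"
    and "\<exists>U. least_energy_solution \<Omega> lam U \<and> positive_on \<Omega> U"
  shows "((\<exists>\<mu>. eigenvalue_seq A \<mu> \<and> \<mu> 1 > 0 \<and>
            (\<forall>k\<in>{2..CARD('n)}. \<mu> k \<le> 0 \<and> \<mu> k \<le> \<mu> (k - 1))) \<and>
          (\<exists>e > 0. (\<chi> i. e) \<in> rel_interior (convex hull (range (\<lambda>j. column j A)))))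
     \<longleftrightarrow>
         (\<exists>(c :: real ^ 'n) U. least_energy_solution \<Omega> lam U \<and>
            (let u = (\<lambda>i x. c $ i * U x) in
               (\<forall>i. positive_on \<Omega> (u i)) \<and> system_solution \<Omega> lam A u \<and>
               u \<in> nehari \<Omega> lam A \<and> energy \<Omega> lam A u = Mval \<Omega> lam A))"
    (is "?spec \<and> ?hull \<longleftrightarrow> ?R")
proof -
  note \<Omega> = assms(2) and sym = assms(5) and lam = assms(7)
  obtain f :: "'n \<Rightarrow> real ^ 'n" and l where
    on: "\<And>i j. f i \<bullet> f j = (if i = j then 1 else 0)" and ev: "\<And>i. A *v f i = l i *\<^sub>R f i"
    and ex: "\<And>x. x = (\<Sum>i\<in>UNIV. (x \<bullet> f i) *\<^sub>R f i)"
    using symmetric_matrix_orthonormal_eigenbasis[OF sym] by blast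
  have cp: "charpoly A = (\<Prod>i\<in>UNIV. [:- l i, 1:])"
    by (rule charpoly_orthonormal_eigenbasis[OF on ev])
  have q1: "d \<bullet> (A *v d) = (\<Sum>i\<in>UNIV. d $ i)" if "A *v d = (\<chi> i. 1)" for d
    by (simp add: that inner_vec_def)
  have q1_pos: "d \<bullet> (A *v d) > 0" if "A *v d = (\<chi> i. 1)" "\<And>i. d $ i > 0" for d
    unfolding q1[OF that(1)] using that(2) by (intro sum_pos) auto
  show ?thesis
  proof
    assume L: "?spec \<and> ?hull"
    then obtain \<mu> where \<mu>: "eigenvalue_seq A \<mu>" "\<mu> 1 > 0" "\<And>k. k \<in> {2..CARD('n)} \<Longrightarrow> \<mu> k \<le> 0" by blast
    obtain p where np: "\<And>i. i \<noteq> p \<Longrightarrow> l i \<le> 0"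
      using eigenvalue_seq_imp_one_positive[OF cp \<mu>] by blast
    obtain d where d: "\<And>i. d $ i > 0" and Ad: "A *v d = (\<chi> i. 1)"
      using L constant_in_rel_interior_hull_columns_iff[of A] by blast
    obtain U where U: "least_energy_solution \<Omega> lam U" and pos: "positive_on \<Omega> U"
      using assms(8) by blast
    \<comment> \<open>The inequality relative to d, with <A d, d> and <A d, x> evaluated by A d =
      (1, ..., 1).\<close>
    have rcs: "(x \<bullet> (A *v x)) * (\<Sum>i\<in>UNIV. d $ i) \<le> (\<Sum>i\<in>UNIV. x $ i)\<^sup>2" for x
      using one_positive_reverse_Cauchy_Schwarz[OF sym ev ex np q1_pos[OF Ad d], of p x]
      by (simp add: q1[OF Ad]) (simp add: Ad inner_vec_def)
    let ?c = "\<chi> i. sqrt (d $ i)"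
    have c: "?c $ i > 0" for i using d[of i] by simp
    have c2: "(\<chi> i. (?c $ i)\<^sup>2) = d" using d by (simp add: vec_eq_iff less_imp_le)
    have "positive_on \<Omega> (\<lambda>x. ?c $ i * U x)" for i
      using pos unfolding positive_on_def by (rule eventually_mono) (use c[of i] in simp)
    moreover have "system_solution \<Omega> lam A (\<lambda>i x. ?c $ i * U x)"
      using multiples_solution_iff[OF \<Omega> lam U, of ?c A] c Ad unfolding c2 by (metis less_irrefl)
    ultimately show ?R
      using U minimizer_if_reverse_Cauchy_Schwarz[OF \<Omega> lam U d Ad rcs]
      unfolding Let_def by blast
  next
    assume ?R
    then obtain c :: "real ^ 'n" and U where U: "least_energy_solution \<Omega> lam U"
      and pos: "\<And>i. positive_on \<Omega> (\<lambda>x. c $ i * U x)"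
      and sol: "system_solution \<Omega> lam A (\<lambda>i x. c $ i * U x)"
      and neh: "(\<lambda>i x. c $ i * U x) \<in> nehari \<Omega> lam A"
      and min: "energy \<Omega> lam A (\<lambda>i x. c $ i * U x) = Mval \<Omega> lam A"
      unfolding Let_def by blast
    \<comment> \<open>Not c_i > 0: here \<open>U\<close> is not known to be positive, and
      \<open>U\<close> and all c_i could be negative together. Only the squares c_i^2
      matter.\<close>
    have c: "c $ i \<noteq> 0" for i
      using positive_on_imp_ex_pos[OF \<Omega> assms(4) pos[of i]] by auto
    define d where "d = (\<chi> i. (c $ i)\<^sup>2)"
    have d: "d $ i > 0" for i using c[of i] by (simp add: d_def)
    have Ad: "A *v d = (\<chi> i. 1)"
      using multiples_solution_iff[OF \<Omega> lam U c, of A] sol by (simp add: d_def)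
    have neg: "x \<bullet> (A *v x) \<le> 0" if "x \<bullet> (\<chi> i. 1) = 0" for x
      using hyperplane_nonpos_if_minimizer[OF \<Omega> lam U sym c Ad[unfolded d_def] neh min that] .
    obtain p where p: "l p > 0" "\<And>i. i \<noteq> p \<Longrightarrow> l i \<le> 0"
      using nonpos_on_hyperplane_imp_one_positive[OF on ev ex neg q1_pos[OF Ad d]] by blast
    have ?spec by (rule one_positive_imp_eigenvalue_seq[OF cp p])
    moreover have ?hull
      using constant_in_rel_interior_hull_columns_iff[of A] d Ad by blast
    ultimately show "?spec \<and> ?hull" ..
  qed
qed

end
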